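(* Let $a_1,\dots,a_6$ be non-negative integers, not all zero, such that $a_1+a_6\ge\max\{a_2+a_5,\ a_3+a_4\}$, and let $C=C(a_1,\dots,a_6)$ be the tetrahedral curve with defining ideal $I\subset R=K[x_1,x_2,x_3,x_4]$. Let $$\mathcal A=\max\{a_2+a_5,\ a_3+a_4,\ a_2+a_4-a_6+1,\ a_3+a_5-a_6+1,\ a_2+a_3-a_1+1,\ a_4+a_5-a_1+1\}.$$ Assume that $C$ is not arithmetically Cohen-Macaulay. Then $a_1+a_6-2\ge\mathcal A$ and $$k(R/I)=\operatorname{diam}(H^1_{\mathfrak m}(R/I))=a_1+a_6-\mathcal A-1.$$ In particular, $H^1_{\mathfrak m}(R/I)$ has no gap.
   Context: $K$ is a field, $R=K[x_1,x_2,x_3,x_4]$ with the standard grading, $\mathfrak m=(x_1,x_2,x_3,x_4)$. For non-negative integers $a_1,\dots,a_6$, not all zero, the tetrahedral curve $C=C(a_1,\dots,a_6)$ is the curve in $\mathbb P^3$ defined by the ideal $$I=(x_1,x_2)^{a_1}\cap(x_1,x_3)^{a_2}\cap(x_1,x_4)^{a_3}\cap(x_2,x_3)^{a_4}\cap(x_2,x_4)^{a_5}\cap(x_3,x_4)^{a_6}$$ of $R$, where $\mathfrak p^0=R$. $C$ is arithmetically Cohen-Macaulay if $R/I$ is a Cohen-Macaulay ring (equivalently $H^1_{\mathfrak m}(R/I)=0$). The first local cohomology module $H^1_{\mathfrak m}(R/I)$ is a graded $R$-module of finite length. For a $\mathbb Z$-graded module $M\neq 0$ of finite length, $\operatorname{diam}(M)=\max\{n\mid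 M_n\ne0\}-\min\{n\mid M_n\neq0\}+1$, and $\operatorname{diam}(0)=0$. $k(R/I)$ is the smallest non-negative integer $k$ such that $\mathfrak m^kH^1_{\mathfrak m}(R/I)=0$ (with $\mathfrak m^0=R$). A non-zero $\mathbb Z$-graded module $M$ has no gap if whenever $M_i\ne0$ and $M_j\neq0$ for some $i\le j$, then $M_k\ne0$ for all $i\le k\le j$. *)

theory Defs
  imports
    "HOL-Algebra.Algebra"
    "HOL-Algebra.Algebraic_Closure_Type"
    "HOL-Library.Poly_Mapping"
    "HOL-Library.Numeral_Type"
    "HOL-Library.Extended_Nat"
begin

section \<open>Cohen-Macaulay rings\<close>

text \<open>
  Depth and codimension (height) of an ideal, and Cohen-Macaulay rings, as in Eisenbud,
  \<^emph>\<open>Commutative Algebra\<close>, Section 18.2: a Noetherian ring is Cohen-Macaulay if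
  depth(P, A) = codim P for every maximal ideal P of A.
\<close>

definition regular_sequence :: "('r, 'x) ring_scheme \<Rightarrow> 'r list \<Rightarrow> bool" where
  "regular_sequence A rs \<longleftrightarrow>
     set rs \<subseteq> carrier A \<and>
     (\<forall>i < length rs. \<forall>a \<in> carrier A.
        rs ! i \<otimes>\<^bsub>A\<^esub> a \<in> genideal A (set (take i rs)) \<longrightarrow> a \<in> genideal A (set (take i rs))) \<and>
     genideal A (set rs) \<noteq> carrier A"

definition ideal_depth :: "('r, 'x) ring_scheme \<Rightarrow> 'r set \<Rightarrow> enat" where
  "ideal_depth A P = Sup {enat (length rs) | rs. regular_sequence A rs \<and> set rs \<subseteq> P}"

definition prime_height :: "('r, 'x) ring_scheme \<Rightarrow> 'r set \<Rightarrow> enat" where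
  "prime_height A P =
     Sup {enat n | n. \<exists>Q :: nat \<Rightarrow> 'r set.
       (\<forall>i \<le> n. primeideal (Q i) A) \<and> (\<forall>i < n. Q i \<subset> Q (Suc i)) \<and> Q n = P}"

definition cohen_macaulay_ring :: "('r, 'x) ring_scheme \<Rightarrow> bool" where
  "cohen_macaulay_ring A \<longleftrightarrow>
     cring A \<and> noetherian_ring A \<and>
     (\<forall>P. maximalideal P A \<longrightarrow> ideal_depth A P = prime_height A P)"


section \<open>Modules\<close>

text \<open>
  The type \<^typ>\<open>('r, 'm) module\<close> extends that of rings, so its records have the fields
  \<^const>\<open>monoid.mult\<close> and \<^const>\<open>one\<close>; these play no role for a module.
\<close>

definition self_module :: "('r, 'x) ring_scheme \<Rightarrow> ('r, 'r) module" where
  "self_module R = \<lparr>carrier = carrier R, monoid.mult = undefined, one = undefined,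
     ring.zero = \<zero>\<^bsub>R\<^esub>, add = (\<oplus>\<^bsub>R\<^esub>), module.smult = (\<otimes>\<^bsub>R\<^esub>)\<rparr>"

text \<open>The subquotient \<open>Z / B\<close> for submodules \<open>B \<subseteq> Z\<close> of \<open>M\<close>; its elements are cosets of \<open>B\<close>.\<close>

definition subquotient :: "('r, 'm) module \<Rightarrow> 'm set \<Rightarrow> 'm set \<Rightarrow> ('r, 'm set) module" where
  "subquotient M Z B = \<lparr>carrier = (\<lambda>z. B +>\<^bsub>M\<^esub> z) ` Z, monoid.mult = undefined, one = undefined,
     ring.zero = B, add = set_add M, module.smult = (\<lambda>r S. \<Union>z\<in>S. B +>\<^bsub>M\<^esub> (r \<odot>\<^bsub>M\<^esub> z))\<rparr>"

definition direct_product :: "('i \<Rightarrow> ('r, 'm) module) \<Rightarrow> ('r, 'i \<Rightarrow> 'm) module" where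
  "direct_product N = \<lparr>carrier = {c. \<forall>i. c i \<in> carrier (N i)},
     monoid.mult = undefined, one = undefined,
     ring.zero = (\<lambda>i. \<zero>\<^bsub>N i\<^esub>), add = (\<lambda>c d i. c i \<oplus>\<^bsub>N i\<^esub> d i), module.smult = (\<lambda>r c i. r \<odot>\<^bsub>N i\<^esub> c i)\<rparr>"


subsection \<open>Localization at the powers of an element\<close>

text \<open>\<open>loc_frac R M f m k\<close> is the fraction \<open>m / f^k\<close>, an element of \<open>M\<^sub>f\<close>.\<close>

definition frac_rel :: "('r, 'x) ring_scheme \<Rightarrow> ('r, 'm) module \<Rightarrow> 'r \<Rightarrow>
    (('m \<times> nat) \<times> ('m \<times> nat)) set" where
  "frac_rel R M f = {((m, k), (n, l)). m \<in> carrier M \<and> n \<in> carrier M \<and>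
     (\<exists>t :: nat. (f [^]\<^bsub>R\<^esub> (t + l)) \<odot>\<^bsub>M\<^esub> m = (f [^]\<^bsub>R\<^esub> (t + k)) \<odot>\<^bsub>M\<^esub> n)}"

definition loc_frac :: "('r, 'x) ring_scheme \<Rightarrow> ('r, 'm) module \<Rightarrow> 'r \<Rightarrow> 'm \<Rightarrow> nat \<Rightarrow>
    ('m \<times> nat) set" where
  "loc_frac R M f m k = frac_rel R M f `` {(m, k)}"

definition localization :: "('r, 'x) ring_scheme \<Rightarrow> ('r, 'm) module \<Rightarrow> 'r \<Rightarrow>
    ('r, ('m \<times> nat) set) module" where
  "localization R M f = \<lparr>carrier = {loc_frac R M f m k | m k. m \<in> carrier M},
     monoid.mult = undefined, one = undefined,
     ring.zero = loc_frac R M f \<zero>\<^bsub>M\<^esub> 0,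
     add = (\<lambda>S T. \<Union>(m, k)\<in>S. \<Union>(n, l)\<in>T.
       loc_frac R M f (((f [^]\<^bsub>R\<^esub> l) \<odot>\<^bsub>M\<^esub> m) \<oplus>\<^bsub>M\<^esub> ((f [^]\<^bsub>R\<^esub> k) \<odot>\<^bsub>M\<^esub> n)) (k + l)),
     module.smult = (\<lambda>r S. \<Union>(m, k)\<in>S. loc_frac R M f (r \<odot>\<^bsub>M\<^esub> m) k)\<rparr>"

text \<open>The canonical map \<open>M\<^sub>f \<rightarrow> M\<^sub>f\<^sub>g\<close>, which sends \<open>m / f^k\<close> to \<open>g^k m / (f g)^k\<close>.\<close>

definition loc_map :: "('r, 'x) ring_scheme \<Rightarrow> ('r, 'm) module \<Rightarrow> 'r \<Rightarrow> 'r \<Rightarrow>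
    ('m \<times> nat) set \<Rightarrow> ('m \<times> nat) set" where
  "loc_map R M f g S = (\<Union>(m, k)\<in>S. loc_frac R M (f \<otimes>\<^bsub>R\<^esub> g) ((g [^]\<^bsub>R\<^esub> k) \<odot>\<^bsub>M\<^esub> m) k)"


subsection \<open>The first local cohomology module\<close>

text \<open>
  For a Noetherian ring \<open>R\<close>, an \<open>R\<close>-module \<open>M\<close> and a finite family \<open>x\<close> of elements of \<open>R\<close>, the first
  local cohomology module of \<open>M\<close> with support in the ideal generated by \<open>x\<close> is the first cohomology
  of the Cech complex \<open>0 \<rightarrow> M \<rightarrow> \<Prod>\<^sub>i M\<^sub>x\<^sub>i \<rightarrow> \<Prod>\<^sub>i\<^sub>j M\<^sub>x\<^sub>i\<^sub>x\<^sub>j \<rightarrow> \<dots>\<close>.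
  A cochain \<open>c\<close> is a cocycle if \<open>c\<^sub>i\<close> and \<open>c\<^sub>j\<close> have the same image in \<open>M\<^sub>x\<^sub>i\<^sub>x\<^sub>j\<close> for all \<open>i, j\<close>
  (for \<open>i = j\<close> this holds trivially, and it is symmetric in \<open>i\<close> and \<open>j\<close>).
\<close>

definition cech_cochains :: "('r, 'x) ring_scheme \<Rightarrow> ('r, 'm) module \<Rightarrow> ('i::finite \<Rightarrow> 'r) \<Rightarrow>
    ('r, 'i \<Rightarrow> ('m \<times> nat) set) module" where
  "cech_cochains R M x = direct_product (\<lambda>i. localization R M (x i))"

definition cech_cocycles :: "('r, 'x) ring_scheme \<Rightarrow> ('r, 'm) module \<Rightarrow> ('i::finite \<Rightarrow> 'r) \<Rightarrow>
    ('i \<Rightarrow> ('m \<times> nat) set) set" where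
  "cech_cocycles R M x = {c \<in> carrier (cech_cochains R M x).
     \<forall>i j. loc_map R M (x i) (x j) (c i) = loc_map R M (x j) (x i) (c j)}"

definition cech_coboundaries :: "('r, 'x) ring_scheme \<Rightarrow> ('r, 'm) module \<Rightarrow> ('i::finite \<Rightarrow> 'r) \<Rightarrow>
    ('i \<Rightarrow> ('m \<times> nat) set) set" where
  "cech_coboundaries R M x = (\<lambda>m i. loc_frac R M (x i) m 0) ` carrier M"

definition local_cohomology1 :: "('r, 'x) ring_scheme \<Rightarrow> ('r, 'm) module \<Rightarrow> ('i::finite \<Rightarrow> 'r) \<Rightarrow>
    ('r, ('i \<Rightarrow> ('m \<times> nat) set) set) module" where
  "local_cohomology1 R M x =
     subquotient (cech_cochains R M x) (cech_cocycles R M x) (cech_coboundaries R M x)"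

text \<open>
  The gradings induced by a grading \<open>G\<close> of \<open>M\<close> (\<open>G n\<close> is the component of degree \<open>n\<close>), where \<open>f\<close>
  and all \<open>x i\<close> are homogeneous of degree 1: \<open>m / f^k\<close> has degree \<open>n\<close> if \<open>m\<close> has degree \<open>n + k\<close>.
\<close>

definition localization_component :: "('r, 'x) ring_scheme \<Rightarrow> ('r, 'm) module \<Rightarrow> (int \<Rightarrow> 'm set) \<Rightarrow>
    'r \<Rightarrow> int \<Rightarrow> ('m \<times> nat) set set" where
  "localization_component R M G f n = {loc_frac R M f m k | m k. m \<in> G (n + int k)}"

definition local_cohomology1_component :: "('r, 'x) ring_scheme \<Rightarrow> ('r, 'm) module \<Rightarrow>
    (int \<Rightarrow> 'm set) \<Rightarrow> ('i::finite \<Rightarrow> 'r) \<Rightarrow> int \<Rightarrow> ('i \<Rightarrow> ('m \<times> nat) set) set set" where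
  "local_cohomology1_component R M G x n =
     (\<lambda>c. cech_coboundaries R M x +>\<^bsub>cech_cochains R M x\<^esub> c) `
       {c \<in> cech_cocycles R M x. \<forall>i. c i \<in> localization_component R M G (x i) n}"


subsection \<open>Graded modules of finite length\<close>

text \<open>
  Here \<open>G n\<close> is the component of degree \<open>n\<close> of \<open>M\<close>.
  The diameter is only meaningful if \<open>M\<close> has finite length, so that the set of degrees is finite.
\<close>

definition nonzero_degrees :: "('r, 'm) module \<Rightarrow> (int \<Rightarrow> 'm set) \<Rightarrow> int set" where
  "nonzero_degrees M G = {n. G n \<noteq> {\<zero>\<^bsub>M\<^esub>}}"

definition diam :: "('r, 'm) module \<Rightarrow> (int \<Rightarrow> 'm set) \<Rightarrow> int" where
  "diam M G = (if carrier M = {\<zero>\<^bsub>M\<^esub>} then 0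
     else Max (nonzero_degrees M G) - Min (nonzero_degrees M G) + 1)"

definition has_no_gap :: "('r, 'm) module \<Rightarrow> (int \<Rightarrow> 'm set) \<Rightarrow> bool" where
  "has_no_gap M G \<longleftrightarrow> carrier M \<noteq> {\<zero>\<^bsub>M\<^esub>} \<and>
     (\<forall>i \<in> nonzero_degrees M G. \<forall>j \<in> nonzero_degrees M G. {i..j} \<subseteq> nonzero_degrees M G)"

text \<open>Powers of ideals are powers in \<^const>\<open>ideals_set\<close>; in particular \<open>\<aa>^0 = R\<close>.\<close>

definition ideal_power :: "('r, 'x) ring_scheme \<Rightarrow> 'r set \<Rightarrow> nat \<Rightarrow> 'r set" where
  "ideal_power R \<aa> n = \<aa> [^]\<^bsub>ideals_set R\<^esub> n"

definition least_annihilating_power :: "('r, 'x) ring_scheme \<Rightarrow> 'r set \<Rightarrow> ('r, 'm) module \<Rightarrow> nat" where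
  "least_annihilating_power R \<aa> M =
     (LEAST k. \<forall>r \<in> ideal_power R \<aa> k. \<forall>h \<in> carrier M. r \<odot>\<^bsub>M\<^esub> h = \<zero>\<^bsub>M\<^esub>)"


section \<open>Tetrahedral curves\<close>

text \<open>
  Monomials are exponent vectors. The variables are indexed by \<open>1, 2, 3, 4\<close> of the four-element
  type \<^typ>\<open>4\<close> (in which \<open>4 = 0\<close>).
\<close>

type_synonym 'k poly4 = "(4 \<Rightarrow>\<^sub>0 nat) \<Rightarrow>\<^sub>0 'k"

abbreviation poly_ring :: "('k::field) poly4 ring" where
  "poly_ring \<equiv> ring_of_type_algebra"

definition indet :: "4 \<Rightarrow> ('k::field) poly4" where
  "indet i = Poly_Mapping.single (Poly_Mapping.single i 1) 1"

definition irrelevant_ideal :: "('k::field) poly4 set" where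
  "irrelevant_ideal = genideal poly_ring {indet 1, indet 2, indet 3, indet 4}"

definition homogeneous_component :: "int \<Rightarrow> ('k::field) poly4 set" where
  "homogeneous_component n =
     {p. \<forall>t \<in> Poly_Mapping.keys p. int (\<Sum>i\<in>UNIV. Poly_Mapping.lookup t i) = n}"

definition tetrahedral_ideal ::
    "nat \<Rightarrow> nat \<Rightarrow> nat \<Rightarrow> nat \<Rightarrow> nat \<Rightarrow> nat \<Rightarrow> ('k::field) poly4 set" where
  "tetrahedral_ideal a1 a2 a3 a4 a5 a6 =
     ideal_power poly_ring (genideal poly_ring {indet 1, indet 2}) a1 \<inter>
     ideal_power poly_ring (genideal poly_ring {indet 1, indet 3}) a2 \<inter>
     ideal_power poly_ring (genideal poly_ring {indet 1, indet 4}) a3 \<inter>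
     ideal_power poly_ring (genideal poly_ring {indet 2, indet 3}) a4 \<inter>
     ideal_power poly_ring (genideal poly_ring {indet 2, indet 4}) a5 \<inter>
     ideal_power poly_ring (genideal poly_ring {indet 3, indet 4}) a6"

text \<open>\<open>R/I\<close> as a graded \<open>R\<close>-module, for a homogeneous ideal \<open>I\<close>.\<close>

definition quotient_module :: "('k::field) poly4 set \<Rightarrow> ('k poly4, 'k poly4 set) module" where
  "quotient_module I = subquotient (self_module poly_ring) UNIV I"

definition quotient_component :: "('k::field) poly4 set \<Rightarrow> int \<Rightarrow> 'k poly4 set set" where
  "quotient_component I n = (\<lambda>p. I +>\<^bsub>poly_ring\<^esub> p) ` homogeneous_component n"

definition H1 :: "('k::field) poly4 set \<Rightarrow>
    ('k poly4, (4 \<Rightarrow> ('k poly4 set \<times> nat) set) set) module" where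
  "H1 I = local_cohomology1 poly_ring (quotient_module I) indet"

definition H1_component :: "('k::field) poly4 set \<Rightarrow> int \<Rightarrow>
    (4 \<Rightarrow> ('k poly4 set \<times> nat) set) set set" where
  "H1_component I n =
     local_cohomology1_component poly_ring (quotient_module I) (quotient_component I) indet n"

definition k_invariant :: "('k::field) poly4 set \<Rightarrow> nat" where
  "k_invariant I = least_annihilating_power poly_ring irrelevant_ideal (H1 I)"

definition arithmetically_cohen_macaulay :: "('k::field) poly4 set \<Rightarrow> bool" where
  "arithmetically_cohen_macaulay I \<longleftrightarrow> cohen_macaulay_ring (poly_ring Quot I)"

end

theory Submission
  imports Defs
begin

text \<open>
  The ideal \<open>I\<close> is spanned by monomials, so the first local cohomology of \<open>R/I\<close> can be computed one multidegree
  at a time from the Cech complex. For a monomial \<open>x\<^sup>b\<close>, call a line \<open>x\<^sub>j = x\<^sub>k = 0\<close> violated if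
  \<open>b\<^sub>j + b\<^sub>k\<close> is smaller than its exponent, and consider the graph on the indices \<open>1, 2, 3, 4\<close> in which the two
  indices other than \<open>j, k\<close> are joined if this line is violated. The components \<open>z\<^sub>i / x\<^sub>i\<^sup>N\<close> of a cocycle have the same
  coefficient of \<open>x\<^sup>b\<close> at adjacent indices, isolated indices carry no condition, and a coboundary has the same
  coefficient everywhere. So multidegree \<open>b\<close> contributes exactly if the edges of the graph form two components,
  that is, two opposite edges. By the assumption \<open>a\<^sub>1 + a\<^sub>6 \<ge> max (a\<^sub>2 + a\<^sub>5) (a\<^sub>3 + a\<^sub>4)\<close> these
  belong to the violated lines \<open>x\<^sub>1 = x\<^sub>2 = 0\<close> and \<open>x\<^sub>3 = x\<^sub>4 = 0\<close>. Such exponents \<open>b\<close> are called obstructed,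
  and \<open>splits_iff\<close> makes the argument precise. Negative exponents do not contribute (\<open>cocycle_coeff_zero\<close>).

  Thus the cohomology has a basis indexed by the obstructed exponents, on which multiplication by \<open>x\<^sup>g\<close> is the
  translation by \<open>g\<close>. The conditions on an obstructed \<open>b\<close> are \<open>b\<^sub>1 + b\<^sub>2 < a\<^sub>1\<close>, \<open>b\<^sub>3 + b\<^sub>4 < a\<^sub>6\<close> and four lower bounds
  for sums of two coordinates. Raising coordinates respects the lower bounds, so from every obstructed
  exponent one reaches the degree \<open>a\<^sub>1 + a\<^sub>6 - 2\<close> by translation with a single monomial; and the least degree
  is \<open>A\<close> by \<open>tetra_region_descent\<close>. So the degrees form the interval from \<open>A\<close> to \<open>a\<^sub>1 + a\<^sub>6 - 2\<close>, and a monomial of degree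
  \<open>a\<^sub>1 + a\<^sub>6 - 2 - A\<close> acts non-trivially. This gives all claims (\<open>invariants_if_obstructed\<close>) once an
  obstructed exponent exists.

  It remains to show that \<open>R/I\<close> is Cohen-Macaulay if there is none (\<open>cohen_macaulay_if_unobstructed\<close>), with all
  maximal ideals \<open>P\<close> taken into account and over an arbitrary field. The depth never exceeds the height
  (\<open>ideal_depth_le_prime_height\<close>). The height is at most two, since every prime ideal over \<open>I\<close> contains
  some \<open>(x\<^sub>p, x\<^sub>q)\<close> and three polynomials are algebraically dependent modulo this ideal
  (\<open>no_prime_chain_of_length_three\<close>). Finally, \<open>P\<close> contains a regular sequence of length two. If \<open>P\<close> does not contain
  \<open>x\<^sub>l\<close>, this is easy: by Zariski's lemma \<open>P\<close> contains a polynomial in \<open>x\<^sub>l\<close> alone with non-zero constant term, and this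
  is regular modulo every ideal that is homogeneous in \<open>x\<^sub>l\<close>. If \<open>P\<close> contains all variables, then the
  first two elementary symmetric polynomials are a regular sequence; here the vanishing of the
  cohomology is needed.
\<close>

section \<open>Polynomials and their monomials\<close>

lemma exhaust_four:
  fixes i :: 4
  shows "i = 1 \<or> i = 2 \<or> i = 3 \<or> i = 4"
proof (induct i)
  case (of_int z)
  then have "z = 0 \<or> z = 1 \<or> z = 2 \<or> z = 3"
    by auto
  then show ?case
    by auto
qed

lemma UNIV_four: "(UNIV :: 4 set) = {1, 2, 3, 4}"
  using exhaust_four by auto

lemma all_four: "(\<forall>i :: 4. P i) \<longleftrightarrow> P 1 \<and> P 2 \<and> P 3 \<and> P 4"
  by (metis exhaust_four)

lemma four_distinct [simp]:
  "(1::4) \<noteq> 2" "(1::4) \<noteq> 3" "(1::4) \<noteq> 4" "(2::4) \<noteq> 3" "(2::4) \<noteq> 4" "(3::4) \<noteq> 4"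
  "(2::4) \<noteq> 1" "(3::4) \<noteq> 1" "(4::4) \<noteq> 1" "(3::4) \<noteq> 2" "(4::4) \<noteq> 2" "(4::4) \<noteq> 3"
  by simp_all

lemma sum_four: "(\<Sum>i\<in>(UNIV :: 4 set). f i) = f 1 + f 2 + f 3 + f 4"
proof -
  have "(4::4) = 0" by simp
  then show ?thesis
    unfolding UNIV_four by (simp add: ac_simps del: four_distinct)
qed


abbreviation lookup where "lookup \<equiv> Poly_Mapping.lookup"
abbreviation keys where "keys \<equiv> Poly_Mapping.keys"
abbreviation single where "single \<equiv> Poly_Mapping.single"

lemma ring_of_type_algebra_simps [simp]:
  "carrier (ring_of_type_algebra :: 'a::comm_ring_1 ring) = UNIV"
  "x \<otimes>\<^bsub>ring_of_type_algebra\<^esub> y = x * (y::'a)"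
  "\<one>\<^bsub>ring_of_type_algebra\<^esub> = (1::'a)"
  "\<zero>\<^bsub>ring_of_type_algebra\<^esub> = (0::'a)"
  "x \<oplus>\<^bsub>ring_of_type_algebra\<^esub> y = x + (y::'a)"
  by (simp_all add: ring_of_type_algebra_def)

lemma ring_of_type_algebra_pow [simp]:
  "x [^]\<^bsub>ring_of_type_algebra\<^esub> (n::nat) = (x::'a::comm_ring_1) ^ n"
  by (induction n) (simp_all add: nat_pow_def ring_of_type_algebra_def mult.commute)

lemma ideal_type_algebra_iff:
  "ideal J (ring_of_type_algebra :: 'a::comm_ring_1 ring) \<longleftrightarrow>
    0 \<in> J \<and> (\<forall>a\<in>J. \<forall>b\<in>J. a + b \<in> J) \<and> (\<forall>a\<in>J. \<forall>r. r * a \<in> J)"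
proof
  assume "ideal J (ring_of_type_algebra :: 'a ring)"
  then interpret ideal J "ring_of_type_algebra :: 'a ring" .
  show "0 \<in> J \<and> (\<forall>a\<in>J. \<forall>b\<in>J. a + b \<in> J) \<and> (\<forall>a\<in>J. \<forall>r. r * a \<in> J)"
    using additive_subgroup.zero_closed[OF is_additive_subgroup]
      additive_subgroup.a_closed[OF is_additive_subgroup] I_l_closed by simp
next
  assume J: "0 \<in> J \<and> (\<forall>a\<in>J. \<forall>b\<in>J. a + b \<in> J) \<and> (\<forall>a\<in>J. \<forall>r. r * a \<in> J)"
  interpret cring "ring_of_type_algebra :: 'a ring" by auto
  have inv: "\<ominus>\<^bsub>ring_of_type_algebra\<^esub> a = - a" for a :: 'a
    by (rule minus_equality) auto
  show "ideal J (ring_of_type_algebra :: 'a ring)"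
  proof (rule idealI)
    show "subgroup J (add_monoid (ring_of_type_algebra :: 'a ring))"
    proof (rule add.subgroupI)
      show "\<ominus>\<^bsub>ring_of_type_algebra\<^esub> a \<in> J" if "a \<in> J" for a
        using J that inv[of a] by (metis mult_minus1)
    qed (use J in \<open>auto simp: ring_of_type_algebra_def\<close>)
  qed (use J in \<open>auto simp: mult.commute ring_axioms\<close>)
qed

context
  fixes J :: "'a::comm_ring_1 set"
  assumes J: "ideal J ring_of_type_algebra"
begin

lemma ideal_0: "0 \<in> J"
  using J unfolding ideal_type_algebra_iff by blast

lemma ideal_add: "a \<in> J \<Longrightarrow> b \<in> J \<Longrightarrow> a + b \<in> J"
  using J unfolding ideal_type_algebra_iff by blast

lemma ideal_mult_left: "a \<in> J \<Longrightarrow> r * a \<in> J"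
  using J unfolding ideal_type_algebra_iff by blast

lemma ideal_mult_right: "a \<in> J \<Longrightarrow> a * r \<in> J"
  using ideal_mult_left[of a r] by (simp add: mult.commute)

lemma ideal_uminus: "a \<in> J \<Longrightarrow> - a \<in> J"
  using ideal_mult_left[of a "-1"] by simp

lemma ideal_diff: "a \<in> J \<Longrightarrow> b \<in> J \<Longrightarrow> a - b \<in> J"
  using ideal_add[of a "- b"] ideal_uminus by simp

lemma ideal_sum: "(\<And>x. x \<in> A \<Longrightarrow> f x \<in> J) \<Longrightarrow> sum f A \<in> J"
  by (induction A rule: infinite_finite_induct) (auto intro: ideal_0 ideal_add)

lemma ideal_diff_cancel: "a - b \<in> J \<Longrightarrow> b \<in> J \<Longrightarrow> a \<in> J"
  using ideal_add[of "a - b" b] by simp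

end

lemma ideal_sum_principal:
  assumes "ideal J (ring_of_type_algebra :: 'a::comm_ring_1 ring)"
  shows "ideal {p + f * q | p q. p \<in> J} (ring_of_type_algebra :: 'a ring)"
  unfolding ideal_type_algebra_iff
proof (intro conjI ballI allI)
  show "0 \<in> {p + f * q |p q. p \<in> J}"
    using ideal_0[OF assms] by (intro CollectI exI[of _ 0]) simp
next
  fix a b assume "a \<in> {p + f * q |p q. p \<in> J}" "b \<in> {p + f * q |p q. p \<in> J}"
  then obtain p q p' q' where "a = p + f * q" "b = p' + f * q'" "p \<in> J" "p' \<in> J"
    by auto
  then show "a + b \<in> {p + f * q |p q. p \<in> J}"
    using ideal_add[OF assms] by (intro CollectI exI[of _ "p + p'"] exI[of _ "q + q'"])
      (simp add: algebra_simps)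
next
  fix a r assume "a \<in> {p + f * q |p q. p \<in> J}"
  then obtain p q where "a = p + f * q" "p \<in> J"
    by auto
  then show "r * a \<in> {p + f * q |p q. p \<in> J}"
    using ideal_mult_left[OF assms] by (intro CollectI exI[of _ "r * p"] exI[of _ "r * q"])
      (simp add: algebra_simps)
qed

lemma lookup_single_times:
  fixes p :: "('a::cancel_comm_monoid_add) \<Rightarrow>\<^sub>0 'b::comm_semiring_1"
  shows "lookup (single g c * p) (g + s) = c * lookup p s"
proof -
  have "lookup (single g c * p) (g + s) = (\<Sum>l. lookup (single g c) l * (\<Sum>q. lookup p q when g + s = l + q))"
    by (simp add: lookup_mult)
  also have "\<dots> = (\<Sum>l. c * lookup p s when l = g)"
  proof (rule Sum_any.cong)
    fix l
    show "lookup (single g c) l * (\<Sum>q. lookup p q when g + s = l + q) = (c * lookup p s when l = g)"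
      by (cases "l = g") (auto simp: lookup_single)
  qed
  finally show ?thesis by simp
qed

lemma lookup_single_times_outside:
  fixes p :: "('a::comm_monoid_add) \<Rightarrow>\<^sub>0 'b::comm_semiring_1"
  assumes "\<nexists>s'. s = g + s'"
  shows "lookup (single g c * p) s = 0"
proof -
  have "s \<notin> keys (single g c * p)"
    using assms keys_mult[of "single g c" p] by (auto split: if_splits)
  then show ?thesis
    by (simp add: in_keys_iff)
qed

lemma exponent_diff:
  fixes g s :: "'i \<Rightarrow>\<^sub>0 nat"
  assumes "\<And>i. lookup g i \<le> lookup s i"
  obtains s' where "s = g + s'"
proof
  show "s = g + (s - g)"
    by (rule poly_mapping_eqI) (simp add: lookup_add lookup_minus assms)
qed

lemma poly_mapping_sum_single:
  fixes p :: "'a \<Rightarrow>\<^sub>0 'b::comm_monoid_add"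
  shows "p = (\<Sum>t\<in>keys p. single t (lookup p t))"
proof (rule poly_mapping_eqI)
  fix s
  show "lookup p s = lookup (\<Sum>t\<in>keys p. single t (lookup p t)) s"
    by (simp add: lookup_sum lookup_single when_def in_keys_iff)
qed

lemma poly_mapping_single_induct [case_names zero single_add]:
  fixes p :: "'a \<Rightarrow>\<^sub>0 'b::comm_monoid_add"
  assumes "P 0" "\<And>t c p. P p \<Longrightarrow> P (single t c + p)"
  shows "P p"
proof -
  have "P (\<Sum>t\<in>A. single t (lookup p t))" if "finite A" for A
    using that by induction (auto intro: assms)
  then show ?thesis
    using poly_mapping_sum_single[of p] by (metis finite_keys)
qed

lemma keys_single_times: "t \<in> keys (single g c * p) \<Longrightarrow> \<exists>s\<in>keys p. t = g + s"
  using keys_mult[of "single g c" p] by (auto split: if_splits)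

lemma indet_power: "indet i ^ n = single (single i n) 1"
  by (induction n) (simp_all add: indet_def mult_single single_add [symmetric] mult.commute flip: single_one)

lemma lookup_indet_power_times:
  "lookup (indet i ^ n * p) (single i n + s) = lookup p s"
  "lookup s i < n \<Longrightarrow> lookup (indet i ^ n * p) s = 0"
proof -
  show "lookup (indet i ^ n * p) (single i n + s) = lookup p s"
    by (simp add: indet_power lookup_single_times)
  show "lookup (indet i ^ n * p) s = 0" if "lookup s i < n"
    unfolding indet_power
    by (rule lookup_single_times_outside) (use that in \<open>auto simp: lookup_add lookup_single\<close>)
qed

section \<open>Powers of ideals generated by variables\<close>

definition weight :: "4 set \<Rightarrow> (4 \<Rightarrow>\<^sub>0 nat) \<Rightarrow> nat" where
  "weight V t = (\<Sum>i\<in>V. lookup t i)"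

lemma weight_add: "weight V (s + t) = weight V s + weight V t"
  by (simp add: weight_def lookup_add sum.distrib)

lemma weight_single: "weight V (single i n) = (if i \<in> V then n else 0)"
  by (simp add: weight_def lookup_single when_def)

lemma weight_pos_split:
  assumes "weight V t \<ge> Suc n"
  obtains i s where "i \<in> V" "t = single i 1 + s" "weight V s \<ge> n"
proof -
  from assms obtain i where i: "i \<in> V" "lookup t i \<noteq> 0"
    unfolding weight_def by (metis Suc_le_lessD not_less0 sum.neutral)
  then obtain s where s: "t = single i 1 + s"
    by (elim exponent_diff[rotated]) (auto simp: lookup_single when_def)
  then show thesis
    using that[of i s] i assms by (simp add: weight_add weight_single)
qed

text \<open>
  The power \<open>(x\<^sub>i | i \<in> V)\<^sup>a\<close>, by \<open>ideal_power_indets\<close> below.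
\<close>

definition weight_ideal :: "4 set \<Rightarrow> nat \<Rightarrow> ('k::field) poly4 set" where
  "weight_ideal V a = {p. \<forall>t\<in>keys p. a \<le> weight V t}"

lemma ideal_monomial_set:
  fixes T :: "(4 \<Rightarrow>\<^sub>0 nat) set"
  assumes "\<And>s t. s \<in> T \<Longrightarrow> t + s \<in> T"
  shows "ideal {p :: 'k::field poly4. keys p \<subseteq> T} poly_ring"
  unfolding ideal_type_algebra_iff
proof (intro conjI ballI allI)
  show "a + b \<in> {p. keys p \<subseteq> T}" if "a \<in> {p. keys p \<subseteq> T}" "b \<in> {p. keys p \<subseteq> T}" for a b :: "'k poly4"
    using that keys_add[of a b] by auto
  show "r * a \<in> {p. keys p \<subseteq> T}" if "a \<in> {p. keys p \<subseteq> T}" for a r :: "'k poly4"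
    using that keys_mult[of r a] assms by blast
qed simp

lemma ideal_weight_ideal: "ideal (weight_ideal V a :: ('k::field) poly4 set) poly_ring"
proof -
  have "(weight_ideal V a :: 'k poly4 set) = {p. keys p \<subseteq> {t. a \<le> weight V t}}"
    by (auto simp: weight_ideal_def)
  then show ?thesis
    using ideal_monomial_set[of "{t. a \<le> weight V t}"] by (simp add: weight_add)
qed

lemma indet_in_weight_ideal: "i \<in> V \<Longrightarrow> indet i \<in> weight_ideal V 1"
  by (simp add: weight_ideal_def indet_def weight_single)

lemma ideal_contains_monomials:
  fixes J :: "'k::field poly4 set"
  assumes J: "ideal J poly_ring" and "\<And>t. t \<in> keys p \<Longrightarrow> single t 1 \<in> J"
  shows "p \<in> J"
proof -
  have "single t (lookup p t) \<in> J" if "t \<in> keys p" for t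
    using ideal_mult_left[OF J assms(2)[OF that], of "single 0 (lookup p t)"] by (simp add: mult_single)
  then show ?thesis
    by (subst poly_mapping_sum_single) (rule ideal_sum[OF J])
qed

lemma genideal_indets: "genideal poly_ring (indet ` V) = (weight_ideal V 1 :: ('k::field) poly4 set)"
proof
  interpret cring "poly_ring :: 'k poly4 ring" by auto
  show "genideal poly_ring (indet ` V) \<subseteq> (weight_ideal V 1 :: 'k poly4 set)"
    by (rule genideal_minimal[OF ideal_weight_ideal]) (use indet_in_weight_ideal in auto)
  show "weight_ideal V 1 \<subseteq> genideal poly_ring (indet ` V :: 'k poly4 set)" (is "_ \<subseteq> ?J")
  proof
    fix p :: "'k poly4" assume p: "p \<in> weight_ideal V 1"
    have J: "ideal ?J poly_ring"
      by (rule genideal_ideal) simp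
    show "p \<in> ?J"
    proof (rule ideal_contains_monomials[OF J])
      fix t assume "t \<in> keys p"
      then have "weight V t \<ge> Suc 0"
        using p by (auto simp: weight_ideal_def)
      then obtain i s where i: "i \<in> V" "t = single i 1 + s"
        by (rule weight_pos_split)
      have "indet i \<in> ?J"
        using i(1) genideal_self[of "indet ` V"] by auto
      from ideal_mult_right[OF J this, of "single s 1"]
      show "single t 1 \<in> ?J"
        by (simp add: i(2) indet_def mult_single)
    qed
  qed
qed

text \<open>
  In the induction step, a monomial of weight at least \<open>a + 1\<close> is a variable from \<open>V\<close> times a monomial of
  weight at least \<open>a\<close>; conversely, weights add up in products.
\<close>

lemma ideal_power_indets:
  "ideal_power poly_ring (genideal poly_ring (indet ` V)) a = (weight_ideal V a :: ('k::field) poly4 set)"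
proof (induction a)
  case 0
  show ?case
    by (auto simp: ideal_power_def weight_ideal_def ideals_set_def)
next
  case (Suc a)
  interpret cring "poly_ring :: 'k poly4 ring" by auto
  let ?P = "ideal_prod poly_ring (weight_ideal V a) (weight_ideal V 1 :: 'k poly4 set)"
  have P: "ideal ?P poly_ring"
    by (intro ideal_prod_is_ideal ideal_weight_ideal)
  have "ideal_power poly_ring (genideal poly_ring (indet ` V)) (Suc a) = ?P"
    using Suc by (simp add: ideal_power_def genideal_indets ideals_set_def)
  also have "?P = weight_ideal V (Suc a)"
  proof
    show "?P \<subseteq> weight_ideal V (Suc a)"
    proof
      fix p assume "p \<in> ?P"
      then show "p \<in> weight_ideal V (Suc a)"
      proof induction
        case (prod i j)
        then show ?case
          using keys_mult[of i j] by (force simp: weight_ideal_def weight_add)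
      next
        case (sum s t)
        then show ?case
          using ideal_add[OF ideal_weight_ideal] by simp
      qed
    qed
    show "weight_ideal V (Suc a) \<subseteq> ?P"
    proof
      fix p :: "'k poly4" assume p: "p \<in> weight_ideal V (Suc a)"
      show "p \<in> ?P"
      proof (rule ideal_contains_monomials[OF P])
        fix t assume "t \<in> keys p"
        then have "weight V t \<ge> Suc a"
          using p by (auto simp: weight_ideal_def)
        then obtain i s where i: "i \<in> V" "t = single i 1 + s" "weight V s \<ge> a"
          by (rule weight_pos_split)
        have "single s 1 \<otimes>\<^bsub>poly_ring\<^esub> indet i \<in> ?P"
          by (rule ideal_prod.prod) (use i in \<open>auto simp: weight_ideal_def indet_def weight_single\<close>)
        then show "single t 1 \<in> ?P"
          by (simp add: i(2) indet_def mult_single add.commute)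
      qed
    qed
  qed
  finally show ?case .
qed

text \<open>
  A monomial of the product that arises from only one pair of monomials of the factors cannot cancel.
\<close>

lemma lookup_times_unique:
  fixes p q :: "('a::cancel_comm_monoid_add) \<Rightarrow>\<^sub>0 'b::comm_ring_1"
  assumes "\<And>u v. u \<in> keys p \<Longrightarrow> v \<in> keys q \<Longrightarrow> u + v = s + t \<Longrightarrow> u = s"
  shows "lookup (p * q) (s + t) = lookup p s * lookup q t"
proof -
  define p' where "p' = p - single s (lookup p s)"
  have "s + t \<notin> keys (p' * q)"
  proof
    assume "s + t \<in> keys (p' * q)"
    then obtain u v where uv: "u \<in> keys p'" "v \<in> keys q" "s + t = u + v"
      using keys_mult[of p' q] by blast
    then have "u \<noteq> s" "u \<in> keys p"
      by (auto simp: p'_def in_keys_iff lookup_minus lookup_single when_def split: if_splits)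
    with assms uv show False by metis
  qed
  moreover have "p * q = single s (lookup p s) * q + p' * q"
    by (simp add: p'_def algebra_simps)
  ultimately show ?thesis
    by (simp add: lookup_add lookup_single_times in_keys_iff)
qed

text \<open>
  The ideal of a coordinate subspace is prime, and its powers are primary. To see this, compare the
  monomials of least weight that are least among these in the monomial order: their product does not
  cancel.
\<close>

lemma weight_ideal_primary:
  fixes s w :: "('k::field) poly4"
  assumes sw: "s * w \<in> weight_ideal V a" and s: "s \<notin> weight_ideal V 1"
  shows "w \<in> weight_ideal V a"
proof (rule ccontr)
  assume w: "w \<notin> weight_ideal V a"
  define d where "d = Min (weight V ` keys w)"
  define t where "t = Min {t \<in> keys w. weight V t = d}"
  define u where "u = Min {u \<in> keys s. weight V u = 0}"
  have "keys w \<noteq> {}"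
    using w by (auto simp: weight_ideal_def)
  then have "d \<in> weight V ` keys w"
    unfolding d_def by (intro Min_in) auto
  then have "t \<in> {t \<in> keys w. weight V t = d}"
    unfolding t_def by (intro Min_in) auto
  moreover have "u \<in> {u \<in> keys s. weight V u = 0}"
    unfolding u_def using s by (intro Min_in) (auto simp: weight_ideal_def)
  ultimately have t: "t \<in> keys w" "weight V t = d" and u: "u \<in> keys s" "weight V u = 0"
    by auto
  have d_le: "d \<le> weight V t'" if "t' \<in> keys w" for t'
    unfolding d_def using that by simp
  have t_le: "t \<le> t'" if "t' \<in> keys w" "weight V t' = d" for t'
    unfolding t_def using that by simp
  have u_le: "u \<le> u'" if "u' \<in> keys s" "weight V u' = 0" for u'
    unfolding u_def using that by simp
  have "lookup (s * w) (u + t) = lookup s u * lookup w t"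
  proof (rule lookup_times_unique)
    fix u' t' assume *: "u' \<in> keys s" "t' \<in> keys w" "u' + t' = u + t"
    then have "weight V u' + weight V t' = d"
      by (metis t(2) u(2) weight_add add_0)
    with d_le[OF *(2)] have "weight V u' = 0" "weight V t' = d"
      by simp_all
    then have "u \<le> u'" "t \<le> t'"
      using * t_le u_le by simp_all
    with *(3) show "u' = u"
      by (metis add_less_le_mono order_le_less less_irrefl)
  qed
  then have "u + t \<in> keys (s * w)"
    using t u by (simp add: in_keys_iff)
  then have "a \<le> d"
    using sw t u by (auto simp: weight_ideal_def weight_add)
  with d_le w show False
    by (force simp: weight_ideal_def)
qed

section \<open>Tetrahedral ideals\<close>

text \<open>
  The exponents are from now on given by a symmetric function \<open>A\<close>: \<open>A i j\<close> belongs to the line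
  \<open>x\<^sub>i = x\<^sub>j = 0\<close>. The ideal is spanned by monomials: it contains the monomial with exponents \<open>t\<close> if \<open>good A t\<close> holds, and
  \<open>bad A t i j\<close> says that the line \<open>x\<^sub>i = x\<^sub>j = 0\<close> is violated.
\<close>

definition line_exponent :: "nat \<Rightarrow> nat \<Rightarrow> nat \<Rightarrow> nat \<Rightarrow> nat \<Rightarrow> nat \<Rightarrow> 4 \<Rightarrow> 4 \<Rightarrow> nat" where
  "line_exponent a1 a2 a3 a4 a5 a6 i j =
    (if {i, j} = {1, 2} then a1 else if {i, j} = {1, 3} then a2 else if {i, j} = {1, 4} then a3
     else if {i, j} = {2, 3} then a4 else if {i, j} = {2, 4} then a5 else a6)"

lemma line_exponent_simps:
  "line_exponent a1 a2 a3 a4 a5 a6 1 2 = a1" "line_exponent a1 a2 a3 a4 a5 a6 1 3 = a2"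
  "line_exponent a1 a2 a3 a4 a5 a6 1 4 = a3" "line_exponent a1 a2 a3 a4 a5 a6 2 3 = a4"
  "line_exponent a1 a2 a3 a4 a5 a6 2 4 = a5" "line_exponent a1 a2 a3 a4 a5 a6 3 4 = a6"
  by (simp_all add: line_exponent_def doubleton_eq_iff)

lemma line_exponent_sym: "line_exponent a1 a2 a3 a4 a5 a6 i j = line_exponent a1 a2 a3 a4 a5 a6 j i"
  by (simp add: line_exponent_def insert_commute)

definition bad :: "(4 \<Rightarrow> 4 \<Rightarrow> nat) \<Rightarrow> (4 \<Rightarrow>\<^sub>0 nat) \<Rightarrow> 4 \<Rightarrow> 4 \<Rightarrow> bool" where
  "bad A t i j \<longleftrightarrow> i \<noteq> j \<and> lookup t i + lookup t j < A i j"

definition good :: "(4 \<Rightarrow> 4 \<Rightarrow> nat) \<Rightarrow> (4 \<Rightarrow>\<^sub>0 nat) \<Rightarrow> bool" where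
  "good A t \<longleftrightarrow> (\<forall>i j. \<not> bad A t i j)"

definition good_off :: "(4 \<Rightarrow> 4 \<Rightarrow> nat) \<Rightarrow> 4 \<Rightarrow> (4 \<Rightarrow>\<^sub>0 nat) \<Rightarrow> bool" where
  "good_off A l t \<longleftrightarrow> (\<forall>i j. bad A t i j \<longrightarrow> i = l \<or> j = l)"

definition lines_ideal :: "(4 \<Rightarrow> 4 \<Rightarrow> nat) \<Rightarrow> ('k::field) poly4 set" where
  "lines_ideal A = {p. \<forall>t\<in>keys p. good A t}"

text \<open>The contraction of the extension of the ideal to the localization at \<open>x\<^sub>l\<close>.\<close>

definition lines_ideal_off :: "(4 \<Rightarrow> 4 \<Rightarrow> nat) \<Rightarrow> 4 \<Rightarrow> ('k::field) poly4 set" where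
  "lines_ideal_off A l = {p. \<forall>t\<in>keys p. good_off A l t}"

lemma weight_pair: "i \<noteq> j \<Longrightarrow> weight {i, j} t = lookup t i + lookup t j"
  by (simp add: weight_def)

lemma bad_antimono: "bad A (s + t) i j \<Longrightarrow> bad A t i j"
  by (auto simp: bad_def lookup_add)

lemma good_add: "good A s \<Longrightarrow> good A (t + s)"
  unfolding good_def using bad_antimono by blast

lemma good_off_add: "good_off A l s \<Longrightarrow> good_off A l (t + s)"
  unfolding good_off_def using bad_antimono by blast

lemma ideal_lines_ideal: "ideal (lines_ideal A :: ('k::field) poly4 set) poly_ring"
proof -
  have "(lines_ideal A :: 'k poly4 set) = {p. keys p \<subseteq> {t. good A t}}"
    by (auto simp: lines_ideal_def)
  moreover have "ideal {p :: 'k poly4. keys p \<subseteq> {t. good A t}} poly_ring"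
    by (rule ideal_monomial_set) (simp add: good_add)
  ultimately show ?thesis
    by (simp only:)
qed

lemma ideal_lines_ideal_off: "ideal (lines_ideal_off A l :: ('k::field) poly4 set) poly_ring"
proof -
  have "(lines_ideal_off A l :: 'k poly4 set) = {p. keys p \<subseteq> {t. good_off A l t}}"
    by (auto simp: lines_ideal_off_def)
  moreover have "ideal {p :: 'k poly4. keys p \<subseteq> {t. good_off A l t}} poly_ring"
    by (rule ideal_monomial_set) (simp add: good_off_add)
  ultimately show ?thesis
    by (simp only:)
qed

lemma lines_ideal_weight: 
  assumes "p \<in> lines_ideal A" "i \<noteq> j"
  shows "p \<in> weight_ideal {i, j} (A i j)"
  using assms by (auto simp: lines_ideal_def good_def bad_def weight_ideal_def weight_pair not_less)

lemma lines_idealI: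
  assumes "\<And>i j. i \<noteq> j \<Longrightarrow> p \<in> weight_ideal {i, j} (A i j)"
  shows "p \<in> lines_ideal A"
  using assms by (auto simp: lines_ideal_def good_def bad_def weight_ideal_def weight_pair not_less)

lemma lines_ideal_off_weight: 
  assumes "p \<in> lines_ideal_off A l" "i \<noteq> j" "i \<noteq> l" "j \<noteq> l"
  shows "p \<in> weight_ideal {i, j} (A i j)"
  using assms by (force simp: lines_ideal_off_def good_off_def bad_def weight_ideal_def weight_pair not_less)

lemma lines_ideal_offI:
  assumes "\<And>i j. i \<noteq> j \<Longrightarrow> i \<noteq> l \<Longrightarrow> j \<noteq> l \<Longrightarrow> p \<in> weight_ideal {i, j} (A i j)"
  shows "p \<in> lines_ideal_off A l"
  using assms by (force simp: lines_ideal_off_def good_off_def bad_def weight_ideal_def weight_pair not_less)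

lemma tetrahedral_ideal_eq:
  "tetrahedral_ideal a1 a2 a3 a4 a5 a6 =
    (lines_ideal (line_exponent a1 a2 a3 a4 a5 a6) :: ('k::field) poly4 set)"
proof -
  have pw: "ideal_power poly_ring (genideal poly_ring {indet i, indet j}) a = (weight_ideal {i, j} a :: 'k poly4 set)"
    for i j :: 4 and a
    using ideal_power_indets[of "{i, j}"] by simp
  let ?A = "line_exponent a1 a2 a3 a4 a5 a6"
  have "p \<in> tetrahedral_ideal a1 a2 a3 a4 a5 a6 \<longleftrightarrow>
      p \<in> weight_ideal {1, 2} (?A 1 2) \<and> p \<in> weight_ideal {1, 3} (?A 1 3) \<and>
      p \<in> weight_ideal {1, 4} (?A 1 4) \<and> p \<in> weight_ideal {2, 3} (?A 2 3) \<and>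
      p \<in> weight_ideal {2, 4} (?A 2 4) \<and> p \<in> weight_ideal {3, 4} (?A 3 4)" for p :: "'k poly4"
    unfolding tetrahedral_ideal_def pw line_exponent_simps by auto
  also have "\<dots> p \<longleftrightarrow> (\<forall>i j. i \<noteq> j \<longrightarrow> p \<in> weight_ideal {i, j} (?A i j))" for p :: "'k poly4"
    unfolding all_four using line_exponent_sym[of a1 a2 a3 a4 a5 a6]
    by (auto simp: insert_commute)
  also have "\<dots> p \<longleftrightarrow> p \<in> lines_ideal ?A" for p :: "'k poly4"
    using lines_ideal_weight[of p ?A] lines_idealI[of p ?A] by blast
  finally show ?thesis by blast
qed

text \<open>
  The ideal is an intersection of primary ideals, whose radicals are the ideals of the lines. So an element outside
  the latter is a non-zero-divisor modulo \<open>I\<close>.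
\<close>

lemma lines_ideal_nonzerodivisor:
  assumes "f * p \<in> lines_ideal A" "\<And>i j. i \<noteq> j \<Longrightarrow> f \<notin> weight_ideal {i, j} 1"
  shows "p \<in> lines_ideal A"
  by (rule lines_idealI) (metis assms lines_ideal_weight weight_ideal_primary)

lemma lines_ideal_off_nonzerodivisor:
  assumes "f * p \<in> lines_ideal_off A l" "\<And>i j. i \<noteq> j \<Longrightarrow> i \<noteq> l \<Longrightarrow> j \<noteq> l \<Longrightarrow> f \<notin> weight_ideal {i, j} 1"
  shows "p \<in> lines_ideal_off A l"
  by (rule lines_ideal_offI) (metis assms lines_ideal_off_weight weight_ideal_primary)

lemma indet_not_in_weight_ideal: "i \<notin> V \<Longrightarrow> indet i ^ n \<notin> weight_ideal V 1"
  by (simp add: weight_ideal_def indet_power weight_single)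

lemma lines_ideal_subset_off: "lines_ideal A \<subseteq> lines_ideal_off A l"
  by (auto simp: lines_ideal_def lines_ideal_off_def good_def good_off_def)

lemma lines_ideal_off_cancel_indet:
  assumes "indet l ^ n * p \<in> lines_ideal_off A l"
  shows "p \<in> lines_ideal_off A l"
  by (rule lines_ideal_off_nonzerodivisor[OF assms], rule indet_not_in_weight_ideal) auto

lemma ex_third_index:
  fixes i j :: 4
  obtains l where "l \<noteq> i" "l \<noteq> j"
proof -
  have "card {i, j} < card (UNIV :: 4 set)"
    using card_insert_le_m1[of 2 "{j}" i] by simp
  then have "{i, j} \<noteq> UNIV"
    by fastforce
  then show thesis
    using that by blast
qed

text \<open>
  Every line survives the localization at a variable whose index is neither of its own, so that \<open>I\<close> is saturated.
\<close>

lemma lines_ideal_if_all_off: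
  assumes "\<And>l. p \<in> lines_ideal_off A l"
  shows "p \<in> lines_ideal A"
proof (rule lines_idealI)
  fix i j :: 4 assume "i \<noteq> j"
  obtain l where "l \<noteq> i" "l \<noteq> j"
    by (rule ex_third_index)
  then show "p \<in> weight_ideal {i, j} (A i j)"
    using lines_ideal_off_weight[OF assms \<open>i \<noteq> j\<close>, of l] by metis
qed

lemma lines_ideal_off_times_indet:
  assumes "p \<in> lines_ideal_off A l" "\<And>i j. A i j \<le> n"
  shows "indet l ^ n * p \<in> lines_ideal A"
  unfolding lines_ideal_def
proof (intro CollectI ballI)
  fix t assume "t \<in> keys (indet l ^ n * p)"
  then obtain s where s: "s \<in> keys p" "t = single l n + s"
    unfolding indet_power by (blast dest: keys_single_times)
  have "\<not> bad A t i j" for i j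
  proof
    assume "bad A t i j"
    moreover from this have "i = l \<or> j = l"
      using assms(1) s bad_antimono by (fastforce simp: lines_ideal_off_def good_off_def)
    ultimately show False
      using assms(2)[of i j] s by (auto simp: bad_def lookup_add)
  qed
  then show "good A t"
    by (simp add: good_def)
qed

lemma exponent_le_sum:
  fixes A :: "4 \<Rightarrow> 4 \<Rightarrow> nat"
  shows "A i j \<le> (\<Sum>i\<in>UNIV. \<Sum>j\<in>UNIV. A i j)"
proof -
  have "A i j \<le> (\<Sum>j\<in>UNIV. A i j)"
    by (rule member_le_sum) auto
  also have "\<dots> \<le> (\<Sum>i\<in>UNIV. \<Sum>j\<in>UNIV. A i j)"
    by (rule member_le_sum[of i UNIV "\<lambda>i. \<Sum>j\<in>UNIV. A i j"]) auto
  finally show ?thesis .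
qed

lemma finite_bound_exponents:
  fixes A :: "4 \<Rightarrow> 4 \<Rightarrow> nat"
  obtains n where "\<And>i j. A i j \<le> n"
  using exponent_le_sum by blast

section \<open>Cech cocycles\<close>

text \<open>\<open>cocycle A N z\<close> says that the fractions \<open>z i / x\<^sub>i^N\<close> form a Cech cocycle of \<open>R/I\<close>.\<close>

definition cocycle :: "(4 \<Rightarrow> 4 \<Rightarrow> nat) \<Rightarrow> nat \<Rightarrow> (4 \<Rightarrow> ('k::field) poly4) \<Rightarrow> bool" where
  "cocycle A N z \<longleftrightarrow> (\<forall>i j. indet j ^ N * z i - indet i ^ N * z j \<in> lines_ideal A)"

text \<open>
  The cocycle is the coboundary of \<open>m\<close>: the difference of \<open>z i / x\<^sub>i^N\<close> and \<open>m\<close> vanishes in the localization of \<open>R/I\<close>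
  at \<open>x\<^sub>i\<close>.
\<close>

definition splits :: "(4 \<Rightarrow> 4 \<Rightarrow> nat) \<Rightarrow> nat \<Rightarrow> (4 \<Rightarrow> ('k::field) poly4) \<Rightarrow> bool" where
  "splits A N z \<longleftrightarrow> (\<exists>m. \<forall>i. z i - indet i ^ N * m \<in> lines_ideal_off A i)"

text \<open>
  The coefficient of \<open>x\<^sup>b\<close> in \<open>z i / x\<^sub>i^N\<close>.
\<close>

abbreviation fraction_coeff :: "nat \<Rightarrow> (4 \<Rightarrow> ('k::field) poly4) \<Rightarrow> 4 \<Rightarrow> (4 \<Rightarrow>\<^sub>0 nat) \<Rightarrow> 'k" where
  "fraction_coeff N z i b \<equiv> lookup (z i) (single i N + b)"

text \<open>
  The violated lines are exactly \<open>x\<^sub>1 = x\<^sub>2 = 0\<close> and \<open>x\<^sub>3 = x\<^sub>4 = 0\<close>. Then the values of a cocycle at the indices \<open>1, 2\<close> agree,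
  and so do those at \<open>3, 4\<close>, but the two common values are independent.
\<close>

definition obstructed :: "(4 \<Rightarrow> 4 \<Rightarrow> nat) \<Rightarrow> (4 \<Rightarrow>\<^sub>0 nat) \<Rightarrow> bool" where
  "obstructed A b \<longleftrightarrow> bad A b 1 2 \<and> bad A b 3 4 \<and>
    \<not> bad A b 1 3 \<and> \<not> bad A b 2 4 \<and> \<not> bad A b 1 4 \<and> \<not> bad A b 2 3"

lemma ex_fourth_index:
  fixes i j k :: 4
  obtains l where "l \<noteq> i" "l \<noteq> j" "l \<noteq> k"
proof -
  have "card {i, j, k} \<le> 3"
    by (rule card_insert_le_m1) (auto intro: card_insert_le_m1)
  then have "{i, j, k} \<noteq> UNIV"
    by auto
  then show thesis
    using that by blast
qed

lemma bad_add_single: "bad A (single l n + s) i j \<longleftrightarrow> bad A s i j" if "l \<noteq> i" "l \<noteq> j"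
  using that by (simp add: bad_def lookup_add lookup_single)

lemma not_in_keys_lines_ideal: "p \<in> lines_ideal A \<Longrightarrow> bad A s i j \<Longrightarrow> lookup p s = 0"
  unfolding lines_ideal_def good_def by (metis (mono_tags, lifting) in_keys_iff mem_Collect_eq)

lemma not_in_keys_lines_ideal_off: "p \<in> lines_ideal_off A l \<Longrightarrow> \<not> good_off A l s \<Longrightarrow> lookup p s = 0"
  unfolding lines_ideal_off_def by (metis (mono_tags, lifting) in_keys_iff mem_Collect_eq)

lemma cocycle_coeff:
  assumes "cocycle A N z" "bad A s j k"
  shows "lookup (indet l ^ N * z i) s = lookup (indet i ^ N * z l) s"
  using assms not_in_keys_lines_ideal[of "indet l ^ N * z i - indet i ^ N * z l" A s j k]
  by (simp add: cocycle_def lookup_minus)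

text \<open>
  Only non-negative exponents occur: multiplication by \<open>x\<^sub>l^N\<close>, where \<open>x\<^sub>l\<close> is the remaining variable, keeps the line
  violated, and there the component at \<open>i\<close> is compared with a polynomial that is divisible by \<open>x\<^sub>i^N\<close>.
\<close>

lemma cocycle_coeff_zero:
  assumes z: "cocycle A N z" and "\<not> good_off A i s" "lookup s i < N"
  shows "lookup (z i) s = 0"
proof -
  obtain j k where jk: "bad A s j k" "i \<noteq> j" "i \<noteq> k"
    using assms(2) by (auto simp: good_off_def)
  obtain l where l: "l \<noteq> i" "l \<noteq> j" "l \<noteq> k"
    by (rule ex_fourth_index)
  have "lookup (z i) s = lookup (indet l ^ N * z i) (single l N + s)"
    by (simp add: lookup_indet_power_times)
  also have "\<dots> = lookup (indet i ^ N * z l) (single l N + s)"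
    using jk l by (intro cocycle_coeff[OF z, of _ j k]) (simp add: bad_add_single)
  also have "\<dots> = 0"
    using assms l by (intro lookup_indet_power_times) (simp add: lookup_add lookup_single)
  finally show ?thesis .
qed

lemma cocycle_coeff_eq:
  assumes z: "cocycle A N z" and b: "bad A b j k" "i \<noteq> j" "i \<noteq> k" "l \<noteq> j" "l \<noteq> k"
  shows "fraction_coeff N z i b = fraction_coeff N z l b"
proof -
  have "fraction_coeff N z i b = lookup (indet l ^ N * z i) (single l N + (single i N + b))"
    by (simp add: lookup_indet_power_times)
  also have "\<dots> = lookup (indet i ^ N * z l) (single l N + (single i N + b))"
    using b by (intro cocycle_coeff[OF z, of _ j k]) (simp add: bad_add_single)
  also have "\<dots> = lookup (indet i ^ N * z l) (single i N + (single l N + b))"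
    by (simp add: ac_simps)
  also have "\<dots> = fraction_coeff N z l b"
    by (simp add: lookup_indet_power_times)
  finally show ?thesis .
qed

text \<open>
  Here \<open>Bjk\<close> stands for a violated line, hence for an edge between the other two indices; two
  premises exclude two of the three pairs of opposite edges as components, and the last one treats the remaining pair.
\<close>

lemma common_value_on_component:
  fixes g1 g2 g3 g4 :: 'a
  assumes "B12 \<Longrightarrow> g3 = g4" "B13 \<Longrightarrow> g2 = g4" "B14 \<Longrightarrow> g2 = g3" "B23 \<Longrightarrow> g1 = g4" "B24 \<Longrightarrow> g1 = g3" "B34 \<Longrightarrow> g1 = g2"
    and "B13 \<Longrightarrow> B24 \<Longrightarrow> B12 \<or> B34" "B14 \<Longrightarrow> B23 \<Longrightarrow> B12 \<or> B34"
    and "B12 \<Longrightarrow> B34 \<Longrightarrow> \<not> B13 \<Longrightarrow> \<not> B24 \<Longrightarrow> \<not> B14 \<Longrightarrow> \<not> B23 \<Longrightarrow> g1 = g3"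
  shows "\<exists>c. (B23 \<or> B24 \<or> B34 \<longrightarrow> g1 = c) \<and> (B13 \<or> B14 \<or> B34 \<longrightarrow> g2 = c) \<and>
    (B12 \<or> B14 \<or> B24 \<longrightarrow> g3 = c) \<and> (B12 \<or> B13 \<or> B23 \<longrightarrow> g4 = c)"
  using assms by (smt (verit))

locale tetrahedron =
  fixes A :: "4 \<Rightarrow> 4 \<Rightarrow> nat"
  assumes sym: "A i j = A j i"
    and dominant: "A 1 3 + A 2 4 \<le> A 1 2 + A 3 4" "A 1 4 + A 2 3 \<le> A 1 2 + A 3 4"
begin

lemma bad_sym: "bad A t i j \<longleftrightarrow> bad A t j i"
  using sym[of i j] by (auto simp: bad_def)

lemma not_good_off_iff:
  "\<not> good_off A 1 b \<longleftrightarrow> bad A b 2 3 \<or> bad A b 2 4 \<or> bad A b 3 4"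
  "\<not> good_off A 2 b \<longleftrightarrow> bad A b 1 3 \<or> bad A b 1 4 \<or> bad A b 3 4"
  "\<not> good_off A 3 b \<longleftrightarrow> bad A b 1 2 \<or> bad A b 1 4 \<or> bad A b 2 4"
  "\<not> good_off A 4 b \<longleftrightarrow> bad A b 1 2 \<or> bad A b 1 3 \<or> bad A b 2 3"
proof -
  have irrefl: "\<not> bad A b i i" for i
    by (simp add: bad_def)
  note s = bad_sym[of b 2 1] bad_sym[of b 3 1] bad_sym[of b 4 1] bad_sym[of b 3 2] bad_sym[of b 4 2] bad_sym[of b 4 3]
  show 
    "\<not> good_off A 1 b \<longleftrightarrow> bad A b 2 3 \<or> bad A b 2 4 \<or> bad A b 3 4"
    "\<not> good_off A 2 b \<longleftrightarrow> bad A b 1 3 \<or> bad A b 1 4 \<or> bad A b 3 4"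
    "\<not> good_off A 3 b \<longleftrightarrow> bad A b 1 2 \<or> bad A b 1 4 \<or> bad A b 2 4"
    "\<not> good_off A 4 b \<longleftrightarrow> bad A b 1 2 \<or> bad A b 1 3 \<or> bad A b 2 3"
    unfolding good_off_def all_four s by (simp_all add: irrefl four_distinct) argo+
qed

text \<open>
  For a monomial \<open>x\<^sup>b\<close>, let \<open>i\<close> and \<open>l\<close> be joined by an edge if \<open>x\<^sup>b\<close> violates the condition given by
  the other two indices; then a cocycle has the same coefficient of \<open>x\<^sup>b\<close> at \<open>i\<close> and at \<open>l\<close>. A graph on four
  vertices with edges in two components consists of two opposite edges, and by the assumption
  on the exponents these must be the edges \<open>12\<close> and \<open>34\<close>.
\<close>

lemma cocycle_common_value:
  assumes z: "cocycle A N z" and b: "obstructed A b \<Longrightarrow> fraction_coeff N z 1 b = fraction_coeff N z 3 b"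
  shows "\<exists>c. \<forall>i. \<not> good_off A i b \<longrightarrow> fraction_coeff N z i b = c"
  unfolding all_four not_good_off_iff
proof (rule common_value_on_component)
  show "bad A b 1 2 \<or> bad A b 3 4" if "bad A b 1 3" "bad A b 2 4"
    using that dominant by (auto simp: bad_def)
  show "bad A b 1 2 \<or> bad A b 3 4" if "bad A b 1 4" "bad A b 2 3"
    using that dominant by (auto simp: bad_def)
  show "fraction_coeff N z 1 b = fraction_coeff N z 3 b"
    if "bad A b 1 2" "bad A b 3 4" "\<not> bad A b 1 3" "\<not> bad A b 2 4" "\<not> bad A b 1 4" "\<not> bad A b 2 3"
    using that b by (simp add: obstructed_def)
qed (erule cocycle_coeff_eq[OF z]; simp only: four_distinct not_False_eq_True)+

text \<open>
  The common value of a cocycle on the graph of \<open>b\<close>, where it exists, is the coefficient of \<open>x\<^sup>b\<close> in the polynomial that the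
  cocycle comes from. At an obstructed exponent, the indices \<open>1\<close> and \<open>3\<close> represent the two components.
\<close>

lemma splits_iff:
  assumes z: "cocycle A N z"
  shows "splits A N z \<longleftrightarrow> (\<forall>b. obstructed A b \<longrightarrow> fraction_coeff N z 1 b = fraction_coeff N z 3 b)"
proof
  assume "splits A N z"
  then obtain m where m: "z i - indet i ^ N * m \<in> lines_ideal_off A i" for i
    unfolding splits_def by blast
  have eq: "fraction_coeff N z i b = lookup m b" if "bad A b j k" "i \<noteq> j" "i \<noteq> k" for i j k b
  proof -
    have "\<not> good_off A i (single i N + b)"
      using that bad_add_single[of i j k A N b] by (auto simp: good_off_def)
    then have "lookup (z i - indet i ^ N * m) (single i N + b) = 0"
      by (rule not_in_keys_lines_ideal_off[OF m])
    then show ?thesis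
      by (simp add: lookup_minus lookup_indet_power_times)
  qed
  show "\<forall>b. obstructed A b \<longrightarrow> fraction_coeff N z 1 b = fraction_coeff N z 3 b"
  proof (intro allI impI)
    fix b assume "obstructed A b"
    then have "bad A b 3 4" "bad A b 1 2"
      by (auto simp: obstructed_def)
    then show "fraction_coeff N z 1 b = fraction_coeff N z 3 b"
      using eq[of b 3 4 1] eq[of b 1 2 3] by (metis four_distinct)
  qed
next
  assume "\<forall>b. obstructed A b \<longrightarrow> fraction_coeff N z 1 b = fraction_coeff N z 3 b"
  then have "\<forall>b. \<exists>c. \<forall>i. \<not> good_off A i b \<longrightarrow> fraction_coeff N z i b = c"
    using cocycle_common_value[OF z] by blast
  then obtain c0 where c0: "\<And>b i. \<not> good_off A i b \<Longrightarrow> fraction_coeff N z i b = c0 b"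
    by metis
  \<comment> \<open>If all indices are isolated, then the value is arbitrary; zero ensures finite support.\<close>
  define c where "c b = (if \<exists>i. \<not> good_off A i b then c0 b else 0)" for b
  have c: "fraction_coeff N z i b = c b" if "\<not> good_off A i b" for i b
    using c0 that by (auto simp: c_def)
  have "{b. c b \<noteq> 0} \<subseteq> (\<Union>i. (\<lambda>b. single i N + b) -` keys (z i))"
  proof
    fix b assume "b \<in> {b. c b \<noteq> 0}"
    then obtain i where "\<not> good_off A i b" "c0 b \<noteq> 0"
      by (auto simp: c_def split: if_splits)
    with c0[of i b] show "b \<in> (\<Union>i. (\<lambda>b. single i N + b) -` keys (z i))"
      by (auto simp: in_keys_iff intro!: exI[of _ i])
  qed
  moreover have "finite (\<Union>i. (\<lambda>b. single i N + b) -` keys (z i))"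
    by (intro finite_UN_I finite_vimageI) (auto intro!: injI)
  ultimately have fin: "finite {b. c b \<noteq> 0}"
    by (rule finite_subset)
  define m where "m = Abs_poly_mapping c"
  have m: "lookup m b = c b" for b
    using fin by (simp add: m_def)
  have "z i - indet i ^ N * m \<in> lines_ideal_off A i" for i
    unfolding lines_ideal_off_def
  proof (intro CollectI ballI, rule ccontr)
    fix s assume s: "s \<in> keys (z i - indet i ^ N * m)" and ng: "\<not> good_off A i s"
    have "lookup (z i) s = lookup (indet i ^ N * m) s"
    proof (cases "lookup s i < N")
      case True
      then show ?thesis
        using cocycle_coeff_zero[OF z ng] by (simp add: lookup_indet_power_times)
    next
      case False
      then obtain b where b: "s = single i N + b"
        by (elim exponent_diff[rotated]) (auto simp: lookup_single when_def)
      then have "\<not> good_off A i b"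
        using ng good_off_add by blast
      then show ?thesis
        using c by (simp add: b lookup_indet_power_times m)
    qed
    with s show False
      by (simp add: in_keys_iff lookup_minus)
  qed
  then show "splits A N z"
    unfolding splits_def by blast
qed

text \<open>
  For an obstructed exponent \<open>b\<close>, the cocycle with value \<open>x\<^sup>b\<close> on the component \<open>{1, 2}\<close> of its graph and value
  zero on the component \<open>{3, 4}\<close>.
\<close>

definition monomial_cochain :: "nat \<Rightarrow> (4 \<Rightarrow>\<^sub>0 nat) \<Rightarrow> 4 \<Rightarrow> ('k::field) poly4" where
  "monomial_cochain N b i = (if i = 1 \<or> i = 2 then single (single i N + b) 1 else 0)"

text \<open>
  The factor \<open>(x\<^sub>i x\<^sub>j)^N\<close> repairs all lines that involve \<open>i\<close> or \<open>j\<close>. What is left is the line of the other two indices, one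
  in \<open>{1, 2}\<close> and one in \<open>{3, 4}\<close>, which is not violated.
\<close>

lemma good_obstructed_two_powers:
  assumes b: "obstructed A b" and N: "\<And>i j. A i j \<le> N" and "i = 1 \<or> i = 2" "j \<noteq> 1 \<and> j \<noteq> 2"
  shows "good A (single i N + single j N + b)"
  unfolding good_def
proof (intro allI notI)
  fix k l assume bad: "bad A (single i N + single j N + b) k l"
  then have "A k l > lookup (single i N + single j N + b) k + lookup (single i N + single j N + b) l"
    "k \<noteq> l"
    by (auto simp: bad_def)
  with N[of k l] have "k \<noteq> i" "l \<noteq> i" "k \<noteq> j" "l \<noteq> j"
    by (auto simp: lookup_add lookup_single)
  moreover from bad have "bad A b k l"
    by (rule bad_antimono)
  ultimately show False
    using assms(1,3,4) exhaust_four[of i] exhaust_four[of j] exhaust_four[of k] exhaust_four[of l] \<open>k \<noteq> l\<close>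
      bad_sym[of b 3 1] bad_sym[of b 4 1] bad_sym[of b 3 2] bad_sym[of b 4 2]
    unfolding obstructed_def by (metis four_distinct)
qed

lemma cocycle_monomial_cochain:
  assumes b: "obstructed A b" and N: "\<And>i j. A i j \<le> N"
  shows "cocycle A N (monomial_cochain N b :: 4 \<Rightarrow> ('k::field) poly4)"
  unfolding cocycle_def
proof (intro allI)
  fix i j
  let ?I = "lines_ideal A :: 'k poly4 set"
  let ?z = "monomial_cochain N b :: 4 \<Rightarrow> 'k poly4"
  have eq: "indet j ^ N * ?z i = single (single i N + single j N + b) 1" if "i = 1 \<or> i = 2" for i j
    using that by (simp add: monomial_cochain_def indet_power mult_single ac_simps)
  have zero: "?z i = 0" if "\<not> (i = 1 \<or> i = 2)" for i
    using that by (simp only: monomial_cochain_def if_False)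
  have mem: "indet j ^ N * ?z i \<in> ?I" if "i = 1 \<or> i = 2" "\<not> (j = 1 \<or> j = 2)" for i j
    using good_obstructed_two_powers[OF b N that(1), of j] that(2)
    unfolding eq[OF that(1)] by (simp add: lines_ideal_def)
  show "indet j ^ N * ?z i - indet i ^ N * ?z j \<in> ?I"
  proof (cases "i = 1 \<or> i = 2")
    case i: True
    show ?thesis
    proof (cases "j = 1 \<or> j = 2")
      case True
      then show ?thesis
        using i ideal_0[OF ideal_lines_ideal] by (simp add: eq add.commute[of "single i N"])
    next
      case False
      then show ?thesis
        using mem[OF i False] zero by simp
    qed
  next
    case i: False
    show ?thesis
    proof (cases "j = 1 \<or> j = 2")
      case True
      then show ?thesis
        using mem[OF True i] zero i ideal_uminus[OF ideal_lines_ideal] by simp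
    next
      case False
      then show ?thesis
        using zero i ideal_0[OF ideal_lines_ideal] by simp
    qed
  qed
qed

lemma cocycle_mult: "cocycle A N z \<Longrightarrow> cocycle A N (\<lambda>i. r * z i)"
  unfolding cocycle_def
proof (intro allI)
  fix i j
  assume "\<forall>i j. indet j ^ N * z i - indet i ^ N * z j \<in> lines_ideal A"
  then have "r * (indet j ^ N * z i - indet i ^ N * z j) \<in> lines_ideal A"
    by (blast intro: ideal_mult_left[OF ideal_lines_ideal])
  then show "indet j ^ N * (r * z i) - indet i ^ N * (r * z j) \<in> lines_ideal A"
    by (simp add: algebra_simps)
qed

text \<open>
  Multiplication by \<open>x\<^sup>g\<close> translates multidegrees by \<open>g\<close>. Thus it annihilates the cohomology if no difference of
  two obstructed exponents is \<open>g\<close>.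
\<close>

lemma monomial_mult_unobstructs:
  fixes z :: "4 \<Rightarrow> ('k::field) poly4"
  assumes z: "cocycle A N z" and g: "\<And>b. obstructed A b \<Longrightarrow> \<not> obstructed A (g + b)"
    and b: "obstructed A b"
  shows "fraction_coeff N (\<lambda>i. single g c * z i) 1 b = fraction_coeff N (\<lambda>i. single g c * z i) 3 b"
proof (cases "\<forall>i. lookup g i \<le> lookup b i")
  case True
  then obtain b' where b': "b = g + b'"
    by (metis exponent_diff)
  have bad: "bad A b' 1 2" "bad A b' 3 4"
    using b bad_antimono unfolding obstructed_def b' by blast+
  have "\<not> obstructed A b'"
    using b g unfolding b' by blast
  then obtain v where "\<And>i. \<not> good_off A i b' \<Longrightarrow> fraction_coeff N z i b' = v"
    using cocycle_common_value[OF z, of b'] by blast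
  with bad have "fraction_coeff N z 1 b' = fraction_coeff N z 3 b'"
    using not_good_off_iff by metis
  moreover have "fraction_coeff N (\<lambda>i. single g c * z i) i b = c * fraction_coeff N z i b'" for i
    using lookup_single_times[of g c "z i" "single i N + b'"] by (simp add: b' ac_simps)
  ultimately show ?thesis
    by simp
next
  case False
  have "fraction_coeff N (\<lambda>i. single g c * z i) i b = 0" if i: "\<not> good_off A i b" for i
  proof (cases "\<exists>s. single i N + b = g + s")
    case True
    then obtain s where s: "single i N + b = g + s" by blast
    have lk: "lookup (single i N) k + lookup b k = lookup g k + lookup s k" for k
      by (metis s lookup_add)
    obtain k where k: "lookup b k < lookup g k"
      using False by (auto simp: not_le)
    with lk[of k] have "k = i"
      by (auto simp: lookup_single when_def split: if_splits)
    with lk[of i] k have "lookup s i < N"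
      by simp
    moreover have "\<not> good_off A i s"
    proof -
      obtain j l where "bad A b j l" "i \<noteq> j" "i \<noteq> l"
        using i by (auto simp: good_off_def)
      then have "bad A (g + s) j l"
        using bad_add_single[of i j l A N b] s by simp
      then show ?thesis
        using bad_antimono \<open>i \<noteq> j\<close> \<open>i \<noteq> l\<close> unfolding good_off_def by metis
    qed
    ultimately have "lookup (z i) s = 0"
      using cocycle_coeff_zero[OF z] by blast
    then show ?thesis
      by (simp add: s lookup_single_times)
  next
    case False
    then show ?thesis
      by (simp add: lookup_single_times_outside)
  qed
  moreover have "\<not> good_off A 1 b" "\<not> good_off A 3 b"
    using b not_good_off_iff unfolding obstructed_def by metis+
  ultimately show ?thesis
    by simp
qed

end

section \<open>The first local cohomology of \<open>R/I\<close>\<close>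

lemma a_r_coset_poly: "I +>\<^bsub>(ring_of_type_algebra :: 'a::comm_ring_1 ring)\<^esub> p = {h + p | h. h \<in> I}"
  by (auto simp: a_r_coset_def')

lemma a_r_coset_self_module: "I +>\<^bsub>self_module (ring_of_type_algebra :: 'a::comm_ring_1 ring)\<^esub> p = {h + p | h. h \<in> I}"
  by (auto simp: a_r_coset_def' self_module_def)

abbreviation coset :: "'a::comm_ring_1 set \<Rightarrow> 'a \<Rightarrow> 'a set" where
  "coset I p \<equiv> {h + p | h. h \<in> I}"

lemma coset_eq_iff:
  assumes "ideal (I :: 'a::comm_ring_1 set) ring_of_type_algebra"
  shows "coset I p = coset I q \<longleftrightarrow> p - q \<in> I"
proof
  assume "coset I p = coset I q"
  moreover have "p \<in> coset I p"
    using ideal_0[OF assms] by (auto intro: exI[of _ 0])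
  ultimately obtain h where "p = h + q" "h \<in> I"
    by auto
  then show "p - q \<in> I"
    by simp
next
  assume pq: "p - q \<in> I"
  have sub: "coset I p \<subseteq> coset I q" if "p - q \<in> I" for p q
  proof
    fix x assume "x \<in> coset I p"
    then obtain h where "x = h + p" "h \<in> I"
      by auto
    then show "x \<in> coset I q"
      using ideal_add[OF assms that] by (intro CollectI exI[of _ "p - q + h"]) (simp add: algebra_simps)
  qed
  from sub[OF pq] sub[of q p] ideal_uminus[OF assms pq] show "coset I p = coset I q"
    by simp
qed

locale poly_ideal =
  fixes I :: "('k::field) poly4 set"
  assumes ideal_I: "ideal I poly_ring"
begin

abbreviation M :: "('k poly4, 'k poly4 set) module" where
  "M \<equiv> quotient_module I"

lemma M_carrier: "carrier M = range (coset I)"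
  by (simp add: quotient_module_def subquotient_def a_r_coset_self_module)

lemma M_add: "coset I p \<oplus>\<^bsub>M\<^esub> coset I q = coset I (p + q)"
proof -
  have "coset I p \<oplus>\<^bsub>M\<^esub> coset I q = {a + b | a b. a \<in> coset I p \<and> b \<in> coset I q}"
    by (simp add: quotient_module_def subquotient_def set_add_def' self_module_def) blast
  also have "\<dots> = coset I (p + q)"
  proof (intro equalityI subsetI)
    fix x assume "x \<in> {a + b | a b. a \<in> coset I p \<and> b \<in> coset I q}"
    then obtain h k where "x = (h + p) + (k + q)" "h \<in> I" "k \<in> I"
      by auto
    then show "x \<in> coset I (p + q)"
      using ideal_add[OF ideal_I] by (intro CollectI exI[of _ "h + k"]) (simp add: algebra_simps)
  next
    fix x assume "x \<in> coset I (p + q)"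
    then obtain h where "x = (h + p) + (0 + q)" "h \<in> I"
      by (auto simp: algebra_simps)
    then show "x \<in> {a + b | a b. a \<in> coset I p \<and> b \<in> coset I q}"
      using ideal_0[OF ideal_I] by blast
  qed
  finally show ?thesis .
qed

lemma M_smult: "r \<odot>\<^bsub>M\<^esub> coset I p = coset I (r * p)"
proof -
  have "coset I (r * z) = coset I (r * p)" if z: "z \<in> coset I p" for z
  proof -
    obtain h where "z = h + p" "h \<in> I"
      using z by auto
    then have "r * z - r * p \<in> I"
      using ideal_mult_left[OF ideal_I, of h r] by (simp add: algebra_simps)
    then show ?thesis
      using coset_eq_iff[OF ideal_I] by blast
  qed
  moreover have "p \<in> coset I p"
    using ideal_0[OF ideal_I] by (auto intro: exI[of _ 0])
  ultimately have "(\<Union>z\<in>coset I p. coset I (r * z)) = coset I (r * p)"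
    by blast
  then show ?thesis
    by (simp add: quotient_module_def subquotient_def a_r_coset_self_module) (simp add: self_module_def)
qed

subsection \<open>Fractions\<close>

abbreviation frac :: "'k poly4 \<Rightarrow> 'k poly4 \<Rightarrow> nat \<Rightarrow> ('k poly4 set \<times> nat) set" where
  "frac f p k \<equiv> loc_frac poly_ring M f (coset I p) k"

lemma mem_frac_iff:
  "(n, l) \<in> frac f p k \<longleftrightarrow> (\<exists>q t. n = coset I q \<and> f ^ (t + l) * p - f ^ (t + k) * q \<in> I)"
proof -
  have eq: "f ^ (t + l) \<odot>\<^bsub>M\<^esub> coset I p = f ^ (t + k) \<odot>\<^bsub>M\<^esub> coset I q \<longleftrightarrow>
      f ^ (t + l) * p - f ^ (t + k) * q \<in> I" for t q
    by (simp add: M_smult coset_eq_iff[OF ideal_I])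
  have "(n, l) \<in> frac f p k \<longleftrightarrow> n \<in> carrier M \<and> (\<exists>t. f ^ (t + l) \<odot>\<^bsub>M\<^esub> coset I p = f ^ (t + k) \<odot>\<^bsub>M\<^esub> n)"
    unfolding loc_frac_def frac_rel_def by (auto simp: M_carrier)
  also have "\<dots> \<longleftrightarrow> (\<exists>q. n = coset I q \<and> (\<exists>t. f ^ (t + l) \<odot>\<^bsub>M\<^esub> coset I p = f ^ (t + k) \<odot>\<^bsub>M\<^esub> coset I q))"
    unfolding M_carrier by blast
  finally show ?thesis
    unfolding eq by blast
qed

lemma frac_eq_iff: "frac f p k = frac f q l \<longleftrightarrow> (\<exists>t. f ^ (t + l) * p - f ^ (t + k) * q \<in> I)"
proof
  assume "frac f p k = frac f q l"
  moreover have "(coset I q, l) \<in> frac f q l"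
    unfolding mem_frac_iff using ideal_0[OF ideal_I] by (intro exI[of _ q] exI[of _ 0]) simp
  ultimately have "(coset I q, l) \<in> frac f p k"
    by simp
  then obtain q' t where q': "coset I q = coset I q'" "f ^ (t + l) * p - f ^ (t + k) * q' \<in> I"
    unfolding mem_frac_iff by blast
  then have "f ^ (t + k) * (q' - q) \<in> I"
    using coset_eq_iff[OF ideal_I, of q q'] ideal_uminus[OF ideal_I, of "q - q'"]
    by (intro ideal_mult_left[OF ideal_I]) simp
  from ideal_add[OF ideal_I q'(2) this] show "\<exists>t. f ^ (t + l) * p - f ^ (t + k) * q \<in> I"
    by (intro exI[of _ t]) (simp add: algebra_simps)
next
  have sub: "frac f q l \<subseteq> frac f p k" if pq: "f ^ (t + l) * p - f ^ (t + k) * q \<in> I" for p q k l t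
  proof (rule subrelI)
    fix n j assume "(n, j) \<in> frac f q l"
    then obtain r s where r: "n = coset I r" "f ^ (s + j) * q - f ^ (s + l) * r \<in> I"
      unfolding mem_frac_iff by blast
    have "f ^ (s + j) * (f ^ (t + l) * p - f ^ (t + k) * q) + f ^ (t + k) * (f ^ (s + j) * q - f ^ (s + l) * r) \<in> I"
      using pq r(2) by (intro ideal_add[OF ideal_I] ideal_mult_left[OF ideal_I])
    also have "f ^ (s + j) * (f ^ (t + l) * p - f ^ (t + k) * q) + f ^ (t + k) * (f ^ (s + j) * q - f ^ (s + l) * r) =
      f ^ (s + t + l + j) * p - f ^ (s + t + l + k) * r"
      by (simp add: algebra_simps power_add)
    finally show "(n, j) \<in> frac f p k"
      unfolding mem_frac_iff using r(1) by blast
  qed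
  assume "\<exists>t. f ^ (t + l) * p - f ^ (t + k) * q \<in> I"
  then obtain t where t: "f ^ (t + l) * p - f ^ (t + k) * q \<in> I" ..
  have "f ^ (t + k) * q - f ^ (t + l) * p \<in> I"
    using ideal_uminus[OF ideal_I t] by simp
  from sub[OF t] sub[OF this] show "frac f p k = frac f q l"
    by (rule equalityI[rotated])
qed

lemma frac_self_mem: "(coset I p, k) \<in> frac f p k"
  unfolding mem_frac_iff using ideal_0[OF ideal_I] by (intro exI[of _ p] exI[of _ 0]) simp

lemma frac_mem_E:
  assumes "x \<in> frac f p k"
  obtains q l where "x = (coset I q, l)" "frac f q l = frac f p k"
proof -
  obtain n l where x: "x = (n, l)"
    by (cases x)
  obtain q t where q: "n = coset I q" "f ^ (t + l) * p - f ^ (t + k) * q \<in> I"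
    using assms unfolding x mem_frac_iff by blast
  then have "frac f p k = frac f q l"
    unfolding frac_eq_iff by blast
  with x q that show thesis
    by simp
qed

text \<open>
  The operations on localizations are unions over all representatives of the operands. Such a union is a single fraction
  if every representative yields this fraction.
\<close>

lemma UN_frac_const:
  assumes "\<And>q l. frac f q l = frac f p k \<Longrightarrow> F (coset I q) l = C"
  shows "(\<Union>(m, j)\<in>frac f p k. F m j) = C"
proof -
  have const: "(case x of (m, j) \<Rightarrow> F m j) = C" if "x \<in> frac f p k" for x
    using that by (rule frac_mem_E) (simp add: assms)
  have "(\<Union>(m, j)\<in>frac f p k. F m j) = (\<Union>x\<in>frac f p k. C)"
    by (rule SUP_cong[OF refl const])
  also have "\<dots> = C"
    using frac_self_mem[of p k f] by (intro UN_constant_eq) auto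
  finally show ?thesis .
qed

lemma frac_expand: "frac f p k = frac f (f ^ j * p) (k + j)"
  unfolding frac_eq_iff using ideal_0[OF ideal_I] by (intro exI[of _ 0]) (simp add: power_add algebra_simps)

lemma frac_add:
  "frac f p k \<oplus>\<^bsub>localization poly_ring M f\<^esub> frac f q l = frac f (f ^ l * p + f ^ k * q) (k + l)"
proof -
  let ?F = "\<lambda>m k n l. loc_frac poly_ring M f (((f [^]\<^bsub>poly_ring\<^esub> l) \<odot>\<^bsub>M\<^esub> m) \<oplus>\<^bsub>M\<^esub> ((f [^]\<^bsub>poly_ring\<^esub> k) \<odot>\<^bsub>M\<^esub> n)) (k + l)"
  have F: "?F (coset I p') k' (coset I q') l' = frac f (f ^ l' * p' + f ^ k' * q') (k' + l')" for p' k' q' l'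
    by (simp add: M_smult M_add)
  have inner: "(\<Union>(n, l)\<in>frac f q l. ?F (coset I p') k' n l) = frac f (f ^ l * p' + f ^ k' * q) (k' + l)" for p' k'
  proof (rule UN_frac_const)
    fix q' l' assume "frac f q' l' = frac f q l"
    then obtain t where t: "f ^ (t + l) * q' - f ^ (t + l') * q \<in> I"
      unfolding frac_eq_iff by blast
    show "?F (coset I p') k' (coset I q') l' = frac f (f ^ l * p' + f ^ k' * q) (k' + l)"
      unfolding F frac_eq_iff
      using ideal_mult_left[OF ideal_I t, of "f ^ k' * f ^ k'"]
      by (intro exI[of _ t]) (simp add: algebra_simps power_add)
  qed
  have "(\<Union>(m, k)\<in>frac f p k. \<Union>(n, l)\<in>frac f q l. ?F m k n l) = frac f (f ^ l * p + f ^ k * q) (k + l)"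
  proof (rule UN_frac_const)
    fix p' k' assume "frac f p' k' = frac f p k"
    then obtain t where t: "f ^ (t + k) * p' - f ^ (t + k') * p \<in> I"
      unfolding frac_eq_iff by blast
    show "(\<Union>(n, l)\<in>frac f q l. ?F (coset I p') k' n l) = frac f (f ^ l * p + f ^ k * q) (k + l)"
      unfolding inner frac_eq_iff
      using ideal_mult_left[OF ideal_I t, of "f ^ l * f ^ l"]
      by (intro exI[of _ t]) (simp add: algebra_simps power_add)
  qed
  then show ?thesis
    by (simp add: localization_def)
qed

lemma frac_smult: "r \<odot>\<^bsub>localization poly_ring M f\<^esub> frac f p k = frac f (r * p) k"
proof -
  have "(\<Union>(m, k)\<in>frac f p k. loc_frac poly_ring M f (r \<odot>\<^bsub>M\<^esub> m) k) = frac f (r * p) k"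
  proof (rule UN_frac_const)
    fix q l assume "frac f q l = frac f p k"
    then obtain t where t: "f ^ (t + k) * q - f ^ (t + l) * p \<in> I"
      unfolding frac_eq_iff by blast
    show "loc_frac poly_ring M f (r \<odot>\<^bsub>M\<^esub> coset I q) l = frac f (r * p) k"
      unfolding M_smult frac_eq_iff
      using ideal_mult_left[OF ideal_I t, of r] by (intro exI[of _ t]) (simp add: algebra_simps)
  qed
  then show ?thesis
    by (simp add: localization_def)
qed

lemma loc_map_frac: "loc_map poly_ring M f g (frac f p k) = frac (f * g) (g ^ k * p) k"
proof -
  have "(\<Union>(m, k)\<in>frac f p k. loc_frac poly_ring M (f * g) (g ^ k \<odot>\<^bsub>M\<^esub> m) k) = frac (f * g) (g ^ k * p) k"
  proof (rule UN_frac_const)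
    fix q l assume "frac f q l = frac f p k"
    then obtain t where t: "f ^ (t + k) * q - f ^ (t + l) * p \<in> I"
      unfolding frac_eq_iff by blast
    show "loc_frac poly_ring M (f * g) (g ^ l \<odot>\<^bsub>M\<^esub> coset I q) l = frac (f * g) (g ^ k * p) k"
      unfolding M_smult frac_eq_iff
      using ideal_mult_left[OF ideal_I t, of "g ^ (t + k + l)"]
      by (intro exI[of _ t]) (simp add: algebra_simps power_add power_mult_distrib)
  qed
  then show ?thesis
    by (simp add: loc_map_def)
qed

lemma localization_carrier: "carrier (localization poly_ring M f) = {frac f p k | p k. True}"
  by (auto simp: localization_def M_carrier)

end

context poly_ideal
begin

subsection \<open>Cochains with a common denominator\<close>

definition cochain :: "nat \<Rightarrow> (4 \<Rightarrow> 'k poly4) \<Rightarrow> 4 \<Rightarrow> ('k poly4 set \<times> nat) set" where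
  "cochain N z = (\<lambda>i. frac (indet i) (z i) N)"

text \<open>\<open>cech_class N z\<close> is the coset of \<open>cochain N z\<close> modulo coboundaries.\<close>

definition cech_class :: "nat \<Rightarrow> (4 \<Rightarrow> 'k poly4) \<Rightarrow> (4 \<Rightarrow> ('k poly4 set \<times> nat) set) set" where
  "cech_class N z = range (\<lambda>m. cochain N (\<lambda>i. indet i ^ N * m + z i))"

abbreviation cochains where "cochains \<equiv> cech_cochains poly_ring M indet"
abbreviation cocycles where "cocycles \<equiv> cech_cocycles poly_ring M indet"
abbreviation coboundaries where "coboundaries \<equiv> cech_coboundaries poly_ring M indet"

lemma coboundaries_eq: "coboundaries = range (cochain 0 \<circ> (\<lambda>m i. m))"
  by (auto simp: cech_coboundaries_def M_carrier cochain_def image_image)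

lemma coboundaries_coset: "coboundaries +>\<^bsub>cochains\<^esub> cochain N z = cech_class N z"
proof -
  have "cochain 0 (\<lambda>i. m) \<oplus>\<^bsub>cochains\<^esub> cochain N z = cochain N (\<lambda>i. indet i ^ N * m + z i)" for m
    by (simp add: cech_cochains_def direct_product_def cochain_def frac_add)
  then show ?thesis
    unfolding a_r_coset_def' coboundaries_eq cech_class_def by auto
qed

lemma cochain_smult: "r \<odot>\<^bsub>cochains\<^esub> cochain N z = cochain N (\<lambda>i. r * z i)"
  by (simp add: cech_cochains_def direct_product_def cochain_def frac_smult)

lemma coboundaries_eq_cech_class: "coboundaries = cech_class 0 (\<lambda>i. 0)"
  unfolding coboundaries_eq cech_class_def by (simp add: comp_def)

lemma cech_class_shift: "cech_class N (\<lambda>i. indet i ^ N * m + z i) = cech_class N z"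
proof -
  have sub: "cech_class N (\<lambda>i. indet i ^ N * m + z i) \<subseteq> cech_class N z" for m z
  proof
    fix c assume "c \<in> cech_class N (\<lambda>i. indet i ^ N * m + z i)"
    then obtain m' where "c = cochain N (\<lambda>i. indet i ^ N * m' + (indet i ^ N * m + z i))"
      by (auto simp: cech_class_def)
    also have "\<dots> = cochain N (\<lambda>i. indet i ^ N * (m' + m) + z i)"
      by (simp add: algebra_simps)
    finally show "c \<in> cech_class N z"
      by (auto simp: cech_class_def)
  qed
  have "z = (\<lambda>i. indet i ^ N * (- m) + (indet i ^ N * m + z i))"
    by (simp add: algebra_simps)
  then have "cech_class N z \<subseteq> cech_class N (\<lambda>i. indet i ^ N * m + z i)"
    using sub[of "- m" "\<lambda>i. indet i ^ N * m + z i"] by simp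
  with sub show ?thesis by blast
qed

lemma cech_class_eq_coboundaries_iff:
  "cech_class N z = coboundaries \<longleftrightarrow> (\<exists>m. \<forall>i. \<exists>t. indet i ^ t * (z i - indet i ^ N * m) \<in> I)"
proof -
  have eq: "frac (indet i) (z i) N = frac (indet i) m 0 \<longleftrightarrow> (\<exists>t. indet i ^ t * (z i - indet i ^ N * m) \<in> I)" for i m
    unfolding frac_eq_iff by (simp add: power_add algebra_simps)
  have "cech_class N z = coboundaries \<longleftrightarrow> (\<exists>m. cochain N z = cochain 0 (\<lambda>i. m))"
  proof
    assume "cech_class N z = coboundaries"
    moreover have "cochain N z \<in> cech_class N z"
      unfolding cech_class_def by (intro range_eqI[of _ _ 0]) simp
    ultimately show "\<exists>m. cochain N z = cochain 0 (\<lambda>i. m)"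
      by (auto simp: coboundaries_eq)
  next
    assume "\<exists>m. cochain N z = cochain 0 (\<lambda>i. m)"
    then obtain m where m: "cochain N z = cochain 0 (\<lambda>i. m)" ..
    have "coboundaries +>\<^bsub>cochains\<^esub> cochain N z = coboundaries +>\<^bsub>cochains\<^esub> cochain 0 (\<lambda>i. m)"
      by (simp only: m)
    then have "cech_class N z = cech_class 0 (\<lambda>i. indet i ^ 0 * m + 0)"
      by (simp add: coboundaries_coset)
    then show "cech_class N z = coboundaries"
      unfolding cech_class_shift coboundaries_eq_cech_class by simp
  qed
  also have "\<dots> \<longleftrightarrow> (\<exists>m. \<forall>i. \<exists>t. indet i ^ t * (z i - indet i ^ N * m) \<in> I)"
    unfolding cochain_def fun_eq_iff eq by blast
  finally show ?thesis .
qed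

lemma H1_zero: "\<zero>\<^bsub>H1 I\<^esub> = coboundaries"
  by (simp add: H1_def local_cohomology1_def subquotient_def)

lemma H1_carrier_image: "carrier (H1 I) = (\<lambda>c. coboundaries +>\<^bsub>cochains\<^esub> c) ` cocycles"
  by (simp add: H1_def local_cohomology1_def subquotient_def)

lemma H1_smult: "r \<odot>\<^bsub>H1 I\<^esub> cech_class N z = cech_class N (\<lambda>i. r * z i)"
proof -
  have "r \<odot>\<^bsub>H1 I\<^esub> cech_class N z = (\<Union>c\<in>cech_class N z. coboundaries +>\<^bsub>cochains\<^esub> (r \<odot>\<^bsub>cochains\<^esub> c))"
    by (simp add: H1_def local_cohomology1_def subquotient_def)
  also have "\<dots> = (\<Union>m. cech_class N (\<lambda>i. indet i ^ N * (r * m) + r * z i))"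
    unfolding cech_class_def[of N z] by (simp add: cochain_smult coboundaries_coset algebra_simps)
  also have "\<dots> = cech_class N (\<lambda>i. r * z i)"
    unfolding cech_class_shift by simp
  finally show ?thesis .
qed

lemma common_denominator:
  assumes "\<And>i. c i = frac (indet i) (p i) (k i)"
  shows "c = cochain (\<Sum>i\<in>UNIV. k i) (\<lambda>i. indet i ^ (\<Sum>j\<in>UNIV - {i}. k j) * p i)"
proof
  fix i
  have "k i + (\<Sum>j\<in>UNIV - {i}. k j) = (\<Sum>i\<in>UNIV. k i)"
    by (simp add: sum.remove[of UNIV i])
  then show "c i = cochain (\<Sum>i\<in>UNIV. k i) (\<lambda>i. indet i ^ (\<Sum>j\<in>UNIV - {i}. k j) * p i) i"
    unfolding assms cochain_def using frac_expand[of "indet i" "p i" "k i" "\<Sum>j\<in>UNIV - {i}. k j"] by simp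
qed

lemma cochain_carrier: "cochain N z \<in> carrier cochains"
  by (auto simp: cech_cochains_def direct_product_def localization_carrier cochain_def)

lemma cochain_cocycle_iff:
  "cochain N z \<in> cocycles \<longleftrightarrow>
    (\<forall>i j. \<exists>t. (indet i * indet j) ^ t * (indet j ^ N * z i - indet i ^ N * z j) \<in> I)"
proof -
  have "loc_map poly_ring M (indet i) (indet j) (cochain N z i) = loc_map poly_ring M (indet j) (indet i) (cochain N z j)
    \<longleftrightarrow> (\<exists>t. (indet i * indet j) ^ t * (indet j ^ N * z i - indet i ^ N * z j) \<in> I)" (is "?L \<longleftrightarrow> _") for i j
  proof -
    have "?L \<longleftrightarrow> (\<exists>t. (indet i * indet j) ^ (t + N) * (indet j ^ N * z i - indet i ^ N * z j) \<in> I)"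
      unfolding cochain_def loc_map_frac mult.commute[of "indet j" "indet i"] frac_eq_iff
      by (simp add: algebra_simps)
    also have "\<dots> \<longleftrightarrow> (\<exists>t. (indet i * indet j) ^ t * (indet j ^ N * z i - indet i ^ N * z j) \<in> I)"
    proof
      assume "\<exists>t. (indet i * indet j) ^ t * (indet j ^ N * z i - indet i ^ N * z j) \<in> I"
      then obtain t where "(indet i * indet j) ^ t * (indet j ^ N * z i - indet i ^ N * z j) \<in> I" ..
      from ideal_mult_left[OF ideal_I this, of "(indet i * indet j) ^ N"]
      show "\<exists>t. (indet i * indet j) ^ (t + N) * (indet j ^ N * z i - indet i ^ N * z j) \<in> I"
        by (intro exI[of _ t]) (simp only: power_add mult_ac)
    qed blast
    finally show ?thesis .
  qed
  then show ?thesis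
    using cochain_carrier[of N z] by (simp add: cech_cocycles_def)
qed

lemma cochain_expand: "cochain N z = cochain (N + s) (\<lambda>i. indet i ^ s * z i)"
  unfolding cochain_def using frac_expand[of _ _ N s] by (intro ext) simp

text \<open>
  Raising the common denominator turns the equations of a cocycle, which a priori hold in
  the localizations, into equations in \<open>R/I\<close>.
\<close>

lemma cocycle_normal_form:
  assumes "cochain N z \<in> cocycles"
  obtains s where "\<And>i j. indet j ^ (N + s) * (indet i ^ s * z i) - indet i ^ (N + s) * (indet j ^ s * z j) \<in> I"
proof -
  obtain t where t: "(indet i * indet j) ^ t i j * (indet j ^ N * z i - indet i ^ N * z j) \<in> I" for i j
    using assms unfolding cochain_cocycle_iff by metis
  define s where "s = (\<Sum>i\<in>UNIV. \<Sum>j\<in>UNIV. t i j)"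
  have "indet j ^ (N + s) * (indet i ^ s * z i) - indet i ^ (N + s) * (indet j ^ s * z j) \<in> I" for i j
  proof -
    have "t i j \<le> s"
      unfolding s_def by (rule exponent_le_sum)
    then have "(indet i * indet j) ^ (s - t i j) * ((indet i * indet j) ^ t i j * (indet j ^ N * z i - indet i ^ N * z j)) =
        (indet i * indet j) ^ s * (indet j ^ N * z i - indet i ^ N * z j)"
      by (simp add: mult.assoc [symmetric] power_add [symmetric])
    also have "\<dots> = indet j ^ (N + s) * (indet i ^ s * z i) - indet i ^ (N + s) * (indet j ^ s * z j)"
      by (simp add: algebra_simps power_add power_mult_distrib)
    finally show ?thesis
      using ideal_mult_left[OF ideal_I t] by metis
  qed
  then show thesis
    by (rule that)
qed

subsection \<open>The grading\<close>

lemma homogeneous_indet_times: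
  assumes "p \<in> homogeneous_component n"
  shows "indet i ^ s * p \<in> homogeneous_component (n + int s)"
  unfolding homogeneous_component_def
proof (intro CollectI ballI)
  fix t assume "t \<in> keys (indet i ^ s * p)"
  then obtain u where "u \<in> keys p" "t = single i s + u"
    unfolding indet_power by (blast dest: keys_single_times)
  with assms show "int (\<Sum>i\<in>UNIV. lookup t i) = n + int s"
    by (simp add: homogeneous_component_def lookup_add sum.distrib lookup_single when_def)
qed

lemma localization_component_iff:
  "S \<in> localization_component poly_ring M (quotient_component I) f n \<longleftrightarrow>
    (\<exists>p k. S = frac f p k \<and> p \<in> homogeneous_component (n + int k))"
  by (auto simp: localization_component_def quotient_component_def a_r_coset_poly)

end

locale tetrahedron_ring = tetrahedron A for A +
  fixes I :: "('k::field) poly4 set"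
  assumes I_def: "I = lines_ideal A"

sublocale tetrahedron_ring \<subseteq> poly_ideal I
  by (rule poly_ideal.intro) (simp add: I_def ideal_lines_ideal)

context tetrahedron_ring
begin

lemma cochain_cocycle: "cocycle A N z \<Longrightarrow> cochain N z \<in> cocycles"
  unfolding cochain_cocycle_iff by (intro allI exI[of _ 0]) (simp add: cocycle_def I_def)

lemma cocycle_of_cochain:
  assumes "cochain N z \<in> cocycles"
  obtains s where "cocycle A (N + s) (\<lambda>i. indet i ^ s * z i)"
  using cocycle_normal_form[OF assms] unfolding cocycle_def I_def by metis

lemma H1_carrier: "carrier (H1 I) = {cech_class N z | N z. cocycle A N z}"
proof (intro equalityI subsetI)
  fix h assume "h \<in> carrier (H1 I)"
  then obtain c where c: "c \<in> cocycles" "h = coboundaries +>\<^bsub>cochains\<^esub> c"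
    unfolding H1_carrier_image by blast
  then have "\<forall>i. c i \<in> carrier (localization poly_ring M (indet i))"
    by (simp add: cech_cocycles_def cech_cochains_def direct_product_def)
  then have "\<forall>i. \<exists>p k. c i = frac (indet i) p k"
    unfolding localization_carrier by blast
  from choice[OF this] obtain p where "\<forall>i. \<exists>k. c i = frac (indet i) (p i) k" ..
  from choice[OF this] obtain k where pk: "\<forall>i. c i = frac (indet i) (p i) (k i)" ..
  from common_denominator[of c p k, OF pk[rule_format]] obtain N z where z: "c = cochain N z" ..
  obtain s where "cocycle A (N + s) (\<lambda>i. indet i ^ s * z i)"
    by (rule cocycle_of_cochain[OF c(1)[unfolded z]])
  moreover have "h = cech_class (N + s) (\<lambda>i. indet i ^ s * z i)"
    unfolding c(2) z cochain_expand[of N z s] coboundaries_coset ..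
  ultimately show "h \<in> {cech_class N z | N z. cocycle A N z}"
    by blast
next
  fix h assume "h \<in> {cech_class N z | N z. cocycle A N z}"
  then obtain N z where z: "cocycle A N z" "h = cech_class N z"
    by blast
  then show "h \<in> carrier (H1 I)"
    using cochain_cocycle[OF z(1)] unfolding H1_carrier_image coboundaries_coset [symmetric] by blast
qed

lemma H1_component_eq:
  "H1_component I n = {cech_class N z | N z. cocycle A N z \<and> (\<forall>i. z i \<in> homogeneous_component (n + int N))}"
proof (intro equalityI subsetI)
  fix h assume "h \<in> H1_component I n"
  then obtain c where c: "c \<in> cocycles" "h = coboundaries +>\<^bsub>cochains\<^esub> c"
      "\<forall>i. \<exists>p k. c i = frac (indet i) p k \<and> p \<in> homogeneous_component (n + int k)"
    unfolding H1_component_def local_cohomology1_component_def localization_component_iff by blast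
  from choice[OF c(3)] obtain p where
    "\<forall>i. \<exists>k. c i = frac (indet i) (p i) k \<and> p i \<in> homogeneous_component (n + int k)" ..
  from choice[OF this] obtain k where
    pk: "\<And>i. c i = frac (indet i) (p i) (k i)" "\<And>i. p i \<in> homogeneous_component (n + int (k i))"
    by blast
  define N where "N = (\<Sum>i\<in>UNIV. k i)"
  define z where "z i = indet i ^ (\<Sum>j\<in>UNIV - {i}. k j) * p i" for i
  have z: "c = cochain N z"
    unfolding N_def z_def by (rule common_denominator) (rule pk)
  have deg: "z i \<in> homogeneous_component (n + int N)" for i
  proof -
    have "N = k i + (\<Sum>j\<in>UNIV - {i}. k j)"
      by (simp add: N_def sum.remove[of UNIV i])
    then show ?thesis
      using homogeneous_indet_times[OF pk(2)[of i], of i "\<Sum>j\<in>UNIV - {i}. k j"] 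
      by (simp add: z_def add.assoc)
  qed
  obtain s where "cocycle A (N + s) (\<lambda>i. indet i ^ s * z i)"
    by (rule cocycle_of_cochain[OF c(1)[unfolded z]])
  moreover have "h = cech_class (N + s) (\<lambda>i. indet i ^ s * z i)"
    unfolding c(2) z cochain_expand[of N z s] coboundaries_coset ..
  moreover have "indet i ^ s * z i \<in> homogeneous_component (n + int (N + s))" for i
    using homogeneous_indet_times[OF deg[of i], of i s] by (simp add: add.assoc)
  ultimately show "h \<in> {cech_class N z | N z. cocycle A N z \<and> (\<forall>i. z i \<in> homogeneous_component (n + int N))}"
    by blast
next
  fix h assume "h \<in> {cech_class N z | N z. cocycle A N z \<and> (\<forall>i. z i \<in> homogeneous_component (n + int N))}"
  then obtain N z where z: "cocycle A N z" "h = cech_class N z" "\<And>i. z i \<in> homogeneous_component (n + int N)"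
    by blast
  have "\<forall>i. cochain N z i \<in> localization_component poly_ring M (quotient_component I) (indet i) n"
    unfolding localization_component_iff cochain_def using z(3) by blast
  with z(2) cochain_cocycle[OF z(1)] show "h \<in> H1_component I n"
    unfolding H1_component_def local_cohomology1_component_def coboundaries_coset [symmetric] by blast
qed

lemma cech_class_zero_iff_splits: "cech_class N z = \<zero>\<^bsub>H1 I\<^esub> \<longleftrightarrow> splits A N z"
proof -
  have "(\<exists>t. indet i ^ t * p \<in> I) \<longleftrightarrow> p \<in> lines_ideal_off A i" for i and p :: "'k poly4"
    using finite_bound_exponents[of A] lines_ideal_off_times_indet[of p A i]
      lines_ideal_off_cancel_indet[of i _ p A] lines_ideal_subset_off[of A i]
    unfolding I_def by (metis subsetD)
  then show ?thesis
    unfolding H1_zero cech_class_eq_coboundaries_iff splits_def by simp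
qed

end

section \<open>The degrees of obstructed exponents\<close>

abbreviation total_degree :: "(4 \<Rightarrow>\<^sub>0 nat) \<Rightarrow> nat" where
  "total_degree \<equiv> weight UNIV"

lemma total_degree_four: "total_degree b = lookup b 1 + lookup b 2 + lookup b 3 + lookup b 4"
  by (simp add: weight_def sum_four)

lemma obtain_exponents:
  fixes x y z w :: nat
  obtains b :: "4 \<Rightarrow>\<^sub>0 nat" where "lookup b 1 = x" "lookup b 2 = y" "lookup b 3 = z" "lookup b 4 = w"
proof
  let ?b = "single 1 x + single 2 y + single 3 z + single 4 w :: 4 \<Rightarrow>\<^sub>0 nat"
  show "lookup ?b 1 = x" "lookup ?b 2 = y" "lookup ?b 3 = z" "lookup ?b 4 = w"
    by (simp_all add: lookup_add lookup_single when_def)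
qed

definition tetra_region :: "int \<Rightarrow> int \<Rightarrow> int \<Rightarrow> int \<Rightarrow> int \<Rightarrow> int \<Rightarrow> int \<Rightarrow> int \<Rightarrow> int \<Rightarrow> int \<Rightarrow> bool" where
  "tetra_region a1 a2 a3 a4 a5 a6 x y z w \<longleftrightarrow>
    0 \<le> x \<and> 0 \<le> y \<and> 0 \<le> z \<and> 0 \<le> w \<and> x + y < a1 \<and> z + w < a6 \<and>
    a2 \<le> x + z \<and> a3 \<le> x + w \<and> a4 \<le> y + z \<and> a5 \<le> y + w"

text \<open>
  If no coordinate can be lowered, then either both coordinates of one of the two upper bounds can be lowered
  while one of the other two is raised, or one of the lower bounds for the degree is attained.
\<close>

lemma tetra_region_descent:
  fixes x y z w :: int
  assumes "tetra_region a1 a2 a3 a4 a5 a6 x y z w"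
    and "0 \<le> a2" "0 \<le> a3" "0 \<le> a4" "0 \<le> a5"
    and "x + y + z + w > a2 + a5" "x + y + z + w > a3 + a4"
    "x + y + z + w > a2 + a4 - a6 + 1" "x + y + z + w > a3 + a5 - a6 + 1"
    "x + y + z + w > a2 + a3 - a1 + 1" "x + y + z + w > a4 + a5 - a1 + 1"
  shows "\<exists>x' y' z' w'. tetra_region a1 a2 a3 a4 a5 a6 x' y' z' w' \<and> x' + y' + z' + w' = x + y + z + w - 1"
proof -
  let ?T = "tetra_region a1 a2 a3 a4 a5 a6"
  have "\<not> (\<not> ?T (x - 1) y z w \<and> \<not> ?T x (y - 1) z w \<and> \<not> ?T x y (z - 1) w \<and> \<not> ?T x y z (w - 1) \<and>
    \<not> ?T (x + 1) y (z - 1) (w - 1) \<and> \<not> ?T x (y + 1) (z - 1) (w - 1) \<and>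
    \<not> ?T (x - 1) (y - 1) (z + 1) w \<and> \<not> ?T (x - 1) (y - 1) z (w + 1))"
  proof (intro notI, elim conjE)
    note T = assms(1)[unfolded tetra_region_def]
    assume "\<not> ?T (x - 1) y z w"
    then have 1: "x = 0 \<or> x + z = a2 \<or> x + w = a3"
      using T unfolding tetra_region_def by linarith
    assume "\<not> ?T x (y - 1) z w"
    then have 2: "y = 0 \<or> y + z = a4 \<or> y + w = a5"
      using T unfolding tetra_region_def by linarith
    assume "\<not> ?T x y (z - 1) w"
    then have 3: "z = 0 \<or> x + z = a2 \<or> y + z = a4"
      using T unfolding tetra_region_def by linarith
    assume "\<not> ?T x y z (w - 1)"
    then have 4: "w = 0 \<or> x + w = a3 \<or> y + w = a5"
      using T unfolding tetra_region_def by linarith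
    assume "\<not> ?T (x + 1) y (z - 1) (w - 1)"
    then have 5: "z = 0 \<or> w = 0 \<or> a1 \<le> x + y + 1 \<or> y + z = a4 \<or> y + w = a5"
      using T unfolding tetra_region_def by linarith
    assume "\<not> ?T x (y + 1) (z - 1) (w - 1)"
    then have 6: "z = 0 \<or> w = 0 \<or> a1 \<le> x + y + 1 \<or> x + z = a2 \<or> x + w = a3"
      using T unfolding tetra_region_def by linarith
    assume "\<not> ?T (x - 1) (y - 1) (z + 1) w"
    then have 7: "x = 0 \<or> y = 0 \<or> a6 \<le> z + w + 1 \<or> x + w = a3 \<or> y + w = a5"
      using T unfolding tetra_region_def by linarith
    assume "\<not> ?T (x - 1) (y - 1) z (w + 1)"
    then have 8: "x = 0 \<or> y = 0 \<or> a6 \<le> z + w + 1 \<or> x + z = a2 \<or> y + z = a4"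
      using T unfolding tetra_region_def by linarith
    show False
      using 1 2 3 4 5 6 7 8 T assms(2-) by (smt (verit))
  qed
  then have "?T (x - 1) y z w \<or> ?T x (y - 1) z w \<or> ?T x y (z - 1) w \<or> ?T x y z (w - 1) \<or>
    ?T (x + 1) y (z - 1) (w - 1) \<or> ?T x (y + 1) (z - 1) (w - 1) \<or>
    ?T (x - 1) (y - 1) (z + 1) w \<or> ?T (x - 1) (y - 1) z (w + 1)"
    by blast
  then show ?thesis
    by (elim disjE) ((rule exI)+, rule conjI, assumption, simp)+
qed

context tetrahedron
begin

definition least_degree :: int where
  "least_degree = Max {int (A 1 3) + int (A 2 4), int (A 1 4) + int (A 2 3),
    int (A 1 3) + int (A 2 3) - int (A 3 4) + 1, int (A 1 4) + int (A 2 4) - int (A 3 4) + 1,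
    int (A 1 3) + int (A 1 4) - int (A 1 2) + 1, int (A 2 3) + int (A 2 4) - int (A 1 2) + 1}"

lemma obstructed_iff_region:
  "obstructed A b \<longleftrightarrow> tetra_region (A 1 2) (A 1 3) (A 1 4) (A 2 3) (A 2 4) (A 3 4)
    (lookup b 1) (lookup b 2) (lookup b 3) (lookup b 4)"
  by (auto simp: obstructed_def bad_def tetra_region_def)

lemma least_degree_le_iff:
  "least_degree \<le> n \<longleftrightarrow> int (A 1 3) + int (A 2 4) \<le> n \<and> int (A 1 4) + int (A 2 3) \<le> n \<and>
    int (A 1 3) + int (A 2 3) - int (A 3 4) + 1 \<le> n \<and> int (A 1 4) + int (A 2 4) - int (A 3 4) + 1 \<le> n \<and>
    int (A 1 3) + int (A 1 4) - int (A 1 2) + 1 \<le> n \<and> int (A 2 3) + int (A 2 4) - int (A 1 2) + 1 \<le> n"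
  unfolding least_degree_def by (subst Max_le_iff) (simp_all only: finite.intros insert_not_empty
      not_False_eq_True ball_simps simp_thms)

lemma obstructed_degree_bounds:
  assumes "obstructed A b"
  shows "least_degree \<le> total_degree b" "int (total_degree b) \<le> int (A 1 2) + int (A 3 4) - 2"
proof -
  note b = assms[unfolded obstructed_iff_region tetra_region_def]
  show "least_degree \<le> total_degree b"
    unfolding least_degree_le_iff total_degree_four of_nat_add using b by (intro conjI; linarith)
  show "int (total_degree b) \<le> int (A 1 2) + int (A 3 4) - 2"
    unfolding total_degree_four of_nat_add using b by linarith
qed

lemma obstructed_descent:
  assumes "obstructed A b" "least_degree < total_degree b"
  shows "\<exists>b'. obstructed A b' \<and> int (total_degree b') = int (total_degree b) - 1"
proof -
  let ?T = "tetra_region (A 1 2) (A 1 3) (A 1 4) (A 2 3) (A 2 4) (A 3 4)"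
  obtain x y z w where T: "?T x y z w" and sum: "x + y + z + w = int (total_degree b) - 1"
  proof -
    have "least_degree \<le> int (total_degree b) - 1"
      using assms(2) by simp
    note bounds = this[unfolded least_degree_le_iff total_degree_four of_nat_add]
    have "\<exists>x y z w. ?T x y z w \<and>
        x + y + z + w = int (lookup b 1) + int (lookup b 2) + int (lookup b 3) + int (lookup b 4) - 1"
      by (rule tetra_region_descent[OF assms(1)[unfolded obstructed_iff_region]]) (use bounds in linarith)+
    then show thesis
      using that by (auto simp: total_degree_four)
  qed
  obtain b' :: "4 \<Rightarrow>\<^sub>0 nat" where
    "lookup b' 1 = nat x" "lookup b' 2 = nat y" "lookup b' 3 = nat z" "lookup b' 4 = nat w"
    using obtain_exponents[of "nat x" "nat y" "nat z" "nat w"] by blast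
  with T sum have "obstructed A b'" "int (total_degree b') = int (total_degree b) - 1"
    unfolding obstructed_iff_region total_degree_four by (simp_all add: tetra_region_def)
  then show ?thesis by blast
qed

text \<open>
  Raising the first and the third coordinate is only restricted by the two upper bounds.
\<close>

lemma obstructed_ascent:
  assumes "obstructed A b" and n: "int (total_degree b) \<le> n" "n \<le> int (A 1 2) + int (A 3 4) - 2"
  obtains g where "obstructed A (g + b)" "int (total_degree (g + b)) = n"
proof -
  define u where "u = min (nat n - total_degree b) (A 1 2 - 1 - (lookup b 1 + lookup b 2))"
  define v where "v = nat n - total_degree b - u"
  have "obstructed A (single 1 u + single 3 v + b)"
    using assms unfolding obstructed_def bad_def total_degree_four u_def v_def
    by (auto simp: lookup_add lookup_single min_def)
  moreover have "int (total_degree (single 1 u + single 3 v + b)) = n"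
    using n by (auto simp: weight_add weight_single u_def v_def)
  ultimately show thesis
    by (rule that)
qed

lemma obstructed_of_least_degree:
  assumes "obstructed A b0"
  obtains b where "obstructed A b" "int (total_degree b) = least_degree"
proof -
  have "\<exists>b. obstructed A b \<and> int (total_degree b) = least_degree" if "obstructed A b0" for b0
    using that
  proof (induction "total_degree b0" arbitrary: b0 rule: less_induct)
    case less
    show ?case
    proof (cases "least_degree < total_degree b0")
      case True
      then obtain b' where "obstructed A b'" "int (total_degree b') = int (total_degree b0) - 1"
        using obstructed_descent less.prems by blast
      then show ?thesis
        using less.hyps[of b'] by simp
    next
      case False
      then show ?thesis
        using obstructed_degree_bounds(1)[OF less.prems] less.prems by force
    qed
  qed
  then show thesis
    using assms that by blast
qed

lemma degrees_of_obstructed: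
  assumes "obstructed A b0"
  shows "{int (total_degree b) | b. obstructed A b} = {least_degree..int (A 1 2) + int (A 3 4) - 2}"
proof (intro equalityI subsetI)
  fix n assume n: "n \<in> {least_degree..int (A 1 2) + int (A 3 4) - 2}"
  obtain b where b: "obstructed A b" "int (total_degree b) = least_degree"
    by (rule obstructed_of_least_degree[OF assms])
  obtain g where "obstructed A (g + b)" "int (total_degree (g + b)) = n"
    by (rule obstructed_ascent[OF b(1), of n]) (use b n in auto)
  then show "n \<in> {int (total_degree b) | b. obstructed A b}"
    by blast
qed (use obstructed_degree_bounds in auto)

end

section \<open>The invariants of the first local cohomology\<close>

context tetrahedron_ring
begin

lemma cech_class_eq_zero_iff:
  assumes "cocycle A N z"
  shows "cech_class N z = \<zero>\<^bsub>H1 I\<^esub> \<longleftrightarrow>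
    (\<forall>b. obstructed A b \<longrightarrow> fraction_coeff N z 1 b = fraction_coeff N z 3 b)"
  by (simp add: cech_class_zero_iff_splits splits_iff[OF assms])

lemma monomial_class_nonzero:
  assumes N: "\<And>i j. A i j \<le> N" and b: "obstructed A b" and gb: "obstructed A (g + b)"
  shows "cech_class N (\<lambda>i. single g 1 * monomial_cochain N b i) \<noteq> \<zero>\<^bsub>H1 I\<^esub>"
proof -
  have "cocycle A N (\<lambda>i. single g 1 * monomial_cochain N b i :: 'k poly4)"
    by (intro cocycle_mult cocycle_monomial_cochain b N)
  moreover have "fraction_coeff N (\<lambda>i. single g 1 * monomial_cochain N b i :: 'k poly4) 1 (g + b) = 1"
    by (simp add: monomial_cochain_def mult_single ac_simps)
  moreover have "fraction_coeff N (\<lambda>i. single g 1 * monomial_cochain N b i :: 'k poly4) 3 (g + b) = 0"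
    by (simp add: monomial_cochain_def)
  ultimately show ?thesis
    using gb cech_class_eq_zero_iff zero_neq_one by metis
qed

lemma monomial_cochain_homogeneous:
  "monomial_cochain N b i \<in> (homogeneous_component (int (total_degree b) + int N) :: 'k poly4 set)"
  unfolding homogeneous_component_def weight_def [symmetric]
  by (simp add: monomial_cochain_def weight_add weight_single)

text \<open>
  A homogeneous cocycle that does not split has a non-zero coefficient at an obstructed exponent, which then has the same degree;
  conversely, the cochain of an obstructed monomial is homogeneous.
\<close>

lemma nonzero_degrees_H1:
  "nonzero_degrees (H1 I) (H1_component I) = {int (total_degree b) | b. obstructed A b}"
proof (intro equalityI subsetI)
  fix n assume "n \<in> nonzero_degrees (H1 I) (H1_component I)"
  then have ne: "H1_component I n \<noteq> {\<zero>\<^bsub>H1 I\<^esub>}"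
    by (simp add: nonzero_degrees_def)
  have "cech_class 0 (\<lambda>i. 0) \<in> H1_component I n"
    unfolding H1_component_eq
    by (intro CollectI exI[of _ 0] exI[of _ "\<lambda>i. 0"])
      (simp add: cocycle_def homogeneous_component_def ideal_0[OF ideal_lines_ideal])
  then have "\<zero>\<^bsub>H1 I\<^esub> \<in> H1_component I n"
    by (simp add: H1_zero coboundaries_eq_cech_class)
  with ne obtain h where h: "h \<in> H1_component I n" "h \<noteq> \<zero>\<^bsub>H1 I\<^esub>"
    by blast
  obtain N z where z: "h = cech_class N z" "cocycle A N z" "\<And>i. z i \<in> homogeneous_component (n + int N)"
    using h(1) unfolding H1_component_eq by blast
  obtain b where b: "obstructed A b" "fraction_coeff N z 1 b \<noteq> fraction_coeff N z 3 b"
    using h(2) cech_class_eq_zero_iff[OF z(2)] z(1) by blast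
  then obtain i where "fraction_coeff N z i b \<noteq> 0"
    by metis
  then have "single i N + b \<in> keys (z i)"
    by (simp add: in_keys_iff)
  then have "int (total_degree (single i N + b)) = n + int N"
    using z(3)[of i] by (simp add: homogeneous_component_def weight_def)
  then have "int (total_degree b) = n"
    by (simp add: weight_add weight_single)
  with b(1) show "n \<in> {int (total_degree b) | b. obstructed A b}"
    by blast
next
  fix n assume "n \<in> {int (total_degree b) | b. obstructed A b}"
  then obtain b where b: "obstructed A b" "n = int (total_degree b)"
    by blast
  obtain N where N: "\<And>i j. A i j \<le> N"
    using finite_bound_exponents[of A] by blast
  have "cech_class N (monomial_cochain N b) \<in> H1_component I n"
    unfolding H1_component_eq b(2) using cocycle_monomial_cochain[OF b(1) N] monomial_cochain_homogeneous by blast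
  moreover have "cech_class N (monomial_cochain N b) \<noteq> \<zero>\<^bsub>H1 I\<^esub>"
    using monomial_class_nonzero[OF N b(1), of 0] b(1) by simp
  ultimately show "n \<in> nonzero_degrees (H1 I) (H1_component I)"
    by (auto simp: nonzero_degrees_def)
qed

lemma H1_carrier_nonzero:
  assumes "obstructed A b"
  shows "carrier (H1 I) \<noteq> {\<zero>\<^bsub>H1 I\<^esub>}"
proof -
  obtain N where N: "\<And>i j. A i j \<le> N"
    using finite_bound_exponents[of A] by blast
  have "cech_class N (monomial_cochain N b) \<in> carrier (H1 I)"
    unfolding H1_carrier using cocycle_monomial_cochain[OF assms N] by blast
  moreover have "cech_class N (monomial_cochain N b) \<noteq> \<zero>\<^bsub>H1 I\<^esub>"
    using monomial_class_nonzero[OF N assms, of 0] assms by simp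
  ultimately show ?thesis
    by blast
qed

lemma irrelevant_power: "ideal_power poly_ring irrelevant_ideal k = (weight_ideal UNIV k :: 'k poly4 set)"
  using ideal_power_indets[of UNIV k] by (simp add: irrelevant_ideal_def UNIV_four)

text \<open>
  A monomial whose degree is at least the number of degrees of the cohomology moves every obstructed exponent beyond the
  maximal degree. On the other hand, one monomial leads from the least to the maximal degree.
\<close>

lemma k_invariant_H1:
  assumes "obstructed A b0"
  shows "int (k_invariant I) = int (A 1 2) + int (A 3 4) - least_degree - 1"
proof -
  define d where "d = nat (int (A 1 2) + int (A 3 4) - least_degree - 1)"
  have d: "int d = int (A 1 2) + int (A 3 4) - least_degree - 1"
    using obstructed_degree_bounds[OF assms] by (simp add: d_def)
  have "k_invariant I = d"
    unfolding k_invariant_def least_annihilating_power_def irrelevant_power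
  proof (rule Least_equality)
    show "\<forall>r\<in>weight_ideal UNIV d. \<forall>h\<in>carrier (H1 I). r \<odot>\<^bsub>H1 I\<^esub> h = \<zero>\<^bsub>H1 I\<^esub>"
    proof (intro ballI)
      fix r :: "'k poly4" and h assume r: "r \<in> weight_ideal UNIV d" and "h \<in> carrier (H1 I)"
      then obtain N z where z: "h = cech_class N z" "cocycle A N z"
        unfolding H1_carrier by blast
      have "fraction_coeff N (\<lambda>i. r * z i) 1 b = fraction_coeff N (\<lambda>i. r * z i) 3 b" if b: "obstructed A b" for b
      proof -
        have expand: "fraction_coeff N (\<lambda>i. r * z i) i b =
          (\<Sum>g\<in>keys r. fraction_coeff N (\<lambda>i. single g (lookup r g) * z i) i b)" for i
          by (subst poly_mapping_sum_single[of r]) (simp add: sum_distrib_right lookup_sum)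
        have "fraction_coeff N (\<lambda>i. single g (lookup r g) * z i) 1 b =
          fraction_coeff N (\<lambda>i. single g (lookup r g) * z i) 3 b" if g: "g \<in> keys r" for g
        proof (rule monomial_mult_unobstructs[OF z(2) _ b])
          fix b' assume "obstructed A b'"
          moreover have "d \<le> total_degree g"
            using r g by (simp add: weight_ideal_def)
          ultimately show "\<not> obstructed A (g + b')"
            using obstructed_degree_bounds(1)[of b'] obstructed_degree_bounds(2)[of "g + b'"] d
            by (auto simp: weight_add)
        qed
        then show ?thesis
          unfolding expand by (rule sum.cong[OF refl])
      qed
      then show "r \<odot>\<^bsub>H1 I\<^esub> h = \<zero>\<^bsub>H1 I\<^esub>"
        unfolding z(1) H1_smult using cech_class_eq_zero_iff[OF cocycle_mult[OF z(2)]] by blast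
    qed
  next
    fix k assume k: "\<forall>r\<in>weight_ideal UNIV k. \<forall>h\<in>carrier (H1 I). r \<odot>\<^bsub>H1 I\<^esub> h = \<zero>\<^bsub>H1 I\<^esub>"
    obtain N where N: "\<And>i j. A i j \<le> N"
      using finite_bound_exponents[of A] by blast
    obtain b where b: "obstructed A b" "int (total_degree b) = least_degree"
      by (rule obstructed_of_least_degree[OF assms])
    obtain g where g: "obstructed A (g + b)" "int (total_degree (g + b)) = int (A 1 2) + int (A 3 4) - 2"
      by (rule obstructed_ascent[OF b(1), of "int (A 1 2) + int (A 3 4) - 2"])
        (use obstructed_degree_bounds(2)[OF b(1)] in auto)
    show "d \<le> k"
    proof (rule ccontr)
      assume "\<not> d \<le> k"
      then have "single g 1 \<in> (weight_ideal UNIV k :: 'k poly4 set)"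
        using g(2) b(2) d by (simp add: weight_ideal_def weight_add)
      moreover have "cech_class N (monomial_cochain N b) \<in> carrier (H1 I)"
        unfolding H1_carrier using cocycle_monomial_cochain[OF b(1) N] by blast
      ultimately have "single g 1 \<odot>\<^bsub>H1 I\<^esub> cech_class N (monomial_cochain N b) = \<zero>\<^bsub>H1 I\<^esub>"
        using k by blast
      then show False
        using monomial_class_nonzero[OF N b(1) g(1)] unfolding H1_smult by blast
    qed
  qed
  then show ?thesis
    using d by simp
qed

lemma invariants_if_obstructed:
  assumes b0: "obstructed A b0"
  shows "least_degree \<le> int (A 1 2) + int (A 3 4) - 2"
    and "diam (H1 I) (H1_component I) = int (A 1 2) + int (A 3 4) - least_degree - 1"
    and "int (k_invariant I) = diam (H1 I) (H1_component I)"
    and "has_no_gap (H1 I) (H1_component I)"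
proof -
  show le: "least_degree \<le> int (A 1 2) + int (A 3 4) - 2"
    using obstructed_degree_bounds[OF b0] by simp
  have degs: "nonzero_degrees (H1 I) (H1_component I) = {least_degree..int (A 1 2) + int (A 3 4) - 2}"
    unfolding nonzero_degrees_H1 by (rule degrees_of_obstructed[OF b0])
  have "Max {least_degree..int (A 1 2) + int (A 3 4) - 2} = int (A 1 2) + int (A 3 4) - 2"
    "Min {least_degree..int (A 1 2) + int (A 3 4) - 2} = least_degree"
    using le by (auto intro!: Max_eqI Min_eqI)
  then show diam: "diam (H1 I) (H1_component I) = int (A 1 2) + int (A 3 4) - least_degree - 1"
    using H1_carrier_nonzero[OF b0] by (simp add: diam_def degs)
  show "int (k_invariant I) = diam (H1 I) (H1_component I)"
    unfolding diam by (rule k_invariant_H1[OF b0])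
  show "has_no_gap (H1 I) (H1_component I)"
    using H1_carrier_nonzero[OF b0] by (auto simp: has_no_gap_def degs)
qed

end

section \<open>Regular sequences and chains of prime ideals\<close>

context cring
begin

text \<open>An ideal that is maximal among those disjoint from a multiplicatively closed set is prime.\<close>

lemma exists_prime_disjoint:
  assumes J: "ideal J R" and S: "S \<subseteq> carrier R" "\<one> \<in> S" "\<And>s t. s \<in> S \<Longrightarrow> t \<in> S \<Longrightarrow> s \<otimes> t \<in> S"
    and disj: "J \<inter> S = {}"
  obtains Q where "primeideal Q R" "J \<subseteq> Q" "Q \<inter> S = {}"
proof -
  define Fam where "Fam = {Q. ideal Q R \<and> J \<subseteq> Q \<and> Q \<inter> S = {}}"
  have "\<exists>Q\<in>Fam. \<forall>Y\<in>Fam. Q \<subseteq> Y \<longrightarrow> Y = Q"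
  proof (rule subset_Zorn_nonempty)
    show "Fam \<noteq> {}"
      using J disj by (auto simp: Fam_def)
  next
    fix C assume C: "C \<noteq> {}" "subset.chain Fam C"
    then have "subset.chain {I. ideal I R} C"
      by (auto simp: pred_on.chain_def Fam_def)
    from chain_Union_is_ideal[OF this] C(1) have "ideal (\<Union>C) R"
      by simp
    then show "\<Union>C \<in> Fam"
      using C by (auto simp: pred_on.chain_def Fam_def)
  qed
  then obtain Q where Q_Fam: "Q \<in> Fam" and Q_max: "\<forall>Y\<in>Fam. Q \<subseteq> Y \<longrightarrow> Y = Q" ..
  then have Q: "ideal Q R" "J \<subseteq> Q" "Q \<inter> S = {}"
    by (simp_all add: Fam_def)
  have max: "\<And>Y. ideal Y R \<Longrightarrow> Q \<subseteq> Y \<Longrightarrow> Y \<inter> S = {} \<Longrightarrow> Y = Q"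
    using Q_max Q(2) by (simp add: Fam_def)
  interpret Q: ideal Q R by (rule Q(1))
  have meets: "\<exists>q\<in>Q. \<exists>r\<in>carrier R. q \<oplus> r \<otimes> a \<in> S" if a: "a \<in> carrier R" "a \<notin> Q" for a
  proof -
    let ?Y = "Q <+>\<^bsub>R\<^esub> PIdl a"
    have Y: "ideal ?Y R"
      by (rule add_ideals[OF Q(1) cgenideal_ideal[OF a(1)]])
    have "q \<in> ?Y" if q: "q \<in> Q" for q
    proof -
      have "q \<oplus> \<zero> \<otimes> a \<in> ?Y"
        using q unfolding set_add_def' cgenideal_def by blast
      then show ?thesis
        using q a by (simp add: Q.a_subset[THEN subsetD])
    qed
    moreover have "a \<in> ?Y"
    proof -
      have "\<zero> \<oplus> \<one> \<otimes> a \<in> ?Y"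
        using Q.zero_closed unfolding set_add_def' cgenideal_def by blast
      then show ?thesis
        using a by simp
    qed
    ultimately have "?Y \<inter> S \<noteq> {}"
      using max[OF Y] a(2) by blast
    then show ?thesis
      unfolding set_add_def' cgenideal_def by blast
  qed
  have "primeideal Q R"
  proof (rule primeidealI[OF Q(1) is_cring])
    show "carrier R \<noteq> Q"
      using S Q(3) by blast
  next
    fix a b assume ab: "a \<in> carrier R" "b \<in> carrier R" "a \<otimes> b \<in> Q"
    show "a \<in> Q \<or> b \<in> Q"
    proof (rule ccontr)
      assume "\<not> (a \<in> Q \<or> b \<in> Q)"
      with ab meets obtain q r q' r' where
        q: "q \<in> Q" "r \<in> carrier R" "q \<oplus> r \<otimes> a \<in> S" and
        q': "q' \<in> Q" "r' \<in> carrier R" "q' \<oplus> r' \<otimes> b \<in> S"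
        by metis
      have c: "q \<in> carrier R" "q' \<in> carrier R"
        using q q' Q.a_subset by auto
      have "(q \<oplus> r \<otimes> a) \<otimes> (q' \<oplus> r' \<otimes> b) =
          q \<otimes> (q' \<oplus> r' \<otimes> b) \<oplus> ((r \<otimes> a) \<otimes> q' \<oplus> (r \<otimes> r') \<otimes> (a \<otimes> b))"
        using c q q' ab by (simp add: l_distr r_distr m_ac a_ac)
      also have "\<dots> \<in> Q"
        using c q q' ab
        by (intro Q.a_closed Q.I_l_closed[of q'] Q.I_l_closed[of "a \<otimes> b"] Q.I_r_closed[of q]) auto
      finally show False
        using S(3)[OF q(3) q'(3)] Q(3) by blast
    qed
  qed
  with Q that show thesis
    by blast
qed

text \<open>
  An element that is regular modulo \<open>J\<close> lies in no minimal prime of \<open>J\<close>: below a prime \<open>Q\<close>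
  that contains \<open>J\<close> there is one that avoids all products of a power of the element with an element outside \<open>Q\<close>.
\<close>

lemma exists_smaller_prime_avoiding_regular:
  assumes J: "ideal J R" and Q: "primeideal Q R" "J \<subseteq> Q" and r: "r \<in> Q"
    and reg: "\<And>a. a \<in> carrier R \<Longrightarrow> r \<otimes> a \<in> J \<Longrightarrow> a \<in> J"
  obtains Q' where "primeideal Q' R" "J \<subseteq> Q'" "Q' \<subset> Q"
proof -
  interpret Q: primeideal Q R by (rule Q(1))
  have r_carr: "r \<in> carrier R"
    using r Q.a_subset by blast
  have one: "\<one> \<notin> Q"
    using Q.one_imp_carrier Q.I_notcarr by blast
  define S where "S = {r [^] m \<otimes> s | (m :: nat) s. s \<in> carrier R \<and> s \<notin> Q}"
  have reg_pow: "r [^] (m :: nat) \<otimes> a \<in> J \<Longrightarrow> a \<in> J" if "a \<in> carrier R" for m a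
  proof (induction m)
    case (Suc m)
    have "r \<otimes> (r [^] m \<otimes> a) = r [^] Suc m \<otimes> a"
      using that r_carr by (simp add: m_ac)
    with Suc reg[of "r [^] m \<otimes> a"] show ?case
      using that r_carr by simp
  qed (use that in simp)
  have "S \<subseteq> carrier R"
    using r_carr by (auto simp: S_def)
  moreover have "\<one> \<in> S"
    unfolding S_def using one by (intro CollectI exI[of _ "0::nat"] exI[of _ \<one>]) simp
  moreover have "x \<otimes> y \<in> S" if xy: "x \<in> S" "y \<in> S" for x y
  proof -
    obtain m s n t where "x = r [^] (m :: nat) \<otimes> s" "y = r [^] (n :: nat) \<otimes> t"
      and st: "s \<in> carrier R" "s \<notin> Q" "t \<in> carrier R" "t \<notin> Q"
      using xy unfolding S_def by blast
    then have "x \<otimes> y = r [^] (m + n) \<otimes> (s \<otimes> t)"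
      using r_carr by (simp add: nat_pow_mult [symmetric] m_ac)
    moreover have "s \<otimes> t \<notin> Q"
      using st Q.I_prime by blast
    ultimately show ?thesis
      unfolding S_def using st by blast
  qed
  moreover have "J \<inter> S = {}"
    using reg_pow Q(2) by (auto simp: S_def)
  ultimately obtain Q' where Q': "primeideal Q' R" "J \<subseteq> Q'" "Q' \<inter> S = {}"
    by (rule exists_prime_disjoint[OF J])
  have "r \<otimes> \<one> \<in> S" 
    unfolding S_def using one r_carr by (intro CollectI exI[of _ "1::nat"] exI[of _ \<one>]) simp
  then have "r \<notin> Q'"
    using Q'(3) r_carr by auto
  moreover have "Q' \<subseteq> Q"
  proof
    fix s assume s: "s \<in> Q'"
    then have s_carr: "s \<in> carrier R"
      using Q'(1) by (meson additive_subgroup.a_Hcarr ideal.axioms(1) primeideal.axioms(1))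
    show "s \<in> Q"
    proof (rule ccontr)
      assume "s \<notin> Q"
      then have "r [^] (0::nat) \<otimes> s \<in> S"
        unfolding S_def using s_carr by blast
      then show False
        using s s_carr Q'(3) by auto
    qed
  qed
  ultimately show thesis
    using that Q' r by blast
qed

lemma regular_sequence_chain:
  assumes rs: "regular_sequence R rs" and P: "primeideal P R" and rsP: "set rs \<subseteq> P"
  shows "\<exists>Q :: nat \<Rightarrow> 'a set. (\<forall>i \<le> length rs. primeideal (Q i) R) \<and>
    (\<forall>i < length rs. Q i \<subset> Q (Suc i)) \<and> Q (length rs) = P"
proof -
  let ?n = "length rs"
  have "j \<le> ?n \<Longrightarrow> \<exists>Q :: nat \<Rightarrow> 'a set. (\<forall>i. ?n - j \<le> i \<and> i \<le> ?n \<longrightarrow> primeideal (Q i) R) \<and>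
    (\<forall>i. ?n - j \<le> i \<and> i < ?n \<longrightarrow> Q i \<subset> Q (Suc i)) \<and> Q ?n = P \<and> set (take (?n - j) rs) \<subseteq> Q (?n - j)" for j
  proof (induction j)
    case 0
    show ?case
      using P rsP by (intro exI[of _ "\<lambda>i. P"]) auto
  next
    case (Suc j)
    then obtain Q where Q: "\<And>i. ?n - j \<le> i \<Longrightarrow> i \<le> ?n \<Longrightarrow> primeideal (Q i) R"
      "\<And>i. ?n - j \<le> i \<Longrightarrow> i < ?n \<Longrightarrow> Q i \<subset> Q (Suc i)" "Q ?n = P"
      "set (take (?n - j) rs) \<subseteq> Q (?n - j)"
      by (metis Suc_leD)
    define k where "k = ?n - Suc j"
    have k: "k < ?n" "?n - j = Suc k"
      using Suc.prems by (auto simp: k_def)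
    let ?J = "Idl (set (take k rs))"
    have carr: "set (take k rs) \<subseteq> carrier R"
      using rs set_take_subset[of k rs] by (auto simp: regular_sequence_def)
    have sub: "set (take k rs) \<subseteq> Q (Suc k)" "rs ! k \<in> Q (Suc k)"
      using Q(4) k by (auto simp: take_Suc_conv_app_nth)
    have prime: "primeideal (Q (Suc k)) R"
      using Q(1) k by simp
    obtain Q' where Q': "primeideal Q' R" "?J \<subseteq> Q'" "Q' \<subset> Q (Suc k)"
    proof (rule exists_smaller_prime_avoiding_regular)
      show "ideal ?J R"
        by (rule genideal_ideal[OF carr])
      show "primeideal (Q (Suc k)) R"
        by (rule prime)
      show "?J \<subseteq> Q (Suc k)"
        using prime sub(1) by (intro genideal_minimal) (auto simp: primeideal.axioms)
      show "rs ! k \<in> Q (Suc k)"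
        by (rule sub(2))
      show "a \<in> ?J" if "a \<in> carrier R" "rs ! k \<otimes> a \<in> ?J" for a
        using rs k(1) that by (auto simp: regular_sequence_def)
    qed
    have "set (take k rs) \<subseteq> Q'"
      using genideal_self[OF carr] Q'(2) by blast
    then show ?case
      using Q Q' k unfolding k_def [symmetric]
      by (intro exI[of _ "Q(k := Q')"]) (auto simp: le_Suc_eq Suc_le_eq dest: le_neq_implies_less)
  qed
  from this[of ?n] show ?thesis
    by auto
qed

lemma ideal_depth_le_prime_height:
  assumes "primeideal P R"
  shows "ideal_depth R P \<le> prime_height R P"
  unfolding ideal_depth_def
proof (rule Sup_least)
  fix d assume "d \<in> {enat (length rs) | rs. regular_sequence R rs \<and> set rs \<subseteq> P}"
  then obtain rs where rs: "d = enat (length rs)" "regular_sequence R rs" "set rs \<subseteq> P"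
    by blast
  show "d \<le> prime_height R P"
    unfolding prime_height_def rs(1)
    by (rule Sup_upper) (use regular_sequence_chain[OF rs(2) assms rs(3)] in blast)
qed

end

section \<open>The polynomial ring is Noetherian\<close>

lemma monotone_subsequence_nat:
  fixes s :: "nat \<Rightarrow> nat"
  obtains f :: "nat \<Rightarrow> nat" where "strict_mono f" "mono (\<lambda>n. s (f n))"
proof -
  have "\<exists>k\<ge>m. \<forall>j\<ge>m. s k \<le> s j" for m
    using ex_has_least_nat[of "\<lambda>k. m \<le> k" m s] by auto
  then obtain g where g: "\<And>m. m \<le> g m" "\<And>m j. m \<le> j \<Longrightarrow> s (g m) \<le> s j"
    by metis
  define f where "f = rec_nat (g 0) (\<lambda>_ k. g (Suc k))"
  have f_Suc: "f (Suc n) = g (Suc (f n))" for n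
    by (simp add: f_def)
  have f_image: "\<exists>m\<le>f n. f n = g m" for n
    using g(1) by (cases n) (auto simp: f_def intro: exI[of _ 0])
  have "f n < f (Suc n)" for n
    using g(1)[of "Suc (f n)"] by (simp add: f_Suc)
  moreover have "s (f n) \<le> s (f (Suc n))" for n
  proof -
    obtain m where "m \<le> f n" "f n = g m"
      using f_image by blast
    then show ?thesis
      using g(2)[of m "f (Suc n)"] \<open>f n < f (Suc n)\<close> by simp
  qed
  ultimately show thesis
    by (intro that[of f]) (simp_all add: strict_mono_Suc_iff mono_iff_le_Suc)
qed

text \<open>Dickson's lemma: divisibility of monomials is a well-quasi-order.\<close>

lemma dickson:
  fixes f :: "nat \<Rightarrow> 'i::finite \<Rightarrow>\<^sub>0 nat"
  shows "\<exists>i j d. i < j \<and> f j = f i + d"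
proof -
  have "\<exists>r :: nat \<Rightarrow> nat. strict_mono r \<and> (\<forall>k\<in>V. mono (\<lambda>n. lookup (f (r n)) k))" if "finite V" for V
    using that
  proof (induction V)
    case empty
    show ?case
      by (intro exI[of _ id]) (simp add: strict_mono_def)
  next
    case (insert k V)
    then obtain r :: "nat \<Rightarrow> nat" where r: "strict_mono r" "\<And>k. k \<in> V \<Longrightarrow> mono (\<lambda>n. lookup (f (r n)) k)"
      by blast
    obtain t :: "nat \<Rightarrow> nat" where t: "strict_mono t" "mono (\<lambda>n. lookup (f (r (t n))) k)"
      by (rule monotone_subsequence_nat)
    have "mono (\<lambda>n. lookup (f (r (t n))) l)" if "l \<in> V" for l
      using r(2)[OF that] strict_mono_mono[OF t(1)] by (auto simp: mono_def)
    with t r(1) show ?case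
      by (intro exI[of _ "r \<circ> t"]) (auto simp: strict_mono_def)
  qed
  from this[of UNIV] obtain r :: "nat \<Rightarrow> nat" where r: "strict_mono r" "\<And>k. mono (\<lambda>n. lookup (f (r n)) k)"
    by auto
  have "lookup (f (r 0)) k \<le> lookup (f (r 1)) k" for k
    using r(2)[of k] by (auto simp: mono_def)
  then obtain d where "f (r 1) = f (r 0) + d"
    by (rule exponent_diff)
  moreover have "r 0 < r 1"
    using r(1) by (simp add: strict_mono_def)
  ultimately show ?thesis
    by blast
qed

lemma exponent_nonneg: "(0 :: 'i::linorder \<Rightarrow>\<^sub>0 nat) \<le> d"
proof (rule ccontr)
  assume "\<not> 0 \<le> d"
  then have "d < 0"
    by simp
  then show False
    by (auto simp: less_poly_mapping.rep_eq less_fun_def)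
qed

text \<open>
  In an infinite descending sequence, Dickson's lemma would provide a member that is divisible by an earlier one, and hence not
  smaller.
\<close>

lemma wf_exponents: "wf {(s, t :: 4 \<Rightarrow>\<^sub>0 nat). s < t}"
  unfolding wf_iff_no_infinite_down_chain
proof
  assume "\<exists>f :: nat \<Rightarrow> 4 \<Rightarrow>\<^sub>0 nat. \<forall>i. (f (Suc i), f i) \<in> {(s, t). s < t}"
  then obtain f :: "nat \<Rightarrow> 4 \<Rightarrow>\<^sub>0 nat" where f: "\<And>i. f (Suc i) < f i"
    by auto
  obtain i j d where ij: "i < j" "f j = f i + d"
    using dickson[of f] by blast
  have "f j < f i"
    using ij(1) by (rule less_Suc_induct) (auto intro: f less_trans)
  moreover have "f i \<le> f j"
    unfolding ij(2) using exponent_nonneg[of d] by (metis add.right_neutral add_left_mono)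
  ultimately show False
    by simp
qed

abbreviation lead_exponent :: "('k::field) poly4 \<Rightarrow> 4 \<Rightarrow>\<^sub>0 nat" where
  "lead_exponent p \<equiv> Max (keys p)"

lemma lead_exponent_in_keys: "p \<noteq> 0 \<Longrightarrow> lead_exponent p \<in> keys p"
  by (intro Max_in) auto

text \<open>
  In an ideal that is not finitely generated, one may choose successively elements of least leading exponent
  outside the ideal generated by the previous ones. By Dickson's lemma, the leading monomial of one of
  them is divisible by that of an earlier one, and can be cancelled.
\<close>

lemma noetherian_poly4: "noetherian_ring (poly_ring :: ('k::field) poly4 ring)"
proof -
  interpret cring "poly_ring :: 'k poly4 ring" by auto
  let ?R = "poly_ring :: 'k poly4 ring"
  have "\<exists>B \<subseteq> carrier ?R. finite B \<and> J = genideal ?R B" if J: "ideal J ?R" for J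
  proof (rule ccontr)
    assume contra: "\<not> (\<exists>B \<subseteq> carrier ?R. finite B \<and> J = genideal ?R B)"
    have ex: "\<exists>p. p \<in> J - genideal ?R B \<and> (\<forall>q \<in> J - genideal ?R B. lead_exponent p \<le> lead_exponent q)"
      if B: "finite B" "B \<subseteq> J" for B
    proof -
      have "genideal ?R B \<subseteq> J"
        by (rule genideal_minimal[OF J B(2)])
      moreover have "genideal ?R B \<noteq> J"
        using contra B(1) by auto
      ultimately obtain p0 where "p0 \<in> J - genideal ?R B"
        by blast
      then have "lead_exponent p0 \<in> lead_exponent ` (J - genideal ?R B)"
        by blast
      from wfE_min[OF wf_exponents this] obtain t where
        t: "t \<in> lead_exponent ` (J - genideal ?R B)"
        "\<And>s. (s, t) \<in> {(s, t). s < t} \<Longrightarrow> s \<notin> lead_exponent ` (J - genideal ?R B)"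
        by metis
      then obtain p where p: "p \<in> J - genideal ?R B" "t = lead_exponent p"
        by blast
      have "lead_exponent p \<le> lead_exponent q" if "q \<in> J - genideal ?R B" for q
        using t(2)[of "lead_exponent q"] that unfolding p(2) by (simp add: not_less [symmetric]) blast
      with p(1) show ?thesis
        by blast
    qed
    define pick where "pick B = (SOME p. p \<in> J - genideal ?R B \<and>
      (\<forall>q \<in> J - genideal ?R B. lead_exponent p \<le> lead_exponent q))" for B
    have pick: "pick B \<in> J - genideal ?R B"
      "\<And>q. q \<in> J - genideal ?R B \<Longrightarrow> lead_exponent (pick B) \<le> lead_exponent q"
      if "finite B" "B \<subseteq> J" for B
      using someI_ex[OF ex[OF that]] unfolding pick_def by blast+
    define B where "B = rec_nat {} (\<lambda>_ B. insert (pick B) B)"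
    have B_Suc: "B (Suc n) = insert (pick (B n)) (B n)" for n
      by (simp add: B_def)
    have B: "finite (B n) \<and> B n \<subseteq> J" for n
      by (induction n) (use pick in \<open>auto simp: B_Suc\<close>, simp_all add: B_def)
    have mem: "pick (B i) \<in> B j" if "i < j" for i j
      using that by (induction j) (auto simp: B_Suc less_Suc_eq)
    obtain i j d where ij: "i < j" "lead_exponent (pick (B j)) = lead_exponent (pick (B i)) + d"
      using dickson[of "\<lambda>n. lead_exponent (pick (B n))"] by blast
    define f where "f = pick (B j)"
    define g where "g = pick (B i)"
    let ?G = "genideal ?R (B j)"
    have G: "ideal ?G ?R"
      by (rule genideal_ideal) simp
    have f: "f \<in> J" "f \<notin> ?G" "\<And>q. q \<in> J \<Longrightarrow> q \<notin> ?G \<Longrightarrow> lead_exponent f \<le> lead_exponent q"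
      using pick[of "B j"] B[of j] unfolding f_def by blast+
    have g: "g \<in> J" "g \<in> ?G" "g \<noteq> 0"
    proof -
      show "g \<in> J"
        using pick(1)[of "B i"] B[of i] by (simp add: g_def)
      show "g \<in> ?G"
        using mem[OF ij(1)] genideal_self[of "B j"] by (auto simp: g_def)
      have "ideal (genideal ?R (B i)) ?R"
        by (rule genideal_ideal) simp
      from ideal_0[OF this] show "g \<noteq> 0"
        using pick(1)[of "B i"] B[of i] by (auto simp: g_def)
    qed
    define t where "t = lead_exponent f"
    have t: "t = d + lead_exponent g"
      using ij(2) by (simp add: t_def f_def g_def add.commute)
    define h where "h = single d (lookup f t / lookup g (lead_exponent g)) * g"
    define q where "q = f - h"
    have lg: "lookup g (lead_exponent g) \<noteq> 0"
      using lead_exponent_in_keys[OF g(3)] by (simp add: in_keys_iff)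
    have q: "q \<in> J" "q \<notin> ?G"
    proof -
      show "q \<in> J"
        unfolding q_def h_def by (intro ideal_diff[OF J] f ideal_mult_left[OF J] g)
      have "h \<in> ?G"
        unfolding h_def by (intro ideal_mult_left[OF G] g)
      then show "q \<notin> ?G"
        using ideal_diff_cancel[OF G, of f h] f(2) by (auto simp: q_def)
    qed
    then have "q \<noteq> 0"
      using ideal_0[OF G] by auto
    then have q_lead: "lead_exponent q \<in> keys q"
      by (rule lead_exponent_in_keys)
    have "lookup q t = 0"
      using lg by (simp add: q_def h_def lookup_minus t lookup_single_times)
    with q_lead have "lead_exponent q \<noteq> t"
      by (metis in_keys_iff)
    moreover have "lead_exponent q \<le> t"
    proof -
      have "lead_exponent q \<in> keys f \<union> keys h"
        using q_lead unfolding q_def by (auto simp: in_keys_iff lookup_minus)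
      then show ?thesis
      proof
        assume "lead_exponent q \<in> keys f"
        then show ?thesis
          by (simp add: t_def)
      next
        assume "lead_exponent q \<in> keys h"
        then obtain s where "s \<in> keys g" "lead_exponent q = d + s"
          unfolding h_def by (blast dest: keys_single_times)
        then show ?thesis
          by (simp add: t add_left_mono)
      qed
    qed
    moreover have "t \<le> lead_exponent q"
      unfolding t_def by (rule f(3)[OF q])
    ultimately show False
      by simp
  qed
  then show ?thesis
    by (intro noetherian_ringI) auto
qed

section \<open>Prime ideals over a line have height at most two\<close>

text \<open>A homogeneous linear system with fewer equations (\<open>T\<close>) than unknowns (\<open>E\<close>).\<close>

lemma nontrivial_kernel:
  fixes a :: "'e \<Rightarrow> 't \<Rightarrow> 'k::field"
  assumes "finite T" "finite E" "card T < card E"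
  shows "\<exists>c. (\<exists>e\<in>E. c e \<noteq> 0) \<and> (\<forall>t\<in>T. (\<Sum>e\<in>E. c e * a e t) = 0)"
  using assms
proof (induction T arbitrary: E a rule: finite_induct)
  case empty
  then have "E \<noteq> {}"
    by auto
  then show ?case
    by (intro exI[of _ "\<lambda>_. 1"]) auto
next
  case (insert t T)
  show ?case
  proof (cases "\<forall>e\<in>E. a e t = 0")
    case True
    have "card T < card E"
      using insert by simp
    from insert.IH[OF insert.prems(1) this, of a] True show ?thesis
      by auto
  next
    case False
    then obtain e0 where e0: "e0 \<in> E" "a e0 t \<noteq> 0"
      by blast
    define E' where "E' = E - {e0}"
    have E: "E = insert e0 E'" "e0 \<notin> E'" "finite E'"
      using e0 insert.prems by (auto simp: E'_def)
    have "card T < card E'"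
      using insert E by simp
    from insert.IH[OF E(3) this, of "\<lambda>e s. a e s - a e t / a e0 t * a e0 s"] obtain c where
      c: "\<exists>e\<in>E'. c e \<noteq> 0" "\<And>s. s \<in> T \<Longrightarrow> (\<Sum>e\<in>E'. c e * (a e s - a e t / a e0 t * a e0 s)) = 0"
      by blast
    define c' where "c' = c(e0 := - (\<Sum>e\<in>E'. c e * (a e t / a e0 t)))"
    have "(\<Sum>e\<in>E'. c' e * a e s) = (\<Sum>e\<in>E'. c e * a e s)" for s
      using E by (intro sum.cong) (auto simp: c'_def)
    then have "(\<Sum>e\<in>E. c' e * a e s) = (\<Sum>e\<in>E'. c e * (a e s - a e t / a e0 t * a e0 s))" for s
      using E by (simp add: c'_def sum_subtractf right_diff_distrib sum_distrib_right mult.assoc)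
    then have "(\<Sum>e\<in>E. c' e * a e s) = 0" if "s \<in> insert t T" for s
      using that c(2) e0(2) by (cases "s = t") auto
    moreover have "\<exists>e\<in>E. c' e \<noteq> 0"
      using c(1) E by (auto simp: c'_def)
    ultimately show ?thesis
      by blast
  qed
qed

definition degrees_le :: "nat \<Rightarrow> ('k::field) poly4 \<Rightarrow> bool" where
  "degrees_le d p \<longleftrightarrow> (\<forall>t\<in>keys p. \<forall>i. lookup t i \<le> d)"

lemma degrees_le_times: "degrees_le d p \<Longrightarrow> degrees_le e q \<Longrightarrow> degrees_le (d + e) (p * q)"
  unfolding degrees_le_def using keys_mult[of p q] by (fastforce simp: lookup_add intro: add_mono)

lemma degrees_le_power:
  assumes "degrees_le d p"
  shows "degrees_le (n * d) (p ^ n)"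
proof (induction n)
  case (Suc n)
  then show ?case
    using degrees_le_times[OF assms Suc] by simp
qed (simp add: degrees_le_def)

lemma degrees_le_mono: "degrees_le d p \<Longrightarrow> d \<le> e \<Longrightarrow> degrees_le e p"
  unfolding degrees_le_def using le_trans by blast

lemma ex_degrees_le: "\<exists>d. degrees_le d p"
proof -
  have "lookup t i \<le> (\<Sum>t\<in>keys p. \<Sum>i\<in>UNIV. lookup t i)" if "t \<in> keys p" for t i
  proof -
    have "lookup t i \<le> (\<Sum>i\<in>UNIV. lookup t i)"
      by (rule member_le_sum) auto
    also have "\<dots> \<le> (\<Sum>t\<in>keys p. \<Sum>i\<in>UNIV. lookup t i)"
      using that by (intro member_le_sum[of t _ "\<lambda>t. \<Sum>i\<in>UNIV. lookup t i"]) auto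
    finally show ?thesis .
  qed
  then show ?thesis
    unfolding degrees_le_def by blast
qed

lemma split_four:
  fixes p q :: 4
  assumes "p \<noteq> q"
  obtains r s where "UNIV = {p, q, r, s}" "r \<noteq> s" "r \<noteq> p" "r \<noteq> q" "s \<noteq> p" "s \<noteq> q"
proof -
  obtain r where r: "r \<noteq> p" "r \<noteq> q"
    by (rule ex_third_index)
  obtain s where s: "s \<noteq> p" "s \<noteq> q" "s \<noteq> r"
    by (rule ex_fourth_index)
  have "card {p, q, r, s} = card (UNIV :: 4 set)"
    using assms r s by auto
  then have "UNIV = {p, q, r, s}"
    by (intro sym[OF card_subset_eq]) auto
  with r s that show thesis
    by metis
qed

text \<open>
  Restricted to the plane \<open>x\<^sub>p = x\<^sub>q = 0\<close>, three polynomials are algebraically dependent: the products of their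
  powers with exponents less than \<open>N\<close> are \<open>N\<^sup>3\<close> in number, but involve only \<open>O(N\<^sup>2)\<close> monomials.
\<close>

lemma algebraic_relation:
  fixes y0 y1 y2 :: "('k::field) poly4" and p q :: 4
  assumes pq: "p \<noteq> q"
  obtains N c where "\<exists>i<N. \<exists>j<N. \<exists>k<N. c i j k \<noteq> 0"
    "(\<Sum>i<N. (\<Sum>j<N. (\<Sum>k<N. single 0 (c i j k) * y2 ^ k) * y1 ^ j) * y0 ^ i) \<in> weight_ideal {p, q} 1"
proof -
  obtain r s where rs: "UNIV = {p, q, r, s}" "r \<noteq> s" "r \<noteq> p" "r \<noteq> q" "s \<noteq> p" "s \<noteq> q"
    by (rule split_four[OF pq])
  obtain d0 d1 d2 where "degrees_le d0 y0" "degrees_le d1 y1" "degrees_le d2 y2"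
    using ex_degrees_le by metis
  then obtain d where d: "degrees_le d y0" "degrees_le d y1" "degrees_le d y2"
    using degrees_le_mono[of _ _ "d0 + d1 + d2"] by (metis le_add1 le_add2 trans_le_add1)
  \<comment> \<open>The exponents that occur are at most \<open>3 d N\<close>, and \<open>(3 d N + 1)\<^sup>2 \<le> (3 d + 1)\<^sup>2 N\<^sup>2 < N\<^sup>3\<close>.\<close>
  define N where "N = Suc ((3 * d + 1)\<^sup>2)"
  define D where "D = 3 * d * N"
  define E where "E = {..<N} \<times> {..<N} \<times> {..<N}"
  define T where "T = (\<lambda>(a, b). single r a + single s b) ` ({..D} \<times> {..D})"
  define a where "a = (\<lambda>(i, j, k) t. lookup (y2 ^ k * y1 ^ j * y0 ^ i) t)"
  have "card T \<le> card ({..D} \<times> {..D})"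
    unfolding T_def by (intro card_image_le) auto
  also have "\<dots> = (D + 1)\<^sup>2"
    by (simp add: power2_eq_square)
  also have "\<dots> \<le> ((3 * d + 1) * N)\<^sup>2"
    by (intro power_mono) (simp_all add: D_def N_def)
  also have "\<dots> = (3 * d + 1)\<^sup>2 * N\<^sup>2"
    by (rule power_mult_distrib)
  also have "\<dots> < N * N\<^sup>2"
    by (intro mult_strict_right_mono) (simp_all add: N_def)
  also have "\<dots> = card E"
    by (simp add: E_def card_cartesian_product power2_eq_square)
  finally have "card T < card E" .
  moreover have "finite T" "finite E"
    by (simp_all add: T_def E_def)
  ultimately obtain f where f: "\<exists>e\<in>E. f e \<noteq> 0" "\<And>t. t \<in> T \<Longrightarrow> (\<Sum>e\<in>E. f e * a e t) = 0"
    using nontrivial_kernel[of T E a] by blast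
  define c where "c i j k = f (i, j, k)" for i j k
  let ?F = "\<Sum>i<N. (\<Sum>j<N. (\<Sum>k<N. single 0 (c i j k) * y2 ^ k) * y1 ^ j) * y0 ^ i"
  have lookup_F: "lookup ?F t = (\<Sum>e\<in>E. f e * a e t)" for t
  proof -
    have "lookup (single 0 (c i j k) * y2 ^ k * y1 ^ j * y0 ^ i) t = f (i, j, k) * a (i, j, k) t" for i j k
      using lookup_single_times[of 0 "c i j k" "y2 ^ k * y1 ^ j * y0 ^ i" t]
      by (simp add: c_def a_def mult.assoc)
    then have "lookup ?F t = (\<Sum>i<N. \<Sum>j<N. \<Sum>k<N. f (i, j, k) * a (i, j, k) t)"
      by (simp add: sum_distrib_right lookup_sum)
    also have "\<dots> = (\<Sum>e\<in>E. f e * a e t)"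
      by (simp add: E_def sum.cartesian_product split_def)
    finally show ?thesis .
  qed
  have "?F \<in> weight_ideal {p, q} 1"
    unfolding weight_ideal_def
  proof (intro CollectI ballI, rule ccontr)
    fix t assume t: "t \<in> keys ?F" "\<not> 1 \<le> weight {p, q} t"
    then have 0: "lookup t p = 0" "lookup t q = 0"
      using pq by (auto simp: weight_pair)
    have "(\<Sum>e\<in>E. f e * a e t) \<noteq> 0"
      using t(1) lookup_F by (simp add: in_keys_iff)
    then obtain e where "e \<in> E" "f e * a e t \<noteq> 0"
      by (rule sum.not_neutral_contains_not_neutral)
    then have e: "e \<in> E" "a e t \<noteq> 0"
      by auto
    then obtain i j k where ijk: "e = (i, j, k)" "i < N" "j < N" "k < N"
      by (auto simp: E_def)
    have "degrees_le (k * d + j * d + i * d) (y2 ^ k * y1 ^ j * y0 ^ i)"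
      by (intro degrees_le_times degrees_le_power d)
    moreover have "k * d + j * d + i * d \<le> D"
    proof -
      have "k * d + j * d + i * d \<le> N * d + N * d + N * d"
        using ijk by (intro add_mono mult_right_mono) auto
      then show ?thesis
        by (simp add: D_def algebra_simps)
    qed
    ultimately have "degrees_le D (y2 ^ k * y1 ^ j * y0 ^ i)"
      by (rule degrees_le_mono)
    moreover have "t \<in> keys (y2 ^ k * y1 ^ j * y0 ^ i)"
      using e(2) unfolding ijk(1) a_def by (simp add: in_keys_iff)
    ultimately have "lookup t l \<le> D" for l
      unfolding degrees_le_def by blast
    moreover have "t = single r (lookup t r) + single s (lookup t s)"
    proof (rule poly_mapping_eqI)
      fix l
      have "l = p \<or> l = q \<or> l = r \<or> l = s"
        using rs(1) by blast
      then show "lookup t l = lookup (single r (lookup t r) + single s (lookup t s)) l"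
        using 0 rs(2-) by (elim disjE) (simp_all add: lookup_add lookup_single)
    qed
    ultimately have "t \<in> T"
      unfolding T_def by (intro image_eqI[of _ _ "(lookup t r, lookup t s)"]) auto
    then show False
      using f(2) \<open>(\<Sum>e\<in>E. f e * a e t) \<noteq> 0\<close> by blast
  qed
  moreover have "\<exists>i<N. \<exists>j<N. \<exists>k<N. c i j k \<noteq> 0"
    using f(1) by (auto simp: E_def c_def)
  ultimately show thesis
    by (intro that[of N c])
qed

lemma prime_power_notin:
  assumes "primeideal Q (ring_of_type_algebra :: 'a::comm_ring_1 ring)" "y \<notin> Q"
  shows "y ^ n \<notin> Q"
proof -
  interpret primeideal Q "ring_of_type_algebra :: 'a ring" by (rule assms(1))
  have "1 \<notin> Q"
    using one_imp_carrier I_notcarr by auto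
  then show ?thesis
    using I_prime assms(2) by (induction n) auto
qed

text \<open>
  Division by the lowest power of \<open>y\<close> in a relation, followed by reduction modulo \<open>y\<close>.
\<close>

lemma lowest_coefficient_in_next_prime:
  fixes y :: "'a::comm_ring_1"
  assumes Q: "primeideal Q (ring_of_type_algebra :: 'a ring)" and Q': "ideal Q' (ring_of_type_algebra :: 'a ring)"
    and sub: "Q \<subseteq> Q'" and y: "y \<in> Q'" "y \<notin> Q"
    and rel: "(\<Sum>k<N. g k * y ^ k) \<in> Q" and k0: "k0 < N" "\<And>k. k < k0 \<Longrightarrow> g k = 0"
  shows "g k0 \<in> Q'"
proof -
  interpret primeideal Q "ring_of_type_algebra :: 'a ring" by (rule Q)
  define h where "h = (\<Sum>k = Suc k0..<N. g k * y ^ (k - Suc k0))"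
  have "(\<Sum>k<N. g k * y ^ k) = (\<Sum>k<k0. g k * y ^ k) + (\<Sum>k = k0..<N. g k * y ^ k)"
    unfolding lessThan_atLeast0 using k0(1) by (intro sum.atLeastLessThan_concat [symmetric]) auto
  also have "(\<Sum>k<k0. g k * y ^ k) = 0"
    using k0(2) by simp
  also have "(\<Sum>k = k0..<N. g k * y ^ k) = g k0 * y ^ k0 + (\<Sum>k = Suc k0..<N. g k * y ^ k)"
    using k0(1) by (rule sum.atLeast_Suc_lessThan)
  also have "(\<Sum>k = Suc k0..<N. g k * y ^ k) = y ^ Suc k0 * h"
    unfolding h_def sum_distrib_left
  proof (rule sum.cong[OF refl])
    fix k assume "k \<in> {Suc k0..<N}"
    then have "y ^ k = y ^ (Suc k0 + (k - Suc k0))"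
      by simp
    then show "g k * y ^ k = y ^ Suc k0 * (g k * y ^ (k - Suc k0))"
      by (simp only: power_add mult_ac)
  qed
  finally have "(\<Sum>k<N. g k * y ^ k) = y ^ k0 * (g k0 + y * h)"
    by (simp add: algebra_simps)
  with rel have "y ^ k0 * (g k0 + y * h) \<in> Q"
    by simp
  then have "g k0 + y * h \<in> Q"
    using I_prime[of "y ^ k0" "g k0 + y * h"] prime_power_notin[OF Q y(2), of k0] by auto
  then have "g k0 + y * h \<in> Q'"
    using sub by blast
  then show ?thesis
    using ideal_diff[OF Q', of "g k0 + y * h" "y * h"] ideal_mult_right[OF Q' y(1)] by simp
qed

text \<open>
  Choose \<open>y0\<close>, \<open>y1\<close>, \<open>y2\<close> in successive differences of the chain. In an algebraic relation between them, passing to the lowest coefficient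
  with respect to each of them in turn leads up the chain, from the relation in \<open>Q 0\<close> to a non-zero constant in \<open>Q 3\<close>.
\<close>

lemma no_prime_chain_of_length_three:
  fixes Q :: "nat \<Rightarrow> ('k::field) poly4 set"
  assumes Q: "\<And>i. i \<le> 3 \<Longrightarrow> primeideal (Q i) poly_ring"
    and sub: "Q 0 \<subset> Q 1" "Q 1 \<subset> Q 2" "Q 2 \<subset> Q 3"
    and line: "weight_ideal {p, q} 1 \<subseteq> Q 0" "p \<noteq> q"
  shows False
proof -
  obtain y0 y1 y2 where y: "y0 \<in> Q 1" "y0 \<notin> Q 0" "y1 \<in> Q 2" "y1 \<notin> Q 1" "y2 \<in> Q 3" "y2 \<notin> Q 2"
    using sub by blast
  have ideals: "ideal (Q i) poly_ring" if "i \<le> 3" for i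
    using Q[OF that] by (rule primeideal.axioms)
  obtain N and c :: "nat \<Rightarrow> nat \<Rightarrow> nat \<Rightarrow> 'k" where nz: "\<exists>i<N. \<exists>j<N. \<exists>k<N. c i j k \<noteq> 0"
    and rel: "(\<Sum>i<N. (\<Sum>j<N. (\<Sum>k<N. single 0 (c i j k) * y2 ^ k) * y1 ^ j) * y0 ^ i) \<in> weight_ideal {p, q} 1"
    by (rule algebraic_relation[OF line(2), where ?y0.0 = y0 and ?y1.0 = y1 and ?y2.0 = y2])
  define i0 where "i0 = (LEAST i. i < N \<and> (\<exists>j<N. \<exists>k<N. c i j k \<noteq> 0))"
  have i0: "i0 < N" "\<exists>j<N. \<exists>k<N. c i0 j k \<noteq> 0"
    using LeastI_ex[OF nz] unfolding i0_def by auto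
  have i0_less: "c i j k = 0" if "i < i0" "j < N" "k < N" for i j k
    using not_less_Least[OF that(1)[unfolded i0_def]] that i0(1) by auto
  define j0 where "j0 = (LEAST j. j < N \<and> (\<exists>k<N. c i0 j k \<noteq> 0))"
  have j0: "j0 < N" "\<exists>k<N. c i0 j0 k \<noteq> 0"
    using LeastI_ex[OF i0(2)] unfolding j0_def by auto
  have j0_less: "c i0 j k = 0" if "j < j0" "k < N" for j k
    using not_less_Least[OF that(1)[unfolded j0_def]] that j0(1) by auto
  define k0 where "k0 = (LEAST k. k < N \<and> c i0 j0 k \<noteq> 0)"
  have k0: "k0 < N" "c i0 j0 k0 \<noteq> 0"
    using LeastI_ex[OF j0(2)] unfolding k0_def by auto
  have k0_less: "c i0 j0 k = 0" if "k < k0" for k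
    using not_less_Least[OF that(1)[unfolded k0_def]] that k0(1) by auto
  have "(\<Sum>j<N. (\<Sum>k<N. single 0 (c i0 j k) * y2 ^ k) * y1 ^ j) \<in> Q 1"
    using Q[of 0] ideals[of 1] sub y rel line i0 i0_less
    by (intro lowest_coefficient_in_next_prime[where Q = "Q 0" and y = y0 and N = N
          and g = "\<lambda>i. (\<Sum>j<N. (\<Sum>k<N. single 0 (c i j k) * y2 ^ k) * y1 ^ j)"]) auto
  then have "(\<Sum>k<N. single 0 (c i0 j0 k) * y2 ^ k) \<in> Q 2"
    using Q[of 1] ideals[of 2] sub y j0 j0_less
    by (intro lowest_coefficient_in_next_prime[where Q = "Q 1" and y = y1 and N = N
          and g = "\<lambda>j. (\<Sum>k<N. single 0 (c i0 j k) * y2 ^ k)"]) auto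
  then have "single 0 (c i0 j0 k0) \<in> Q 3"
    using Q[of 2] ideals[of 3] sub y k0 k0_less
    by (intro lowest_coefficient_in_next_prime[where Q = "Q 2" and y = y2 and N = N
          and g = "\<lambda>k. single 0 (c i0 j0 k)"]) auto
  then have "single 0 (inverse (c i0 j0 k0)) * single 0 (c i0 j0 k0) \<in> Q 3"
    by (intro ideal_mult_left[OF ideals]) auto
  then have "1 \<in> Q 3"
    using k0(2) by (simp add: mult_single)
  then show False
    using prime_power_notin[OF Q[of 3], of 1 0] ideals[of 3] Q[of 3]
      ideal.one_imp_carrier[of "Q 3" "poly_ring :: 'k poly4 ring"] primeideal.I_notcarr[OF Q[of 3]] by auto
qed

section \<open>Substitution homomorphisms\<close>

locale substitution =
  fixes c :: "'k::field \<Rightarrow> 'b::comm_ring_1" and s :: "4 \<Rightarrow> 'b"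
  assumes c_0: "c 0 = 0" and c_1: "c 1 = 1" and c_add: "c (a + b) = c a + c b"
    and c_mult: "c (a * b) = c a * c b"
begin

definition monomial_value :: "(4 \<Rightarrow>\<^sub>0 nat) \<Rightarrow> 'b" where
  "monomial_value t = (\<Prod>i\<in>UNIV. s i ^ lookup t i)"

definition insertion :: "'k poly4 \<Rightarrow> 'b" where
  "insertion p = (\<Sum>t\<in>keys p. c (lookup p t) * monomial_value t)"

lemma monomial_value_add: "monomial_value (t + u) = monomial_value t * monomial_value u"
  by (simp add: monomial_value_def lookup_add power_add prod.distrib)

lemma monomial_value_0: "monomial_value 0 = 1"
  by (simp add: monomial_value_def)

lemma insertion_superset:
  assumes "finite T" "keys p \<subseteq> T"
  shows "insertion p = (\<Sum>t\<in>T. c (lookup p t) * monomial_value t)"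
  unfolding insertion_def using assms by (intro sum.mono_neutral_left) (auto simp: in_keys_iff c_0)

lemma insertion_0: "insertion 0 = 0"
  by (simp add: insertion_def)

lemma insertion_single: "insertion (single t a) = c a * monomial_value t"
  by (subst insertion_superset[of "{t}"]) (auto split: if_splits)

lemma insertion_add: "insertion (p + q) = insertion p + insertion q"
proof -
  let ?T = "keys p \<union> keys q"
  have "insertion (p + q) = (\<Sum>t\<in>?T. c (lookup (p + q) t) * monomial_value t)"
    by (intro insertion_superset keys_add) simp
  also have "\<dots> = insertion p + insertion q"
    by (subst (1 2) insertion_superset[of ?T]) (simp_all add: lookup_add c_add distrib_right sum.distrib)
  finally show ?thesis .
qed

lemma insertion_mult: "insertion (p * q) = insertion p * insertion q"
proof -
  have single: "insertion (single t a * q) = insertion (single t a) * insertion q" for t a q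
  proof (induction q rule: poly_mapping_single_induct)
    case (single_add u b q)
    then show ?case
      by (simp add: distrib_left mult_single insertion_add insertion_single monomial_value_add c_mult mult_ac)
  qed (simp add: insertion_0)
  show ?thesis
  proof (induction p rule: poly_mapping_single_induct)
    case (single_add t a p)
    then show ?case
      by (simp add: distrib_right insertion_add single)
  qed (simp add: insertion_0)
qed

lemma insertion_1: "insertion 1 = 1"
  using insertion_single[of 0 1] by (simp add: monomial_value_0 c_1)

lemma insertion_diff: "insertion (p - q) = insertion p - insertion q"
  using insertion_add[of "p - q" q] by (simp add: algebra_simps)

lemma insertion_sum: "insertion (sum f B) = (\<Sum>x\<in>B. insertion (f x))"
  by (induction B rule: infinite_finite_induct) (simp_all add: insertion_0 insertion_add)

lemma monomial_value_single: "monomial_value (single i n) = s i ^ n"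
proof -
  have "monomial_value (single i n) = (\<Prod>j\<in>UNIV. if j = i then s i ^ n else 1)"
    unfolding monomial_value_def by (rule prod.cong) (auto simp: lookup_single)
  then show ?thesis
    by simp
qed

lemma insertion_indet: "insertion (indet i) = s i"
  by (simp add: indet_def insertion_single monomial_value_single c_1)

end

section \<open>Maximal ideals over a line contain univariate polynomials\<close>

text \<open>
  Zariski's lemma for a field \<open>L\<close> generated over \<open>K\<close> by two elements \<open>u\<close>, \<open>v\<close>: here \<open>v\<close> is algebraic over \<open>K\<close>.
  Otherwise let \<open>p\<close> be a relation of least degree in \<open>u\<close>, with leading coefficient \<open>a \<in> K[v]\<close>. Up to a power of \<open>a\<close>,
  the inverse of \<open>b = 1 + v a\<close> in \<open>L\<close> can be reduced modulo \<open>p\<close>, and comparing coefficients shows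
  that \<open>b\<close> divides this power. But \<open>b\<close> is coprime to \<open>a\<close> and not constant.
\<close>

lemma univariate_in_maximal_ideal:
  fixes P :: "'k::field poly poly set"
  assumes P: "ideal P ring_of_type_algebra" and one: "1 \<notin> P"
    and inv: "\<And>b. b \<notin> P \<Longrightarrow> \<exists>w. b * w - 1 \<in> P"
  shows "\<exists>g. g \<noteq> 0 \<and> [:g:] \<in> P"
proof (rule ccontr)
  assume "\<nexists>g. g \<noteq> 0 \<and> [:g:] \<in> P"
  then have no: "[:g:] \<in> P \<Longrightarrow> g = 0" for g
    by blast
  have "\<exists>p. p \<in> P \<and> p \<noteq> 0"
  proof (cases "[:0, 1:] \<in> P")
    case True
    then show ?thesis
      by (intro exI[of _ "[:0, 1:]"]) simp
  next
    case False
    then obtain w where w: "[:0, 1:] * w - 1 \<in> P"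
      using inv by blast
    have "coeff ([:0, 1:] * w - 1) 0 \<noteq> 0"
      by simp
    then have "[:0, 1:] * w - 1 \<noteq> 0"
      by (metis coeff_0)
    with w show ?thesis
      by blast
  qed
  then obtain p where p: "p \<in> P" "p \<noteq> 0"
    and min: "\<And>q. q \<in> P \<Longrightarrow> q \<noteq> 0 \<Longrightarrow> Polynomial.degree p \<le> Polynomial.degree q"
    using ex_has_least_nat[of "\<lambda>p. p \<in> P \<and> p \<noteq> 0" _ Polynomial.degree] by metis
  have deg: "Polynomial.degree p > 0"
  proof (rule ccontr)
    assume "\<not> 0 < Polynomial.degree p"
    then obtain g where "p = [:g:]"
      using degree_eq_zeroE by auto
    with no[of g] p show False
      by simp
  qed
  define a where "a = Polynomial.lead_coeff p"
  define b where "b = 1 + [:0, 1:] * a"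
  have a: "a \<noteq> 0"
    using p by (simp add: a_def)
  then have "Polynomial.degree ([:0, 1:] * a) = Suc (Polynomial.degree a)"
    by (subst degree_mult_eq) auto
  then have deg_b: "Polynomial.degree b = Suc (Polynomial.degree a)"
    unfolding b_def by (subst degree_add_eq_right) auto
  then have "b \<noteq> 0"
    by auto
  then obtain w where w: "[:b:] * w - 1 \<in> P"
    using inv[of "[:b:]"] no by blast
  obtain q r where qr: "pseudo_divmod w p = (q, r)"
    by fastforce
  define m where "m = Suc (Polynomial.degree w) - Polynomial.degree p"
  have div: "smult (a ^ m) w = p * q + r" "r = 0 \<or> Polynomial.degree r < Polynomial.degree p"
    using pseudo_divmod[OF p(2) qr] by (simp_all add: a_def m_def)
  have "[:a ^ m:] * ([:b:] * w - 1) - p * ([:b:] * q) \<in> P"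
    by (intro ideal_diff[OF P] ideal_mult_left[OF P w] ideal_mult_right[OF P p(1)])
  also have "[:a ^ m:] * ([:b:] * w - 1) - p * ([:b:] * q) = [:b:] * smult (a ^ m) w - [:a ^ m:] - p * ([:b:] * q)"
    by (simp add: algebra_simps smult_diff_right one_pCons)
  also have "\<dots> = smult b r - [:a ^ m:]"
    unfolding div(1) by (simp add: algebra_simps)
  finally have "smult b r - [:a ^ m:] \<in> P" .
  moreover have "Polynomial.degree (smult b r - [:a ^ m:]) < Polynomial.degree p"
    using div(2) deg by (intro degree_diff_less) auto
  ultimately have "smult b r - [:a ^ m:] = 0"
    using min by (meson not_le)
  then have "coeff (smult b r - [:a ^ m:]) 0 = 0"
    by (simp only: coeff_0)
  then have "b dvd a ^ m"
    by (metis coeff_diff coeff_pCons_0 coeff_smult dvd_triv_left eq_iff_diff_eq_0)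
  then have "b dvd 1"
  proof (induction m)
    case (Suc m)
    have "a ^ m = b * a ^ m - [:0, 1:] * a ^ Suc m"
      by (simp add: b_def algebra_simps)
    also have "b dvd \<dots>"
      by (rule dvd_diff[OF dvd_triv_left dvd_mult[OF Suc.prems]])
    finally show ?case
      by (rule Suc.IH)
  qed simp
  then show False
    using deg_b by (simp add: is_unit_iff_degree[OF \<open>b \<noteq> 0\<close>])
qed

definition univariate :: "4 \<Rightarrow> 'k::field poly \<Rightarrow> 'k poly4" where
  "univariate l g = (\<Sum>n\<le>Polynomial.degree g. single (single l n) (coeff g n))"

lemma lookup_univariate: "lookup (univariate l g) (single l n) = coeff g n"
proof -
  have "lookup (univariate l g) (single l n) = (\<Sum>m\<le>Polynomial.degree g. if m = n then coeff g m else 0)"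
    unfolding univariate_def lookup_sum
  proof (rule sum.cong[OF refl])
    fix m
    have "single l m = single l n \<longleftrightarrow> m = n"
      by (metis lookup_single_eq)
    then show "lookup (single (single l m) (coeff g m)) (single l n) = (if m = n then coeff g m else 0)"
      by (simp add: lookup_single when_def)
  qed
  then show ?thesis
    by (auto simp: coeff_eq_0)
qed

lemma keys_univariate: "t \<in> keys (univariate l g) \<Longrightarrow> \<exists>n. t = single l n"
  unfolding univariate_def using keys_sum by (fastforce split: if_splits)

locale maximal_poly_ideal =
  fixes P :: "('k::field) poly4 set"
  assumes ideal_P: "ideal P poly_ring" and one_notin: "1 \<notin> P"
    and inverse_mod: "\<And>b. b \<notin> P \<Longrightarrow> \<exists>w. b * w - 1 \<in> P"
begin

lemma prime: "a * b \<in> P \<Longrightarrow> a \<in> P \<or> b \<in> P"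
proof (rule ccontr)
  assume ab: "a * b \<in> P" and "\<not> (a \<in> P \<or> b \<in> P)"
  then obtain w where w: "a * w - 1 \<in> P"
    using inverse_mod by blast
  have "w * (a * b) - b * (a * w - 1) \<in> P"
    by (intro ideal_diff[OF ideal_P] ideal_mult_left[OF ideal_P] ab w)
  then have "b \<in> P"
    by (simp add: algebra_simps)
  with \<open>\<not> (a \<in> P \<or> b \<in> P)\<close> show False
    by blast
qed

text \<open>
  Modulo \<open>(x\<^sub>p, x\<^sub>q)\<close>, the polynomial ring becomes \<open>K[x\<^sub>l][x\<^sub>r]\<close>, and Zariski's lemma applies to the image of \<open>P\<close>. A
  polynomial of least degree has no factor \<open>x\<^sub>l\<close>, if \<open>x\<^sub>l\<close> is not in \<open>P\<close>.
\<close>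

lemma univariate_mem_over_line:
  assumes line: "weight_ideal {p, q} 1 \<subseteq> P" "p \<noteq> q" and l: "l \<noteq> p" "l \<noteq> q"
  obtains g where "g \<noteq> 0" "univariate l g \<in> P" "indet l \<notin> P \<Longrightarrow> coeff g 0 \<noteq> 0"
proof -
  obtain r where r: "r \<noteq> p" "r \<noteq> q" "r \<noteq> l"
    by (rule ex_fourth_index)
  have univ: "i = p \<or> i = q \<or> i = r \<or> i = l" for i
  proof -
    have "card {p, q, r, l} = card (UNIV :: 4 set)"
      using line(2) l r by auto
    then have "{p, q, r, l} = UNIV"
      by (intro card_subset_eq) auto
    then show ?thesis
      by blast
  qed
  have on_plane: "t = single r (lookup t r) + single l (lookup t l)"
    if "lookup t p = 0" "lookup t q = 0" for t :: "4 \<Rightarrow>\<^sub>0 nat"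
  proof (rule poly_mapping_eqI)
    fix i
    show "lookup t i = lookup (single r (lookup t r) + single l (lookup t l)) i"
      using univ[of i] that l r by (elim disjE) (simp_all add: lookup_add lookup_single when_def)
  qed
  define s :: "4 \<Rightarrow> 'k poly poly" where
    "s i = (if i = r then [:0, 1:] else if i = l then [:[:0, 1:]:] else 0)" for i
  interpret substitution "\<lambda>a. [:[:a:]:]" s
    by unfold_locales (simp_all add: one_pCons)
  have const_pow: "[:x:] ^ n = [:x ^ n:]" for x :: "'k poly" and n
    by (induction n) (simp_all add: one_pCons)
  have monom: "[:[:x:]:] * [:[:0, 1:]:] ^ n = [:monom x n:]" for x :: 'k and n
    by (simp add: const_pow monom_altdef)
  have sum_const: "(\<Sum>n\<in>B. [:f n:]) = [:\<Sum>n\<in>B. f n:]" for f :: "nat \<Rightarrow> 'k poly" and B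
    by (induction B rule: infinite_finite_induct) auto
  have insertion_univariate: "insertion (univariate l g) = [:g:]" for g
  proof -
    have "insertion (univariate l g) = (\<Sum>n\<le>Polynomial.degree g. [:monom (coeff g n) n:])"
      unfolding univariate_def insertion_sum
    proof (rule sum.cong[OF refl])
      fix n
      have "insertion (single (single l n) (coeff g n)) = [:[:coeff g n:]:] * [:[:0, 1:]:] ^ n"
        using r(3) [symmetric] by (simp only: insertion_single monomial_value_single s_def if_True if_False refl)
      then show "insertion (single (single l n) (coeff g n)) = [:monom (coeff g n) n:]"
        by (simp only: monom)
    qed
    also have "\<dots> = [:\<Sum>n\<le>Polynomial.degree g. monom (coeff g n) n:]"
      by (rule sum_const)
    finally show ?thesis
      by (simp add: poly_as_sum_of_monoms)
  qed
  have surj: "\<exists>p. insertion p = f" for f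
  proof (induction f)
    case 0
    show ?case
      by (intro exI[of _ 0]) (rule insertion_0)
  next
    case (pCons a f)
    then obtain p where p: "insertion p = f"
      by blast
    have "insertion (univariate l a + indet r * p) = pCons a f"
      by (simp add: insertion_add insertion_univariate insertion_mult insertion_indet p s_def)
    then show ?case
      by blast
  qed
  have coeff_insertion: "coeff (coeff (insertion f) i) j = lookup f (single r i + single l j)" for f i j
  proof (induction f rule: poly_mapping_single_induct)
    case zero
    show ?case
      by (simp add: insertion_0)
  next
    case (single_add t a f)
    have "coeff (coeff (insertion (single t a)) i) j = lookup (single t a) (single r i + single l j)"
    proof -
      have UNIV_eq: "UNIV = {p, q, r, l}"
        using univ by auto
      have mv: "monomial_value t = s p ^ lookup t p * (s q ^ lookup t q * (s r ^ lookup t r * s l ^ lookup t l))"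
        unfolding monomial_value_def UNIV_eq using line(2) l r by simp
      show ?thesis
      proof (cases "lookup t p = 0 \<and> lookup t q = 0")
        case True
        have "insertion (single t a) = [:0, 1:] ^ lookup t r * [:monom a (lookup t l):]"
          unfolding insertion_single mv using True r by (simp add: s_def monom [symmetric] mult_ac)
        also have "\<dots> = monom (monom a (lookup t l)) (lookup t r)"
          by (simp add: monom_altdef mult.commute)
        finally have "coeff (coeff (insertion (single t a)) i) j = (if lookup t r = i \<and> lookup t l = j then a else 0)"
          by simp
        moreover have "t = single r i + single l j \<longleftrightarrow> lookup t r = i \<and> lookup t l = j"
        proof
          assume "lookup t r = i \<and> lookup t l = j"
          then show "t = single r i + single l j"
            using True on_plane[of t] by metis
        qed (use r in \<open>simp add: lookup_add lookup_single\<close>)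
        ultimately show ?thesis
          by (simp add: lookup_single when_def)
      next
        case False
        have "s p = 0" "s q = 0"
          using l r by (auto simp: s_def)
        with False have "insertion (single t a) = 0"
          unfolding insertion_single mv by (auto simp: power_0_left)
        moreover have "t \<noteq> single r i + single l j"
          using False l r by (auto simp: lookup_add lookup_single)
        ultimately show ?thesis
          by (simp add: lookup_single when_def)
      qed
    qed
    with single_add show ?case
      by (simp add: insertion_add lookup_add)
  qed
  have kernel: "f \<in> P" if "insertion f = 0" for f
  proof -
    have "f \<in> weight_ideal {p, q} 1"
      unfolding weight_ideal_def
    proof (intro CollectI ballI, rule ccontr)
      fix t assume t: "t \<in> keys f" "\<not> 1 \<le> weight {p, q} t"
      then have "lookup t p = 0" "lookup t q = 0"
        using line(2) by (auto simp: weight_pair)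
      then have "t = single r (lookup t r) + single l (lookup t l)"
        by (rule on_plane)
      with t(1) coeff_insertion[of f "lookup t r" "lookup t l"] that show False
        by (simp add: in_keys_iff)
    qed
    with line(1) show ?thesis
      by blast
  qed
  have image_iff: "insertion f \<in> insertion ` P \<longleftrightarrow> f \<in> P" for f
  proof
    assume "insertion f \<in> insertion ` P"
    then obtain h where "h \<in> P" "insertion (f - h) = 0"
      by (auto simp: insertion_diff)
    with kernel show "f \<in> P"
      using ideal_diff_cancel[OF ideal_P] by blast
  qed blast
  have "\<exists>g. g \<noteq> 0 \<and> [:g:] \<in> insertion ` P"
  proof (rule univariate_in_maximal_ideal)
    show "ideal (insertion ` P) ring_of_type_algebra"
      unfolding ideal_type_algebra_iff
    proof (intro conjI ballI allI)
      show "0 \<in> insertion ` P"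
        using ideal_0[OF ideal_P] image_eqI[of 0 insertion 0 P] insertion_0 by simp
      show "x + y \<in> insertion ` P" if "x \<in> insertion ` P" "y \<in> insertion ` P" for x y
        using that ideal_add[OF ideal_P] by (auto simp: insertion_add [symmetric])
      show "f * x \<in> insertion ` P" if "x \<in> insertion ` P" for f x
        using that surj[of f] ideal_mult_left[OF ideal_P] by (auto simp: insertion_mult [symmetric])
    qed
    show "1 \<notin> insertion ` P"
      using image_iff[of 1] one_notin by (simp add: insertion_1)
    fix b assume "b \<notin> insertion ` P"
    moreover obtain f where f: "insertion f = b"
      using surj by blast
    ultimately obtain w where "f * w - 1 \<in> P"
      using inverse_mod by blast
    then have "insertion (f * w - 1) \<in> insertion ` P"
      by blast
    then show "\<exists>w. b * w - 1 \<in> insertion ` P"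
      by (auto simp: insertion_diff insertion_mult insertion_1 f)
  qed
  then obtain g0 where "g0 \<noteq> 0" "[:g0:] \<in> insertion ` P"
    by blast
  then have "\<exists>g. g \<noteq> 0 \<and> univariate l g \<in> P"
    using image_iff[of "univariate l g0"] unfolding insertion_univariate by blast
  then obtain g where g: "g \<noteq> 0" "univariate l g \<in> P"
    and min: "\<And>g'. g' \<noteq> 0 \<Longrightarrow> univariate l g' \<in> P \<Longrightarrow> Polynomial.degree g \<le> Polynomial.degree g'"
    using ex_has_least_nat[of "\<lambda>g. g \<noteq> 0 \<and> univariate l g \<in> P" _ Polynomial.degree] by metis
  have "coeff g 0 \<noteq> 0" if "indet l \<notin> P"
  proof
    assume "coeff g 0 = 0"
    then obtain g' where g': "g = pCons 0 g'"
      by (cases g) auto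
    then have "insertion (univariate l g) = insertion (indet l * univariate l g')"
      using r by (simp add: insertion_mult insertion_univariate insertion_indet s_def)
    then have "indet l * univariate l g' \<in> P"
      using g(2) image_iff[of "univariate l g"] image_iff[of "indet l * univariate l g'"] by simp
    then have "univariate l g' \<in> P"
      using prime that by blast
    then show False
      using min[of g'] g(1) g' by auto
  qed
  with g that show thesis
    by blast
qed

end

section \<open>Regular sequences of length two\<close>

abbreviation ideal_plus :: "('k::field) poly4 set \<Rightarrow> 'k poly4 \<Rightarrow> 'k poly4 set" where
  "ideal_plus I f \<equiv> {p + f * q | p q. p \<in> I}"

definition regular_pair :: "('k::field) poly4 set \<Rightarrow> 'k poly4 \<Rightarrow> 'k poly4 \<Rightarrow> bool" where
  "regular_pair I f g \<longleftrightarrow> (\<forall>p. f * p \<in> I \<longrightarrow> p \<in> I) \<and>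
    (\<forall>p. g * p \<in> ideal_plus I f \<longrightarrow> p \<in> ideal_plus I f)"

subsection \<open>Grading by the degree in one variable\<close>

definition slice :: "4 \<Rightarrow> nat \<Rightarrow> ('k::field) poly4 \<Rightarrow> 'k poly4" where
  "slice l n p = Poly_Mapping.mapp (\<lambda>t c. if lookup t l = n then c else 0) p"

lemma lookup_slice: "lookup (slice l n p) t = (if lookup t l = n then lookup p t else 0)"
  by (simp add: slice_def lookup_mapp when_def in_keys_iff)

lemma slice_add: "slice l n (p + q) = slice l n p + slice l n q"
  by (rule poly_mapping_eqI) (simp add: lookup_slice lookup_add)

lemma slice_sum: "slice l n (sum f B) = (\<Sum>x\<in>B. slice l n (f x))"
  by (rule poly_mapping_eqI) (simp add: lookup_slice lookup_sum)

lemma keys_slice: "keys (slice l n p) \<subseteq> keys p"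
  by (auto simp: in_keys_iff lookup_slice split: if_splits)

lemma slice_single_times:
  assumes "lookup t l = 0"
  shows "slice l n (single t c * p) = single t c * slice l n p"
proof (rule poly_mapping_eqI)
  fix s
  show "lookup (slice l n (single t c * p)) s = lookup (single t c * slice l n p) s"
  proof (cases "\<exists>s'. s = t + s'")
    case True
    then obtain s' where "s = t + s'"
      by blast
    then show ?thesis
      using assms by (simp add: lookup_slice lookup_single_times lookup_add)
  next
    case False
    then show ?thesis
      by (simp add: lookup_slice lookup_single_times_outside)
  qed
qed

lemma slice_times:
  assumes "\<And>t. t \<in> keys f \<Longrightarrow> lookup t l = 0"
  shows "slice l n (f * p) = f * slice l n p"
proof -
  have "f * q = (\<Sum>t\<in>keys f. single t (lookup f t) * q)" for q
    by (subst poly_mapping_sum_single[of f]) (rule sum_distrib_right)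
  then show ?thesis
    by (simp add: slice_sum slice_single_times assms)
qed

lemma sum_slices: "p = (\<Sum>n\<in>(\<lambda>t. lookup t l) ` keys p. slice l n p)"
  by (rule poly_mapping_eqI) (auto simp: lookup_sum lookup_slice in_keys_iff)

text \<open>
  If \<open>J\<close> is homogeneous for the grading by the degree in \<open>x\<^sub>l\<close>, then a polynomial in \<open>x\<^sub>l\<close> with non-zero
  constant term is regular modulo \<open>J\<close>: consider the component of least degree outside \<open>J\<close>.
\<close>

lemma univariate_regular_mod_graded:
  fixes J :: "('k::field) poly4 set"
  assumes J: "ideal J poly_ring" and graded: "\<And>n p. p \<in> J \<Longrightarrow> slice l n p \<in> J"
    and g: "coeff g 0 \<noteq> 0" and gw: "univariate l g * w \<in> J"
  shows "w \<in> J"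
proof -
  have "slice l n w \<in> J" for n
  proof (induction n rule: less_induct)
    case (less n)
    define w' where "w' = w - (\<Sum>m<n. slice l m w)"
    define g1 where "g1 = univariate l g - single 0 (coeff g 0)"
    have keys_w': "lookup t l \<ge> n" if "t \<in> keys w'" for t
      using that by (auto simp: w'_def in_keys_iff lookup_minus lookup_sum lookup_slice not_less [symmetric])
    have "slice l n (g1 * w') = 0"
    proof (rule poly_mapping_eqI)
      fix s
      have "s \<notin> keys (g1 * w')" if s: "lookup s l = n"
      proof
        assume "s \<in> keys (g1 * w')"
        then obtain t u where tu: "t \<in> keys g1" "u \<in> keys w'" "s = t + u"
          using keys_mult[of g1 w'] by blast
        then have "lookup t l = 0"
          using keys_w'[OF tu(2)] s by (simp add: lookup_add)
        moreover obtain m where "t = single l m"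
        proof (cases "t = 0")
          case True
          then show thesis
            using that[of 0] by simp
        next
          case False
          then have "t \<in> keys (univariate l g)"
            using tu(1) by (simp add: g1_def in_keys_iff lookup_minus lookup_single)
          then show thesis
            using keys_univariate that by blast
        qed
        ultimately have "t = single l 0"
          by simp
        then have "lookup g1 t = 0"
          using lookup_univariate[of l g 0] by (simp add: g1_def lookup_minus)
        with tu(1) show False
          by (simp add: in_keys_iff)
      qed
      then show "lookup (slice l n (g1 * w')) s = lookup 0 s"
        by (simp add: lookup_slice in_keys_iff)
    qed
    moreover have "univariate l g * w' = single 0 (coeff g 0) * w' + g1 * w'"
      by (simp add: g1_def algebra_simps)
    ultimately have "slice l n (univariate l g * w') = single 0 (coeff g 0) * slice l n w'"
      by (simp add: slice_add slice_single_times)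
    also have "slice l n w' = slice l n w"
      by (rule poly_mapping_eqI) (simp add: w'_def lookup_slice lookup_minus lookup_sum)
    finally have eq: "slice l n (univariate l g * w') = single 0 (coeff g 0) * slice l n w" .
    have "(\<Sum>m<n. slice l m w) \<in> J"
      by (intro ideal_sum[OF J] less) simp
    then have "univariate l g * w' \<in> J"
      unfolding w'_def right_diff_distrib by (intro ideal_diff[OF J gw] ideal_mult_left[OF J])
    then have "single 0 (coeff g 0) * slice l n w \<in> J"
      unfolding eq [symmetric] by (rule graded)
    then have "single 0 (inverse (coeff g 0)) * (single 0 (coeff g 0) * slice l n w) \<in> J"
      by (rule ideal_mult_left[OF J])
    then show ?case
      using g by (simp add: mult.assoc [symmetric] mult_single)
  qed
  then show ?thesis
    using sum_slices[of w l] ideal_sum[OF J] by metis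
qed

lemma not_in_weight_idealI: "t \<in> keys f \<Longrightarrow> weight V t = 0 \<Longrightarrow> f \<notin> weight_ideal V 1"
  by (force simp: weight_ideal_def)

lemma single_eq_single_iff:
  "single i (m::nat) = single j n \<longleftrightarrow> m = n \<and> (i = j \<or> m = 0)"
  by (metis lookup_single_eq lookup_single_not_eq single_zero)

lemma lookup_indet: "lookup (indet i) t = (if t = single i 1 then 1 else 0)"
  by (simp add: indet_def lookup_single when_def)

lemma lookup_univariate_zero: "\<forall>n. t \<noteq> single l n \<Longrightarrow> lookup (univariate l g) t = 0"
  using keys_univariate[of t l g] by (auto simp: in_keys_iff)

text \<open>
  Take \<open>f = x\<^sub>p + x\<^sub>q + h(x\<^sub>r)\<close> with \<open>h(x\<^sub>r)\<close> in \<open>P\<close>: on the line \<open>x\<^sub>p = x\<^sub>q = 0\<close> it restricts to \<open>h\<close>, and on every other line one of the linear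
  terms survives. Since \<open>f\<close> does not involve \<open>x\<^sub>l\<close>, the ideal \<open>I + (f)\<close> is homogeneous in \<open>x\<^sub>l\<close>, and a univariate
  polynomial in \<open>P\<close> is the second element.
\<close>

lemma (in maximal_poly_ideal) regular_pair_off_origin:
  assumes line: "weight_ideal {p, q} 1 \<subseteq> P" "p \<noteq> q" and l: "indet l \<notin> P"
  shows "\<exists>f\<in>P. \<exists>g\<in>P. regular_pair (lines_ideal A) f g"
proof -
  have pq: "indet p \<in> P" "indet q \<in> P"
    using line(1) indet_in_weight_ideal[of p "{p, q}"] indet_in_weight_ideal[of q "{p, q}"] by auto
  then have l_neq: "l \<noteq> p" "l \<noteq> q"
    using l by auto
  obtain r where r: "r \<noteq> p" "r \<noteq> q" "r \<noteq> l"
    by (rule ex_fourth_index)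
  obtain h where h: "h \<noteq> 0" "univariate r h \<in> P"
    using univariate_mem_over_line[OF line r(1,2)] by blast
  obtain g where g: "univariate l g \<in> P" "coeff g 0 \<noteq> 0"
    using univariate_mem_over_line[OF line l_neq] l by blast
  define f where "f = indet p + indet q + univariate r h"
  let ?I = "lines_ideal A :: 'k poly4 set"
  have f_regular: "u \<in> ?I" if "f * u \<in> ?I" for u
  proof (rule lines_ideal_nonzerodivisor[OF that])
    fix i j :: 4 assume ij: "i \<noteq> j"
    show "f \<notin> weight_ideal {i, j} 1"
    proof (cases "r = i \<or> r = j")
      case False
      obtain n where n: "coeff h n \<noteq> 0"
        using h(1) by (metis leading_coeff_0_iff)
      have "lookup f (single r n) = coeff h n"
        using r by (auto simp: f_def lookup_add lookup_indet single_eq_single_iff lookup_univariate)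
      with n False show ?thesis
        by (intro not_in_weight_idealI[of "single r n"]) (auto simp: in_keys_iff weight_single)
    next
      case True
      have "\<exists>k\<in>{p, q}. k \<noteq> i \<and> k \<noteq> j"
        using True r line(2) by auto
      then obtain k where k: "k \<in> {p, q}" "k \<noteq> i" "k \<noteq> j" 
        by blast
      have "lookup (univariate r h) (single k 1) = 0"
        using k(1) r by (intro lookup_univariate_zero) (auto simp: single_eq_single_iff)
      then have "lookup f (single k 1) = 1"
        using k(1) line(2) by (auto simp: f_def lookup_add lookup_indet single_eq_single_iff)
      with k show ?thesis
        by (intro not_in_weight_idealI[of "single k 1"]) (auto simp: in_keys_iff weight_single)
    qed
  qed
  have keys_f: "lookup t l = 0" if "t \<in> keys f" for t
  proof -
    have "t = single p 1 \<or> t = single q 1 \<or> (\<exists>n. t = single r n)"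
      using that lookup_univariate_zero[of t r h]
      by (auto simp: f_def in_keys_iff lookup_add lookup_indet split: if_splits)
    then show ?thesis
      using l_neq r by (auto simp: lookup_single)
  qed
  have "w \<in> ideal_plus ?I f" if "univariate l g * w \<in> ideal_plus ?I f" for w
  proof (rule univariate_regular_mod_graded[OF ideal_sum_principal[OF ideal_lines_ideal] _ g(2) that])
    fix n u assume "u \<in> ideal_plus ?I f"
    then obtain a b where ab: "u = a + f * b" "a \<in> ?I"
      by blast
    then have "slice l n u = slice l n a + f * slice l n b"
      using slice_times[of f l] keys_f by (simp add: slice_add)
    moreover have "slice l n a \<in> ?I"
      using ab(2) keys_slice[of l n a] by (auto simp: lines_ideal_def)
    ultimately show "slice l n u \<in> ideal_plus ?I f"
      by blast
  qed
  with f_regular have "regular_pair ?I f (univariate l g)"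
    by (simp add: regular_pair_def)
  moreover have "f \<in> P"
    unfolding f_def by (intro ideal_add[OF ideal_P] pq h)
  ultimately show ?thesis
    using g(1) by blast
qed

subsection \<open>The irrelevant maximal ideal\<close>

lemma monomial_in_closed_set:
  fixes S :: "('k::field) poly4 set"
  assumes one: "1 \<in> S" and indet: "\<And>i. indet i \<in> S" and mult: "\<And>p q. p \<in> S \<Longrightarrow> q \<in> S \<Longrightarrow> p * q \<in> S"
  shows "single t 1 \<in> S"
proof (induction "weight UNIV t" arbitrary: t)
  case 0
  then have "t = 0"
    by (intro poly_mapping_eqI) (simp add: weight_def)
  then show ?case
    using one by simp
next
  case (Suc n)
  then obtain i s where s: "t = single i 1 + s" "weight UNIV s \<ge> n"
    by (metis order_refl weight_pos_split)
  then have "n = weight UNIV s"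
    using Suc.hyps(2) by (simp add: weight_add weight_single)
  then have "indet i * single s 1 \<in> S"
    by (intro mult indet Suc.hyps(1))
  then show ?case
    by (simp add: s(1) indet_def mult_single)
qed

lemma substitution_constants: "substitution (single 0 :: 'k::field \<Rightarrow> 'k poly4)"
  by unfold_locales (simp_all add: single_add mult_single)

text \<open>Substitution of congruent polynomials for the variables does not change a residue class.\<close>

lemma substitution_congruent:
  fixes J :: "('k::field) poly4 set"
  assumes J: "ideal J poly_ring" and s: "\<And>i. indet i - s i \<in> J"
  shows "p - substitution.insertion (single 0) s p \<in> J"
proof -
  interpret substitution "single 0" s by (rule substitution_constants)
  have closed: "p * q - insertion (p * q) \<in> J" if "p - insertion p \<in> J" "q - insertion q \<in> J" for p q
  proof -
    have "p * (q - insertion q) + insertion q * (p - insertion p) \<in> J"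
      using that by (intro ideal_add[OF J] ideal_mult_left[OF J])
    then show ?thesis
      by (simp add: insertion_mult algebra_simps)
  qed
  have "single t 1 \<in> {p. p - insertion p \<in> J}" for t
    by (rule monomial_in_closed_set) (use ideal_0[OF J] s closed in \<open>auto simp: insertion_1 insertion_indet\<close>)
  moreover have "single 0 a - insertion (single 0 a) \<in> J" for a
    using ideal_0[OF J] by (simp add: insertion_single monomial_value_0)
  ultimately have "single 0 a * single t 1 - insertion (single 0 a * single t 1) \<in> J" for a t
    by (intro closed) auto
  then have monom: "single t a - insertion (single t a) \<in> J" for a t
    by (simp add: mult_single)
  show ?thesis
  proof (induction p rule: poly_mapping_single_induct)
    case zero
    show ?case
      using ideal_0[OF J] by (simp add: insertion_0)
  next
    case (single_add t a p)
    have "(single t a - insertion (single t a)) + (p - insertion p) \<in> J"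
      by (intro ideal_add[OF J] monom single_add)
    then show ?case
      by (simp add: insertion_add algebra_simps)
  qed
qed

text \<open>
  The first two elementary symmetric polynomials restrict on the line with coordinates \<open>x\<^sub>r, x\<^sub>l\<close> to \<open>x\<^sub>r + x\<^sub>l\<close> and \<open>x\<^sub>r x\<^sub>l\<close>, which have no
  common zero except the origin over any field.
\<close>

definition linear_form :: "('k::field) poly4" where
  "linear_form = (\<Sum>i\<in>UNIV. indet i)"

definition quadratic_form :: "('k::field) poly4" where
  "quadratic_form = indet 1 * indet 2 + indet 1 * indet 3 + indet 1 * indet 4 +
    indet 2 * indet 3 + indet 2 * indet 4 + indet 3 * indet 4"

lemma linear_form_notin: "i \<noteq> j \<Longrightarrow> linear_form \<notin> (weight_ideal {i, j} 1 :: ('k::field) poly4 set)"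
proof -
  obtain k where k: "k \<noteq> i" "k \<noteq> j"
    by (rule ex_third_index)
  have "lookup linear_form (single k 1) = (1 :: 'k)"
    by (simp add: linear_form_def lookup_sum lookup_indet single_eq_single_iff)
  with k show ?thesis
    by (intro not_in_weight_idealI[of "single k 1"]) (auto simp: in_keys_iff weight_single)
qed

text \<open>The substitution that eliminates \<open>x\<^sub>l\<close> modulo the linear form.\<close>

definition eliminate :: "4 \<Rightarrow> 4 \<Rightarrow> ('k::field) poly4" where
  "eliminate l i = (if i = l then - (\<Sum>j\<in>UNIV - {l}. indet j) else indet i)"

abbreviation elim_hom :: "4 \<Rightarrow> ('k::field) poly4 \<Rightarrow> 'k poly4" where
  "elim_hom l \<equiv> substitution.insertion (single 0) (eliminate l)"

text \<open>
  The substitution leaves all variables except \<open>x\<^sub>l\<close> fixed, and the lines that are not cut out by \<open>x\<^sub>l\<close> only see those.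
\<close>

lemma eliminate_lines_ideal:
  assumes "p \<in> lines_ideal A"
  shows "elim_hom l p \<in> lines_ideal_off A l"
proof -
  interpret substitution "single 0" "eliminate l :: 4 \<Rightarrow> 'a poly4" by (rule substitution_constants)
  have "monomial_value t \<in> lines_ideal_off A l" if t: "t \<in> keys p" for t
  proof (rule lines_ideal_offI)
    fix i j assume ij: "i \<noteq> j" "i \<noteq> l" "j \<noteq> l"
    have "monomial_value t = eliminate l i ^ lookup t i * (eliminate l j ^ lookup t j *
        (\<Prod>k\<in>UNIV - {i} - {j}. eliminate l k ^ lookup t k))"
      unfolding monomial_value_def using ij by (simp add: prod.remove[of UNIV i] prod.remove[of "UNIV - {i}" j])
    also have "\<dots> = single (single i (lookup t i) + single j (lookup t j)) 1 *
        (\<Prod>k\<in>UNIV - {i} - {j}. eliminate l k ^ lookup t k)"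
      using ij by (simp add: eliminate_def indet_power mult.assoc [symmetric] mult_single)
    also have "\<dots> \<in> weight_ideal {i, j} (A i j)"
    proof (rule ideal_mult_right[OF ideal_weight_ideal])
      have "\<not> bad A t i j"
        using assms t by (auto simp: lines_ideal_def good_def)
      then show "single (single i (lookup t i) + single j (lookup t j)) 1 \<in> weight_ideal {i, j} (A i j)"
        using ij by (simp add: weight_ideal_def weight_add weight_single bad_def)
    qed
    finally show "monomial_value t \<in> weight_ideal {i, j} (A i j)" .
  qed
  then show ?thesis
    unfolding insertion_def by (intro ideal_sum[OF ideal_lines_ideal_off] ideal_mult_left[OF ideal_lines_ideal_off])
qed

text \<open>
  After the elimination of \<open>x\<^sub>l\<close>, the quadratic form takes the value \<open>-1\<close> at the unit vector in direction
  of the fourth variable \<open>x\<^sub>r\<close>, where \<open>x\<^sub>i = x\<^sub>j = 0\<close>.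
\<close>

lemma eliminate_quadratic_form_notin:
  assumes ij: "i \<noteq> j" "i \<noteq> l" "j \<noteq> l"
  shows "elim_hom l quadratic_form \<notin> (weight_ideal {i, j} 1 :: ('k::field) poly4 set)"
proof
  assume mem: "elim_hom l quadratic_form \<in> (weight_ideal {i, j} 1 :: 'k poly4 set)"
  obtain r where r: "r \<noteq> i" "r \<noteq> j" "r \<noteq> l"
    by (rule ex_fourth_index)
  interpret elim: substitution "single 0" "eliminate l :: 4 \<Rightarrow> 'k poly4" by (rule substitution_constants)
  define u :: "4 \<Rightarrow> 'k" where "u k = (if k = r then 1 else 0)" for k
  interpret eval: substitution "\<lambda>a. a" u
    by unfold_locales simp_all
  define v :: "4 \<Rightarrow> 'k" where "v k = (if k = r then 1 else if k = l then - 1 else 0)" for k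
  have "eval.insertion (elim.insertion (indet k)) = v k" for k
  proof (cases "k = l")
    case True
    have "eval.insertion (\<Sum>j\<in>UNIV - {l}. indet j) = 1"
      using r by (simp add: eval.insertion_sum eval.insertion_indet u_def)
    then show ?thesis
      using True r eval.insertion_diff[of 0 "\<Sum>j\<in>UNIV - {l}. indet j"]
      by (simp add: elim.insertion_indet eliminate_def v_def eval.insertion_0)
  next
    case False
    then show ?thesis
      by (simp add: elim.insertion_indet eliminate_def eval.insertion_indet u_def v_def)
  qed
  then have "eval.insertion (elim.insertion quadratic_form) =
      v 1 * v 2 + v 1 * v 3 + v 1 * v 4 + v 2 * v 3 + v 2 * v 4 + v 3 * v 4"
    by (simp add: quadratic_form_def elim.insertion_add elim.insertion_mult eval.insertion_add eval.insertion_mult)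
  also have "\<dots> = - 1"
    using exhaust_four[of r] exhaust_four[of l] r(3) by (elim disjE) (simp_all add: v_def)
  finally have "eval.insertion (elim.insertion quadratic_form) = - 1" .
  moreover have "eval.insertion p = 0" if p: "p \<in> weight_ideal {i, j} 1" for p
  proof -
    have "eval.monomial_value t = 0" if "t \<in> keys p" for t
    proof -
      have "lookup t i \<noteq> 0 \<or> lookup t j \<noteq> 0"
        using p that ij(1) by (fastforce simp: weight_ideal_def weight_pair)
      then obtain k where "k \<in> {i, j}" "lookup t k \<noteq> 0"
        by blast
      then have "u k ^ lookup t k = 0"
        using r by (auto simp: u_def)
      then show ?thesis
        unfolding eval.monomial_value_def by (intro prod_zero) auto
    qed
    then show ?thesis
      by (simp add: eval.insertion_def)
  qed
  ultimately show False
    using mem by force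
qed

text \<open>
  After localization at \<open>x\<^sub>l\<close>, the quadratic form is regular modulo \<open>I\<close> and the linear form: if \<open>x\<^sub>l\<close> is eliminated by means of the linear
  form, then this follows from the restrictions to the lines.
\<close>

lemma power_annihilates_regular:
  fixes w :: "('k::field) poly4"
  assumes N: "\<And>i j. A i j \<le> N" and gw: "quadratic_form * w \<in> ideal_plus (lines_ideal A) linear_form"
  shows "indet l ^ N * w \<in> ideal_plus (lines_ideal A) linear_form"
proof -
  interpret substitution "single 0" "eliminate l :: 4 \<Rightarrow> 'k poly4" by (rule substitution_constants)
  let ?f = "linear_form :: 'k poly4"
  have linear_split: "?f = indet l + (\<Sum>j\<in>UNIV - {l}. indet j)"
    by (simp add: linear_form_def sum.remove[of UNIV l])
  have "insertion ?f = (\<Sum>j\<in>UNIV - {l}. eliminate l j) + eliminate l l"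
    by (simp add: linear_form_def insertion_sum insertion_indet insertion_add sum.remove[of UNIV l] add.commute)
  also have "(\<Sum>j\<in>UNIV - {l}. eliminate l j) = (\<Sum>j\<in>UNIV - {l}. indet j :: 'k poly4)"
    by (intro sum.cong) (auto simp: eliminate_def)
  also have "\<dots> + eliminate l l = 0"
    by (simp add: eliminate_def)
  finally have f0: "insertion ?f = 0" .
  obtain a b where ab: "quadratic_form * w = a + ?f * b" "a \<in> lines_ideal A"
    using gw by blast
  have "insertion quadratic_form * insertion w = insertion a"
    using arg_cong[OF ab(1), of insertion] by (simp add: insertion_mult insertion_add f0)
  then have "insertion quadratic_form * insertion w \<in> lines_ideal_off A l"
    using eliminate_lines_ideal[OF ab(2)] by simp
  then have "insertion w \<in> lines_ideal_off A l"
    by (rule lines_ideal_off_nonzerodivisor) (rule eliminate_quadratic_form_notin)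
  then have "indet l ^ N * insertion w \<in> lines_ideal A"
    using N by (rule lines_ideal_off_times_indet)
  moreover obtain v where v: "w - insertion w = ?f * v"
  proof -
    have J: "ideal (range ((*) ?f)) poly_ring"
      unfolding ideal_type_algebra_iff
    proof (intro conjI ballI allI)
      show "0 \<in> range ((*) ?f)"
        by (rule range_eqI[of _ _ 0]) simp
      show "a + b \<in> range ((*) ?f)" if "a \<in> range ((*) ?f)" "b \<in> range ((*) ?f)" for a b
        using that by (auto simp: distrib_left [symmetric])
      show "r * a \<in> range ((*) ?f)" if "a \<in> range ((*) ?f)" for a r
        using that by (auto simp: mult.left_commute[of r])
    qed
    have "indet i - eliminate l i \<in> range ((*) ?f)" for i
    proof (cases "i = l")
      case True
      then have "indet i - eliminate l i = ?f * 1"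
        by (simp add: eliminate_def linear_split)
      then show ?thesis
        by blast
    next
      case False
      then have "indet i - eliminate l i = ?f * 0"
        by (simp add: eliminate_def)
      then show ?thesis
        by blast
    qed
    then have "w - insertion w \<in> range ((*) ?f)"
      by (intro substitution_congruent[OF J])
    then show thesis
      using that by blast
  qed
  have "indet l ^ N * w = indet l ^ N * insertion w + indet l ^ N * (w - insertion w)"
    by (simp add: algebra_simps)
  then have "indet l ^ N * w = indet l ^ N * insertion w + ?f * (indet l ^ N * v)"
    unfolding v by (simp add: mult_ac)
  ultimately show ?thesis
    by blast
qed

text \<open>
  This is where the cohomology enters. If \<open>x\<^sub>i y \<equiv> f z\<^sub>i\<close> modulo \<open>I\<close> for all \<open>i\<close>, then the fractions \<open>z\<^sub>i / x\<^sub>i\<close> form a cocycle. As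
  no exponent is obstructed, it comes from a polynomial \<open>m\<close>, and this satisfies \<open>y \<equiv> f m\<close>.
\<close>

lemma (in tetrahedron) socle_mod_linear_form_zero:
  fixes f :: "('k::field) poly4"
  assumes none: "\<And>b. \<not> obstructed A b" and f: "\<And>i j. i \<noteq> j \<Longrightarrow> f \<notin> weight_ideal {i, j} 1"
    and y: "\<And>i. indet i * y \<in> ideal_plus (lines_ideal A) f"
  shows "y \<in> ideal_plus (lines_ideal A) f"
proof -
  let ?I = "lines_ideal A :: 'k poly4 set"
  have "\<forall>i. \<exists>u z. indet i * y = u + f * z \<and> u \<in> ?I"
    using y by blast
  then obtain u z where uz: "\<And>i. indet i * y = u i + f * z i" "\<And>i. u i \<in> ?I"
    by metis
  have "indet j * z i - indet i * z j \<in> ?I" for i j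
  proof -
    have "f * (indet j * z i - indet i * z j) = indet j * (f * z i) - indet i * (f * z j)"
      by (simp add: algebra_simps)
    also have "\<dots> = indet j * (indet i * y - u i) - indet i * (indet j * y - u j)"
      by (simp add: uz(1))
    also have "\<dots> = indet i * u j - indet j * u i"
      by (simp add: algebra_simps)
    also have "\<dots> \<in> ?I"
      by (intro ideal_diff[OF ideal_lines_ideal] ideal_mult_left[OF ideal_lines_ideal] uz)
    finally show ?thesis
      using f by (rule lines_ideal_nonzerodivisor)
  qed
  then have z: "cocycle A 1 z"
    by (simp add: cocycle_def)
  then have "splits A 1 z"
    using none by (simp add: splits_iff)
  then obtain m where m: "\<And>i. z i - indet i * m \<in> lines_ideal_off A i"
    by (auto simp: splits_def)
  have "y - f * m \<in> lines_ideal_off A i" for i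
  proof (rule lines_ideal_off_cancel_indet[of i 1])
    have "u i + f * (z i - indet i * m) \<in> lines_ideal_off A i"
      using uz(2)[of i] lines_ideal_subset_off
      by (intro ideal_add[OF ideal_lines_ideal_off] ideal_mult_left[OF ideal_lines_ideal_off] m) blast
    also have "u i + f * (z i - indet i * m) = indet i * y - f * indet i * m"
      using uz(1)[of i] by (simp add: algebra_simps)
    finally show "indet i ^ 1 * (y - f * m) \<in> lines_ideal_off A i"
      by (simp add: algebra_simps)
  qed
  then have "y - f * m \<in> ?I"
    by (rule lines_ideal_if_all_off)
  moreover have "y = (y - f * m) + f * m"
    by simp
  ultimately show ?thesis
    by blast
qed

text \<open>
  If \<open>w\<close> is annihilated by the quadratic form modulo \<open>J = I + (f)\<close>, where \<open>f\<close> is the linear form, then all monomials of high degree annihilate \<open>w\<close>,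
  and descending induction on the degree shows that all monomials do, including \<open>1\<close>.
\<close>

lemma (in tetrahedron) regular_pair_origin:
  assumes none: "\<And>b. \<not> obstructed A b"
  shows "regular_pair (lines_ideal A) (linear_form :: ('k::field) poly4) quadratic_form"
  unfolding regular_pair_def
proof (intro conjI allI impI)
  let ?J = "ideal_plus (lines_ideal A) linear_form :: 'k poly4 set"
  have J: "ideal ?J poly_ring"
    by (rule ideal_sum_principal[OF ideal_lines_ideal])
  show "p \<in> lines_ideal A" if "linear_form * p \<in> lines_ideal A" for p :: "'k poly4"
    using that linear_form_notin by (rule lines_ideal_nonzerodivisor)
  fix w :: "'k poly4" assume gw: "quadratic_form * w \<in> ?J"
  obtain N where N: "\<And>i j. A i j \<le> N"
    using finite_bound_exponents[of A] by blast
  have high: "single t 1 * w \<in> ?J" if t: "weight UNIV t \<ge> 4 * N" for t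
  proof -
    obtain l where "lookup t l \<ge> N"
    proof (rule ccontr)
      assume "\<not> thesis"
      then have "lookup t l < N" for l
        using that by (meson not_le)
      then have "lookup t 1 + lookup t 2 + lookup t 3 + lookup t 4 < N + N + N + N"
        by (intro add_strict_mono)
      with t show False
        by (simp add: total_degree_four)
    qed
    then obtain s where s: "t = single l N + s"
      by (elim exponent_diff[rotated]) (auto simp: lookup_single when_def)
    have "single s 1 * (indet l ^ N * w) \<in> ?J"
      by (rule ideal_mult_left[OF J power_annihilates_regular[OF N gw]])
    then show ?thesis
      by (simp add: s indet_power mult.assoc [symmetric] mult_single add.commute)
  qed
  have "single t 1 * w \<in> ?J" if "weight UNIV t + n \<ge> 4 * N" for t n
    using that
  proof (induction n arbitrary: t)
    case 0
    then show ?case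
      using high by simp
  next
    case (Suc n)
    show ?case
    proof (rule socle_mod_linear_form_zero[OF none linear_form_notin])
      fix i
      have "single (single i 1 + t) 1 * w \<in> ?J"
        using Suc by (intro Suc.IH) (simp add: weight_add weight_single)
      then show "indet i * (single t 1 * w) \<in> ?J"
        by (simp add: indet_def mult.assoc [symmetric] mult_single)
    qed
  qed
  from this[of 0 "4 * N"] show "w \<in> ?J"
    by simp
qed

lemma (in tetrahedron) regular_pair_in_maximal_ideal:
  fixes P :: "('k::field) poly4 set"
  assumes none: "\<And>b. \<not> obstructed A b" and P: "maximal_poly_ideal P"
    and line: "weight_ideal {p, q} 1 \<subseteq> P" "p \<noteq> q"
  shows "\<exists>f\<in>P. \<exists>g\<in>P. regular_pair (lines_ideal A) f g"
proof (cases "\<exists>l. indet l \<notin> P")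
  case True
  then show ?thesis
    using maximal_poly_ideal.regular_pair_off_origin[OF P line] by blast
next
  case False
  interpret maximal_poly_ideal P by (rule P)
  have "linear_form \<in> P" "quadratic_form \<in> P"
    unfolding linear_form_def quadratic_form_def using False
    by (auto intro!: ideal_sum[OF ideal_P] ideal_add[OF ideal_P] ideal_mult_left[OF ideal_P])
  then show ?thesis
    using regular_pair_origin[OF none] by blast
qed

section \<open>The Cohen-Macaulay property of the quotient\<close>

text \<open>
  If at most \<open>x\<^sub>l\<close> were in \<open>Q\<close>, then neither would be a high power of the product of the other variables. But this is in \<open>I\<close>, as every
  line is cut out by at least one of them.
\<close>

lemma prime_contains_line:
  assumes Q: "primeideal Q (poly_ring :: ('k::field) poly4 ring)" and sub: "lines_ideal A \<subseteq> Q"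
  obtains p q :: 4 where "p \<noteq> q" "weight_ideal {p, q} 1 \<subseteq> Q"
proof -
  interpret Q: primeideal Q "poly_ring :: 'k poly4 ring" by (rule Q)
  have "\<exists>p q :: 4. p \<noteq> q \<and> indet p \<in> Q \<and> indet q \<in> Q"
  proof (rule ccontr)
    assume none: "\<nexists>p q :: 4. p \<noteq> q \<and> indet p \<in> Q \<and> indet q \<in> Q"
    obtain l :: 4 where l: "\<And>i. i \<noteq> l \<Longrightarrow> indet i \<notin> Q"
      using none by blast
    obtain N where N: "\<And>i j. A i j \<le> N"
      using finite_bound_exponents[of A] by blast
    define t :: "4 \<Rightarrow>\<^sub>0 nat" where "t = (\<Sum>i\<in>UNIV - {l}. single i N)"
    have "lookup t k = N" if "k \<noteq> l" for k
      using that by (simp add: t_def lookup_sum lookup_single when_def)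
    then have "\<not> bad A t i j" for i j
      using N[of i j] unfolding bad_def by (metis le_add1 le_add2 not_le order_trans)
    then have "single t 1 \<in> Q"
      using sub by (auto simp: lines_ideal_def good_def)
    moreover have "single (\<Sum>i\<in>B. single i N) 1 \<notin> Q" if "l \<notin> B" for B
    proof -
      have "finite B"
        by simp
      then show ?thesis
        using that
      proof induction
        case empty
        then show ?case
          using Q.one_imp_carrier Q.I_notcarr by auto
      next
        case (insert i B)
        have "indet i ^ N \<notin> Q"
          using insert.prems l by (intro prime_power_notin[OF Q]) auto
        moreover have "single (\<Sum>i\<in>B. single i N) 1 \<notin> Q"
          using insert by simp
        ultimately have "indet i ^ N * single (\<Sum>i\<in>B. single i N) 1 \<notin> Q"
          using Q.I_prime[of "indet i ^ N"] by auto
        then show ?case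
          using insert.hyps by (simp add: indet_power mult_single)
      qed
    qed
    ultimately show False
      unfolding t_def by blast
  qed
  then obtain p q :: 4 where pq: "p \<noteq> q" "indet p \<in> Q" "indet q \<in> Q"
    by blast
  have "genideal poly_ring (indet ` {p, q}) \<subseteq> Q"
    using pq Q.genideal_minimal[OF Q.is_ideal] by auto
  then show thesis
    using that pq(1) unfolding genideal_indets by blast
qed

context poly_ideal
begin

abbreviation quot :: "'k poly4 set ring" where
  "quot \<equiv> poly_ring Quot I"

abbreviation proj :: "'k poly4 \<Rightarrow> 'k poly4 set" where
  "proj \<equiv> a_r_coset poly_ring I"

interpretation I: ideal I "poly_ring :: 'k poly4 ring"
  by (rule ideal_I)

lemma cring_quot: "cring quot"
  by (rule I.quotient_is_cring) auto

interpretation quot: cring quot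
  by (rule cring_quot)

interpretation hom: ring_hom_ring "poly_ring :: 'k poly4 ring" quot proj
  by (rule I.rcos_ring_hom_ring)

lemma proj_eq_iff: "proj p = proj q \<longleftrightarrow> p - q \<in> I"
  unfolding a_r_coset_poly by (rule coset_eq_iff[OF ideal_I])

lemma quot_carrier: "carrier quot = range proj"
  by (auto simp: FactRing_def A_RCOSETS_def' )

lemma proj_mult: "proj p \<otimes>\<^bsub>quot\<^esub> proj q = proj (p * q)"
  using hom.hom_mult[of p q] by simp

lemma proj_one: "\<one>\<^bsub>quot\<^esub> = proj 1"
  using hom.hom_one by simp

lemma proj_zero: "\<zero>\<^bsub>quot\<^esub> = proj 0"
  using hom.hom_zero by simp

lemma ideal_preimage:
  assumes "ideal J quot"
  shows "ideal {p. proj p \<in> J} poly_ring"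
  using hom.ideal_vimage[OF assms] by simp

lemma ideal_subset_preimage: "ideal J quot \<Longrightarrow> I \<subseteq> {p. proj p \<in> J}"
proof
  fix p assume J: "ideal J quot" and "p \<in> I"
  then have "proj p = proj 0"
    by (simp add: proj_eq_iff)
  then show "p \<in> {p. proj p \<in> J}"
    using additive_subgroup.zero_closed[OF ideal.axioms(1)[OF J]] by (simp add: proj_zero)
qed

lemma prime_preimage:
  assumes "primeideal Q quot"
  shows "primeideal {p. proj p \<in> Q} poly_ring"
proof (rule primeidealI)
  interpret Q: primeideal Q quot by (rule assms)
  show "ideal {p. proj p \<in> Q} poly_ring"
    by (rule ideal_preimage[OF Q.is_ideal])
  show "cring (poly_ring :: 'k poly4 ring)"
    by auto
  show "carrier poly_ring \<noteq> {p. proj p \<in> Q}"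
  proof
    assume "carrier poly_ring = {p. proj p \<in> Q}"
    then have "\<one>\<^bsub>quot\<^esub> \<in> Q"
      unfolding proj_one by auto
    then show False
      using Q.one_imp_carrier Q.I_notcarr by simp
  qed
  fix a b assume "a \<otimes>\<^bsub>poly_ring\<^esub> b \<in> {p. proj p \<in> Q}"
  then have "proj a \<otimes>\<^bsub>quot\<^esub> proj b \<in> Q"
    by (simp add: proj_mult)
  then show "a \<in> {p. proj p \<in> Q} \<or> b \<in> {p. proj p \<in> Q}"
    using Q.I_prime[of "proj a" "proj b"] by (auto simp: quot_carrier)
qed

lemma maximal_preimage:
  assumes "maximalideal P quot"
  shows "maximal_poly_ideal {p. proj p \<in> P}"
proof (rule maximal_poly_ideal.intro)
  interpret P: maximalideal P quot by (rule assms)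
  let ?P = "{p. proj p \<in> P}"
  show ideal: "ideal ?P poly_ring"
    by (rule ideal_preimage[OF P.is_ideal])
  show "1 \<notin> ?P"
    using P.one_imp_carrier P.I_notcarr by (auto simp: proj_one)
  fix b assume b: "b \<notin> ?P"
  let ?J = "{p + b * q | p q. p \<in> ?P}"
  have "ideal (proj ` ?J) quot"
    by (rule I.ring_ideal_imp_quot_ideal[OF ideal_I ideal_sum_principal[OF ideal]])
  moreover have "P \<subseteq> proj ` ?J"
  proof
    fix x assume x: "x \<in> P"
    then obtain p where "x = proj p"
      using P.a_subset by (auto simp: quot_carrier)
    moreover from this x have "p + b * 0 \<in> ?J"
      by blast
    ultimately show "x \<in> proj ` ?J"
      by auto
  qed
  moreover have "proj ` ?J \<subseteq> carrier quot"
    by (auto simp: quot_carrier)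
  moreover have "proj ` ?J \<noteq> P"
  proof -
    have "0 + b * 1 \<in> ?J"
      using ideal_0[OF ideal] by blast
    then have in_image: "proj (0 + b * 1) \<in> proj ` ?J"
      by (rule imageI)
    show ?thesis
    proof
      assume "proj ` ?J = P"
      from in_image[unfolded this] b show False
        by simp
    qed
  qed
  ultimately have "proj ` ?J = carrier quot"
    using P.I_maximal[of "proj ` ?J"] by (simp only: simp_thms)
  then have "proj 1 \<in> proj ` ?J"
    by (simp add: quot_carrier)
  then obtain p q where pq: "proj 1 = proj (p + b * q)" "p \<in> ?P"
    by blast
  have "1 - (p + b * q) \<in> ?P"
    using pq(1) ideal_subset_preimage[OF P.is_ideal] unfolding proj_eq_iff by blast
  then have "- ((1 - (p + b * q)) + p) \<in> ?P"
    by (intro ideal_uminus[OF ideal] ideal_add[OF ideal] pq)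
  then show "\<exists>w. b * w - 1 \<in> ?P"
    by (intro exI[of _ q]) (simp add: algebra_simps)
qed

lemma noetherian_quot: "noetherian_ring quot"
proof (rule quot.noetherian_ringI)
  fix J assume J: "ideal J quot"
  interpret noetherian_ring "poly_ring :: 'k poly4 ring"
    by (rule noetherian_poly4)
  obtain B where B: "finite B" "{p. proj p \<in> J} = genideal poly_ring B"
    using finetely_gen[OF ideal_preimage[OF J]] by blast
  have B_sub: "B \<subseteq> {p. proj p \<in> J}"
    using I.genideal_self[of B] unfolding B(2) by simp
  have carr: "proj ` B \<subseteq> carrier quot"
    by (auto simp: quot_carrier)
  have G: "ideal (genideal quot (proj ` B)) quot"
    by (rule quot.genideal_ideal[OF carr])
  have "J = genideal quot (proj ` B)"
  proof
    have "genideal poly_ring B \<subseteq> {p. proj p \<in> genideal quot (proj ` B)}"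
      using quot.genideal_self[OF carr] by (intro I.genideal_minimal ideal_preimage[OF G]) auto
    then show "J \<subseteq> genideal quot (proj ` B)"
      using ideal.Icarr[OF J] unfolding B(2) [symmetric] quot_carrier by blast
    show "genideal quot (proj ` B) \<subseteq> J"
      using B_sub by (intro quot.genideal_minimal[OF J]) auto
  qed
  then show "\<exists>B\<subseteq>carrier quot. finite B \<and> J = genideal quot B"
    using B(1) carr by blast
qed

lemma genideal_quot_empty: "proj p \<in> genideal quot {} \<longleftrightarrow> p \<in> I"
proof -
  have "genideal quot {} = {proj 0}"
  proof
    show "genideal quot {} \<subseteq> {proj 0}"
      using quot.genideal_minimal[OF quot.zeroideal] unfolding proj_zero by simp
    have "ideal (genideal quot {}) quot"
      by (rule quot.genideal_ideal) simp
    from additive_subgroup.zero_closed[OF ideal.axioms(1)[OF this]]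
    show "{proj 0} \<subseteq> genideal quot {}"
      unfolding proj_zero by simp
  qed
  then show ?thesis
    by (simp add: proj_eq_iff)
qed

lemma genideal_quot_singleton: "proj p \<in> genideal quot {proj f} \<longleftrightarrow> p \<in> ideal_plus I f"
proof -
  have "genideal quot {proj f} = {x \<otimes>\<^bsub>quot\<^esub> proj f | x. x \<in> carrier quot}"
    using quot.cgenideal_eq_genideal[of "proj f"] by (simp add: quot_carrier cgenideal_def)
  also have "\<dots> = {proj (q * f) | q. True}"
    unfolding quot_carrier using proj_mult by auto
  finally have "proj p \<in> genideal quot {proj f} \<longleftrightarrow> (\<exists>q. p - q * f \<in> I)"
    by (auto simp: proj_eq_iff)
  also have "\<dots> \<longleftrightarrow> p \<in> ideal_plus I f"
  proof
    assume "\<exists>q. p - q * f \<in> I"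
    then obtain q where "p - q * f \<in> I" ..
    then show "p \<in> ideal_plus I f"
      by (intro CollectI exI[of _ "p - q * f"] exI[of _ q]) (simp add: mult.commute)
  next
    assume "p \<in> ideal_plus I f"
    then obtain a q where "p = a + f * q" "a \<in> I"
      by blast
    then show "\<exists>q. p - q * f \<in> I"
      by (intro exI[of _ q]) (simp add: mult.commute)
  qed
  finally show ?thesis .
qed

lemma regular_sequence_quot:
  assumes P: "primeideal P quot" and fg: "proj f \<in> P" "proj g \<in> P" and reg: "regular_pair I f g"
  shows "regular_sequence quot [proj f, proj g]"
  unfolding regular_sequence_def
proof (intro conjI allI impI ballI)
  interpret P: primeideal P quot by (rule P)
  show "set [proj f, proj g] \<subseteq> carrier quot"
    by (auto simp: quot_carrier)
  have "genideal quot (set [proj f, proj g]) \<subseteq> P"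
    using fg by (intro quot.genideal_minimal[OF P.is_ideal]) auto
  then show "genideal quot (set [proj f, proj g]) \<noteq> carrier quot"
    using P.I_notcarr P.a_subset by blast
  fix i a assume i: "i < length [proj f, proj g]" and "a \<in> carrier quot"
    and mem: "[proj f, proj g] ! i \<otimes>\<^bsub>quot\<^esub> a \<in> genideal quot (set (take i [proj f, proj g]))"
  then obtain p where p: "a = proj p"
    by (auto simp: quot_carrier)
  from i have "i = 0 \<or> i = 1"
    by auto
  then show "a \<in> genideal quot (set (take i [proj f, proj g]))"
  proof
    assume "i = 0"
    then show ?thesis
      using mem reg by (simp add: p proj_mult genideal_quot_empty regular_pair_def)
  next
    assume "i = 1"
    then show ?thesis
      using mem reg by (simp add: p proj_mult genideal_quot_singleton regular_pair_def)
  qed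
qed

end

text \<open>
  If no exponent is obstructed, then depth and height of every maximal ideal are equal to two: the depth is at
  least two, the height is at most two, and the depth is at most the height.
\<close>

lemma (in tetrahedron) cohen_macaulay_if_unobstructed:
  assumes none: "\<And>b. \<not> obstructed A b"
  shows "cohen_macaulay_ring ((poly_ring :: ('k::field) poly4 ring) Quot lines_ideal A)"
proof -
  interpret poly_ideal "lines_ideal A :: 'k poly4 set"
    by (rule poly_ideal.intro) (rule ideal_lines_ideal)
  have "ideal_depth quot P = prime_height quot P" if P: "maximalideal P quot" for P
  proof -
    have prime: "primeideal P quot"
      by (rule cring.maximalideal_prime[OF cring_quot P])
    obtain p q :: 4 where pq: "p \<noteq> q" "weight_ideal {p, q} 1 \<subseteq> {u. proj u \<in> P}"
      by (rule prime_contains_line[OF prime_preimage[OF prime] ideal_subset_preimage[OF primeideal.axioms(1)[OF prime]]])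
    obtain f g where fg: "proj f \<in> P" "proj g \<in> P" "regular_pair (lines_ideal A) f g"
      using regular_pair_in_maximal_ideal[OF none maximal_preimage[OF P] pq(2,1)] by blast
    have "enat (length [proj f, proj g]) \<le> ideal_depth quot P"
      unfolding ideal_depth_def using regular_sequence_quot[OF prime fg] fg(1,2)
      by (intro Sup_upper CollectI exI[of _ "[proj f, proj g]"]) auto
    then have depth: "2 \<le> ideal_depth quot P"
      by (simp add: numeral_eq_enat numeral_2_eq_2)
    have length: "n \<le> 2" if Q: "\<forall>i\<le>n. primeideal (Q i) quot" "\<forall>i<n. Q i \<subset> Q (Suc i)"
      for n and Q :: "nat \<Rightarrow> 'k poly4 set set"
    proof (rule ccontr)
      assume "\<not> n \<le> 2"
      define Q' where "Q' i = {u. proj u \<in> Q i}" for i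
      have Q': "primeideal (Q' i) poly_ring" if "i \<le> 3" for i
        unfolding Q'_def using Q(1) that \<open>\<not> n \<le> 2\<close> by (intro prime_preimage) auto
      have strict: "Q' i \<subset> Q' (Suc i)" if "i < 3" for i
      proof -
        have less: "Q i \<subset> Q (Suc i)" and pr: "primeideal (Q (Suc i)) quot"
          using Q that \<open>\<not> n \<le> 2\<close> by auto
        have "Q (Suc i) \<subseteq> range proj"
          using additive_subgroup.a_subset[OF ideal.axioms(1)[OF primeideal.axioms(1)[OF pr]]]
          unfolding quot_carrier .
        with less show ?thesis
          unfolding Q'_def by blast
      qed
      obtain p q :: 4 where pq: "p \<noteq> q" "weight_ideal {p, q} 1 \<subseteq> Q' 0"
      proof (rule prime_contains_line)
        show "primeideal (Q' 0) poly_ring"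
          by (rule Q') simp
        have "primeideal (Q 0) quot"
          using Q(1) by simp
        then show "lines_ideal A \<subseteq> Q' 0"
          unfolding Q'_def by (intro ideal_subset_preimage primeideal.axioms)
      qed (rule that)
      show False
      proof (rule no_prime_chain_of_length_three[where Q = Q', OF Q' _ _ _ pq(2,1)])
        show "Q' 0 \<subset> Q' 1" "Q' 1 \<subset> Q' 2" "Q' 2 \<subset> Q' 3"
          using strict[of 0] strict[of 1] strict[of 2] by (simp_all add: numeral_2_eq_2 numeral_3_eq_3)
      qed
    qed
    have height: "prime_height quot P \<le> 2"
      unfolding prime_height_def
    proof (rule Sup_least)
      fix d assume "d \<in> {enat n | n. \<exists>Q. (\<forall>i\<le>n. primeideal (Q i) quot) \<and> (\<forall>i<n. Q i \<subset> Q (Suc i)) \<and> Q n = P}"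
      then have "\<exists>n\<le>2. d = enat n"
        using length by blast
      then show "d \<le> 2"
        by (auto simp: numeral_eq_enat)
    qed
    from depth height cring.ideal_depth_le_prime_height[OF cring_quot prime] show ?thesis
      by (meson order_antisym order_trans)
  qed
  then show ?thesis
    unfolding cohen_macaulay_ring_def using cring_quot noetherian_quot by blast
qed

section \<open>The invariants of tetrahedral curves\<close>

theorem theorem3p4:
  fixes a1 a2 a3 a4 a5 a6 :: nat
    and I :: "('k::field) poly4 set"
    and A :: int
  assumes "(a1, a2, a3, a4, a5, a6) \<noteq> (0, 0, 0, 0, 0, 0)"
    and "a1 + a6 \<ge> max (a2 + a5) (a3 + a4)"
    and "I = tetrahedral_ideal a1 a2 a3 a4 a5 a6"
    and "A = Max {int a2 + int a5, int a3 + int a4,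
                  int a2 + int a4 - int a6 + 1, int a3 + int a5 - int a6 + 1,
                  int a2 + int a3 - int a1 + 1, int a4 + int a5 - int a1 + 1}"
    and "\<not> arithmetically_cohen_macaulay I"
  shows "int a1 + int a6 - 2 \<ge> A \<and>
         int (k_invariant I) = diam (H1 I) (H1_component I) \<and>
         diam (H1 I) (H1_component I) = int a1 + int a6 - A - 1 \<and>
         has_no_gap (H1 I) (H1_component I)"
proof -
  let ?E = "line_exponent a1 a2 a3 a4 a5 a6"
  note E = line_exponent_simps[of a1 a2 a3 a4 a5 a6]
  interpret tetrahedron ?E
  proof
    show "?E i j = ?E j i" for i j
      by (rule line_exponent_sym)
    show "?E 1 3 + ?E 2 4 \<le> ?E 1 2 + ?E 3 4" "?E 1 4 + ?E 2 3 \<le> ?E 1 2 + ?E 3 4"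
      unfolding E using assms(2) by auto
  qed
  have I: "I = lines_ideal ?E"
    by (simp add: assms(3) tetrahedral_ideal_eq)
  interpret tetrahedron_ring ?E I
    by unfold_locales (rule I)
  have A: "least_degree = A"
    by (simp only: least_degree_def assms(4) E)
  have "\<exists>b. obstructed ?E b"
    using assms(5) cohen_macaulay_if_unobstructed
    unfolding arithmetically_cohen_macaulay_def I by blast
  then obtain b where "obstructed ?E b" ..
  from invariants_if_obstructed[OF this] show ?thesis
    unfolding E A by simp
qed

end
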